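(* Every theorem of $\mathbf{IRS}$ is a theorem of $\mathcal{I}\mathcal{POR}^\lambda$ (under the translation of $\mathcal{RL}$-formulas replacing $\mathtt{0},\mathtt{1},\frown,\times$ by $\mathsf{0},\mathsf{1},\circ,\mathsf{Times}$).
   Context: $\mathcal{RL}$: terms $t::=x\mid\epsilon\mid\mathtt{0}\mid\mathtt{1}\mid t\frown t\mid t\times t$; formulas built from $\mathtt{Flip}(t)$, $t=s$, $t\subseteq s$ with $\neg,\wedge,\vee,\to,\exists,\forall$. $\mathtt{1}^t:=\mathtt{1}\times t$; $(\exists x\preceq t)F:=\exists x(\mathtt{1}^x\subseteq\mathtt{1}^t\wedge F)$; subword quantifiers $(\exists x\subseteq^*t)F:=\exists x\exists w(w\subseteq t\wedge wx\subseteq t\wedge F)$, $(\forall x\subseteq^*t)F:=\forall x(\exists w(w\subseteq t\wedge wx\subseteq t)\to F)$. $\Sigma^b_0$: smallest class containing atomic formulas, closed under Boolean connectives and subword quantifiers; $\Sigma^b_1$: $(\exists x_1\preceq t_1)\cdots(\exists x_n\preceq t_n)F$ with $F\in\Sigma^b_0$. $\mathbf{IRS}$: first-order theory with equality in $\mathcal{RL}$ over intuitionistic predicate logic, with axioms ($\mathtt{b}\in\{\mathtt{0},\mathtt{1}\}$): $x\epsilon=x$; $x(y\mathtt{b})=(xy)\mathtt{b}$; $x\times\epsilon=\epsilon$; $x\times y\mathtt{b}=(x\times y)x$; $x\subseteq\epsilon\leftrightarrow x=\epsilon$; $x\subseteq y\mathtt{b}\leftrightarrow x\subseteq y\vee x=y\mathtt{b}$;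 $x\mathtt{b}=y\mathtt{b}\to x=y$; $x\mathtt{0}\neq y\mathtt{1}$; $x\mathtt{b}\neq\epsilon$; and induction on notation $B(\epsilon)\wedge\forall x(B(x)\to B(x\mathtt{0})\wedge B(x\mathtt{1}))\to\forall xB(x)$ for $\Sigma^b_1$-formulas $B$. $\mathcal{POR}^\lambda$: simply typed $\lambda$-calculus with base type $s$ and constants $\mathsf{0},\mathsf{1},\epsilon:s$; $\circ$ (concatenation, written $xy$); $\mathsf{Tail}:s\Rightarrow s$; $\mathsf{Trunc}:s\Rightarrow s\Rightarrow s$; $\mathsf{Cond}:s\Rightarrow s\Rightarrow s\Rightarrow s\Rightarrow s$; $\mathsf{Flipcoin}:s\Rightarrow s$; $\mathsf{Rec}:s\Rightarrow(s\Rightarrow s\Rightarrow s)\Rightarrow(s\Rightarrow s\Rightarrow s)\Rightarrow(s\Rightarrow s)\Rightarrow s\Rightarrow s$, with equational axioms ($\mathsf{b}\in\{\mathsf{0},\mathsf{1}\}$): $\epsilon x=x\epsilon=x$; $x(y\mathsf{b})=(xy)\mathsf{b}$; $\mathsf{Tail}(\epsilon)=\epsilon$, $\mathsf{Tail}(x\mathsf{b})=x$; $\mathsf{Trunc}(x,\epsilon)=\mathsf{Trunc}(\epsilon,x)=\epsilon$, $\mathsf{Trunc}(x\mathsf{b},y\mathsf{0})=\mathsf{Trunc}(x\mathsf{b},y\mathsf{1})=\mathsf{Trunc}(x,y)\mathsf{b}$; $\mathsf{Cond}(\epsilon,y,z,w)=y$, $\mathsf{Cond}(x\mathsf{0},y,z,w)=z$,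 $\mathsf{Cond}(x\mathsf{1},y,z,w)=w$; $\mathsf{Bool}(\mathsf{Flipcoin}(x))=\mathsf{1}$; $\mathsf{Rec}(x,h_0,h_1,k,\epsilon)=x$, $\mathsf{Rec}(x,h_0,h_1,k,y\mathsf{b})=\mathsf{Trunc}(h_b\,y\,(\mathsf{Rec}(x,h_0,h_1,k,y)),k\,y)$; $\beta$- and $\eta$-axioms in contexts. Here $\mathsf{B}(x):=\mathsf{Cond}(x,\epsilon,\mathsf{0},\mathsf{1})$, $\mathsf{BNeg}(x):=\mathsf{Cond}(x,\epsilon,\mathsf{1},\mathsf{0})$, $\mathsf{BOr}(x,y):=\mathsf{Cond}(\mathsf{B}(x),\mathsf{B}(y),\mathsf{B}(y),\mathsf{1})$, $\mathsf{BAnd}(x,y):=\mathsf{Cond}(\mathsf{B}(x),\epsilon,\mathsf{0},\mathsf{B}(y))$, $\mathsf{Eps}(x):=\mathsf{Cond}(x,\mathsf{1},\mathsf{0},\mathsf{0})$, $\mathsf{Bool}(x):=\mathsf{BAnd}(\mathsf{Eps}(\mathsf{Tail}(x)),\mathsf{BNeg}(\mathsf{Eps}(x)))$; $\mathsf{Conc},\mathsf{Eq},\mathsf{Times},\mathsf{Sub}$ are the $\mathsf{Rec}$-defined terms with $\mathsf{Conc}(x,\epsilon)=x$, $\mathsf{Conc}(x,y\mathsf{b})=\mathsf{Conc}(x,y)\mathsf{b}$; $\mathsf{Eq}(\epsilon,\epsilon)=\mathsf{1}$, $\mathsf{Eq}(\epsilon,y\mathsf{b})=\mathsf{Eq}(x\mathsf{b},\epsilon)=\mathsf{Eq}(x\mathsf{0},y\mathsf{1})=\mathsf{Eq}(x\mathsf{1},y\mathsf{0})=\mathsf{0}$,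 $\mathsf{Eq}(x\mathsf{b},y\mathsf{b})=\mathsf{Eq}(x,y)$; $\mathsf{Times}(x,\epsilon)=\epsilon$, $\mathsf{Times}(x,y\mathsf{b})=\mathsf{Conc}(\mathsf{Times}(x,y),x)$; $\mathsf{Sub}(x,\epsilon)=\mathsf{Eps}(x)$, $\mathsf{Sub}(x,y\mathsf{b})=\mathsf{BOr}(\mathsf{Sub}(x,y),\mathsf{Eq}(x,y\mathsf{b}))$. $\mathcal{I}\mathcal{POR}^\lambda$: first-order intuitionistic theory with equality over $\mathcal{POR}^\lambda$-terms, formulas built from $t=u$, $t\subseteq u$, $\mathtt{Flip}(t)$ with $\wedge,\vee,\to,\forall,\exists$ ($\bot:=\mathsf{0}=\mathsf{1}$, $\neg F:=F\to\bot$); axioms: those of $\mathcal{POR}^\lambda$; $x\subseteq y\leftrightarrow\mathsf{Sub}(x,y)=\mathsf{1}$; $x=\epsilon\vee x=\mathsf{Tail}(x)\mathsf{0}\vee x=\mathsf{Tail}(x)\mathsf{1}$; $\mathsf{0}=\mathsf{1}\to x=\epsilon$; $\mathsf{Cond}(x,y,z,w)=w'\leftrightarrow(x=\epsilon\wedge w'=y)\vee(x=\mathsf{Tail}(x)\mathsf{0}\wedge w'=z)\vee(x=\mathsf{Tail}(x)\mathsf{1}\wedge w'=w)$; $\mathtt{Flip}(x)\leftrightarrow\mathsf{Flipcoin}(x)=\mathsf{1}$; NP-induction $(F(\epsilon)\wedge\forall x(F(x)\to F(x\mathsf{0}))\wedge\forall x(F(x)\to F(x\mathsf{1})))\to\forall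 yF(y)$ for $F$ of the form $(\exists z\preceq t)u=v$ with $t$ containing only first-order open variables.
   Formalization: Times is a primitive constant of POR^λ with its two equations Times(x,ε)=ε and Times(x,yb)=Conc(Times(x,y),x) as axioms, not a Rec-defined term: no such term exists, since Rec truncated by k gives only lengths linear in the arguments. *)

theory Defs
  imports Main
begin

text \<open>
  Both languages use de Bruijn indices: a quantifier or a lambda binds index 0, and an index
  pointing beyond all binders is a free variable.  Substitutions are simultaneous.
\<close>

section \<open>The language \<open>\<R>\<L>\<close>\<close>

datatype rterm =
    RVar nat
  | REps
  | RZero
  | ROne
  | RCat rterm rterm (infixl "\<frown>" 75)
  | RTimes rterm rterm (infixl "\<otimes>" 80)

datatype rform =
    RFlip rterm
  | REq rterm rterm (infix "\<doteq>" 55)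
  | RSub rterm rterm (infix "\<sqsubseteq>" 55)
  | RNeg rform
  | RAnd rform rform
  | ROr rform rform
  | RImp rform rform
  | REx rform
  | RAll rform

abbreviation RIff :: "rform \<Rightarrow> rform \<Rightarrow> rform" where
  "RIff F G \<equiv> RAnd (RImp F G) (RImp G F)"

primrec rtsubst :: "(nat \<Rightarrow> rterm) \<Rightarrow> rterm \<Rightarrow> rterm" where
  "rtsubst \<sigma> (RVar i) = \<sigma> i"
| "rtsubst \<sigma> REps = REps"
| "rtsubst \<sigma> RZero = RZero"
| "rtsubst \<sigma> ROne = ROne"
| "rtsubst \<sigma> (t \<frown> u) = rtsubst \<sigma> t \<frown> rtsubst \<sigma> u"
| "rtsubst \<sigma> (t \<otimes> u) = rtsubst \<sigma> t \<otimes> rtsubst \<sigma> u"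

definition rtshift :: "rterm \<Rightarrow> rterm" where
  "rtshift = rtsubst (\<lambda>i. RVar (Suc i))"

definition rup :: "(nat \<Rightarrow> rterm) \<Rightarrow> nat \<Rightarrow> rterm" where
  "rup \<sigma> = case_nat (RVar 0) (\<lambda>i. rtshift (\<sigma> i))"

primrec rsubst :: "(nat \<Rightarrow> rterm) \<Rightarrow> rform \<Rightarrow> rform" where
  "rsubst \<sigma> (RFlip t) = RFlip (rtsubst \<sigma> t)"
| "rsubst \<sigma> (t \<doteq> u) = (rtsubst \<sigma> t \<doteq> rtsubst \<sigma> u)"
| "rsubst \<sigma> (t \<sqsubseteq> u) = (rtsubst \<sigma> t \<sqsubseteq> rtsubst \<sigma> u)"
| "rsubst \<sigma> (RNeg F) = RNeg (rsubst \<sigma> F)"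
| "rsubst \<sigma> (RAnd F G) = RAnd (rsubst \<sigma> F) (rsubst \<sigma> G)"
| "rsubst \<sigma> (ROr F G) = ROr (rsubst \<sigma> F) (rsubst \<sigma> G)"
| "rsubst \<sigma> (RImp F G) = RImp (rsubst \<sigma> F) (rsubst \<sigma> G)"
| "rsubst \<sigma> (REx F) = REx (rsubst (rup \<sigma>) F)"
| "rsubst \<sigma> (RAll F) = RAll (rsubst (rup \<sigma>) F)"

definition rshift :: "rform \<Rightarrow> rform" where
  "rshift = rsubst (\<lambda>i. RVar (Suc i))"

definition rinst :: "rterm \<Rightarrow> rform \<Rightarrow> rform" where
  "rinst t = rsubst (case_nat t RVar)"

text \<open>If \<open>B\<close> is \<open>B(x)\<close> with \<open>x\<close> of index 0, then \<open>rsucc b B\<close> is \<open>B(x b)\<close>, again with \<open>x\<close> of index 0.\<close>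

definition rsucc :: "rterm \<Rightarrow> rform \<Rightarrow> rform" where
  "rsucc b = rsubst (case_nat (RVar 0 \<frown> b) (\<lambda>i. RVar (Suc i)))"

text \<open>
  In the quantifiers below the bounding term \<open>t\<close> lives outside the scope of the bound
  variable \<open>x\<close>, and \<open>F\<close> has \<open>x\<close> as index 0.  In the existential subword quantifier \<open>x\<close> has
  index 1 and the auxiliary variable \<open>w\<close> has index 0 in the matrix, so \<open>F\<close> is shifted past \<open>w\<close>.
\<close>

definition rbex :: "rterm \<Rightarrow> rform \<Rightarrow> rform" where
  "rbex t F = REx (RAnd (ROne \<otimes> RVar 0 \<sqsubseteq> ROne \<otimes> rtshift t) F)"

definition rsubword_ex :: "rterm \<Rightarrow> rform \<Rightarrow> rform" where
  "rsubword_ex t F =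
    REx (REx (RAnd (RVar 0 \<sqsubseteq> rtshift (rtshift t))
             (RAnd (RVar 0 \<frown> RVar 1 \<sqsubseteq> rtshift (rtshift t))
                   (rshift F))))"

definition rsubword_all :: "rterm \<Rightarrow> rform \<Rightarrow> rform" where
  "rsubword_all t F =
    RAll (RImp (REx (RAnd (RVar 0 \<sqsubseteq> rtshift (rtshift t))
                          (RVar 0 \<frown> RVar 1 \<sqsubseteq> rtshift (rtshift t))))
               F)"

inductive sigma0 :: "rform \<Rightarrow> bool" where
  "sigma0 (RFlip t)"
| "sigma0 (t \<doteq> u)"
| "sigma0 (t \<sqsubseteq> u)"
| "sigma0 F \<Longrightarrow> sigma0 (RNeg F)"
| "sigma0 F \<Longrightarrow> sigma0 G \<Longrightarrow> sigma0 (RAnd F G)"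
| "sigma0 F \<Longrightarrow> sigma0 G \<Longrightarrow> sigma0 (ROr F G)"
| "sigma0 F \<Longrightarrow> sigma0 G \<Longrightarrow> sigma0 (RImp F G)"
| "sigma0 F \<Longrightarrow> sigma0 (rsubword_ex t F)"
| "sigma0 F \<Longrightarrow> sigma0 (rsubword_all t F)"

inductive sigma1 :: "rform \<Rightarrow> bool" where
  "sigma0 F \<Longrightarrow> sigma1 F"
| "sigma1 F \<Longrightarrow> sigma1 (rbex t F)"


section \<open>The theory \<open>IRS\<close>\<close>

text \<open>The open axioms are taken with all term instances.\<close>

inductive irs_axiom :: "rform \<Rightarrow> bool" where
  "irs_axiom (x \<frown> REps \<doteq> x)"
| "b \<in> {RZero, ROne} \<Longrightarrow> irs_axiom (x \<frown> (y \<frown> b) \<doteq> (x \<frown> y) \<frown> b)"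
| "irs_axiom (x \<otimes> REps \<doteq> REps)"
| "b \<in> {RZero, ROne} \<Longrightarrow> irs_axiom (x \<otimes> (y \<frown> b) \<doteq> (x \<otimes> y) \<frown> x)"
| "irs_axiom (RIff (x \<sqsubseteq> REps) (x \<doteq> REps))"
| "b \<in> {RZero, ROne} \<Longrightarrow>
     irs_axiom (RIff (x \<sqsubseteq> y \<frown> b) (ROr (x \<sqsubseteq> y) (x \<doteq> y \<frown> b)))"
| "b \<in> {RZero, ROne} \<Longrightarrow> irs_axiom (RImp (x \<frown> b \<doteq> y \<frown> b) (x \<doteq> y))"
| "irs_axiom (RNeg (x \<frown> RZero \<doteq> y \<frown> ROne))"
| "b \<in> {RZero, ROne} \<Longrightarrow> irs_axiom (RNeg (x \<frown> b \<doteq> REps))"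
| "sigma1 B \<Longrightarrow>
     irs_axiom (RImp (RAnd (rinst REps B)
                           (RAll (RImp B (RAnd (rsucc RZero B) (rsucc ROne B)))))
                     (RAll B))"

text \<open>
  Natural deduction for intuitionistic predicate logic with equality; negation is primitive in
  \<open>\<R>\<L>\<close>, so it has its own introduction and elimination rules.
\<close>

inductive irs :: "rform set \<Rightarrow> rform \<Rightarrow> bool" (infix "\<turnstile>\<^sub>R" 50) where
  Ax: "irs_axiom F \<Longrightarrow> \<Gamma> \<turnstile>\<^sub>R F"
| Assm: "F \<in> \<Gamma> \<Longrightarrow> \<Gamma> \<turnstile>\<^sub>R F"
| NegI: "insert F \<Gamma> \<turnstile>\<^sub>R G \<Longrightarrow> insert F \<Gamma> \<turnstile>\<^sub>R RNeg G \<Longrightarrow> \<Gamma> \<turnstile>\<^sub>R RNeg F"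
| NegE: "\<Gamma> \<turnstile>\<^sub>R F \<Longrightarrow> \<Gamma> \<turnstile>\<^sub>R RNeg F \<Longrightarrow> \<Gamma> \<turnstile>\<^sub>R G"
| AndI: "\<Gamma> \<turnstile>\<^sub>R F \<Longrightarrow> \<Gamma> \<turnstile>\<^sub>R G \<Longrightarrow> \<Gamma> \<turnstile>\<^sub>R RAnd F G"
| AndE1: "\<Gamma> \<turnstile>\<^sub>R RAnd F G \<Longrightarrow> \<Gamma> \<turnstile>\<^sub>R F"
| AndE2: "\<Gamma> \<turnstile>\<^sub>R RAnd F G \<Longrightarrow> \<Gamma> \<turnstile>\<^sub>R G"
| OrI1: "\<Gamma> \<turnstile>\<^sub>R F \<Longrightarrow> \<Gamma> \<turnstile>\<^sub>R ROr F G"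
| OrI2: "\<Gamma> \<turnstile>\<^sub>R G \<Longrightarrow> \<Gamma> \<turnstile>\<^sub>R ROr F G"
| OrE: "\<Gamma> \<turnstile>\<^sub>R ROr F G \<Longrightarrow> insert F \<Gamma> \<turnstile>\<^sub>R H \<Longrightarrow> insert G \<Gamma> \<turnstile>\<^sub>R H \<Longrightarrow> \<Gamma> \<turnstile>\<^sub>R H"
| ImpI: "insert F \<Gamma> \<turnstile>\<^sub>R G \<Longrightarrow> \<Gamma> \<turnstile>\<^sub>R RImp F G"
| ImpE: "\<Gamma> \<turnstile>\<^sub>R RImp F G \<Longrightarrow> \<Gamma> \<turnstile>\<^sub>R F \<Longrightarrow> \<Gamma> \<turnstile>\<^sub>R G"
| AllI: "rshift ` \<Gamma> \<turnstile>\<^sub>R F \<Longrightarrow> \<Gamma> \<turnstile>\<^sub>R RAll F"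
| AllE: "\<Gamma> \<turnstile>\<^sub>R RAll F \<Longrightarrow> \<Gamma> \<turnstile>\<^sub>R rinst t F"
| ExI: "\<Gamma> \<turnstile>\<^sub>R rinst t F \<Longrightarrow> \<Gamma> \<turnstile>\<^sub>R REx F"
| ExE: "\<Gamma> \<turnstile>\<^sub>R REx F \<Longrightarrow> insert F (rshift ` \<Gamma>) \<turnstile>\<^sub>R rshift G \<Longrightarrow> \<Gamma> \<turnstile>\<^sub>R G"
| Refl: "\<Gamma> \<turnstile>\<^sub>R t \<doteq> t"
| Leibniz: "\<Gamma> \<turnstile>\<^sub>R t \<doteq> u \<Longrightarrow> \<Gamma> \<turnstile>\<^sub>R rinst t F \<Longrightarrow> \<Gamma> \<turnstile>\<^sub>R rinst u F"

definition IRS_theorem :: "rform \<Rightarrow> bool" where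
  "IRS_theorem F \<longleftrightarrow> {} \<turnstile>\<^sub>R F"


section \<open>Terms of \<open>\<P>\<O>\<R>\<^sup>\<lambda>\<close>\<close>

datatype ty = Str | Fun ty ty (infixr "\<rightarrow>\<^sub>t" 60)

text \<open>
  The constant \<open>CTimes\<close> is primitive, governed by the two recursion equations of \<open>Times\<close>.
  It is not definable by \<open>Rec\<close> from the other constants: in the standard model the value of
  an eta-long beta-normal term of type \<open>Str\<close> with variables of type \<open>Str\<close> only has length at most
  linear in the lengths of the variables, by induction on the term (the value of
  \<open>Rec x h\<^sub>0 h\<^sub>1 k y\<close> is that of \<open>x\<close> or no longer than that of \<open>k (Tail y)\<close>), whereas
  \<open>Times(x,y)\<close> has length \<open>|x| * |y|\<close>.
\<close>

datatype const =
  CZero | COne | CEps | CCat | CTail | CTrunc | CCond | CFlipcoin | CRec | CTimes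

primrec const_ty :: "const \<Rightarrow> ty" where
  "const_ty CZero = Str"
| "const_ty COne = Str"
| "const_ty CEps = Str"
| "const_ty CCat = Str \<rightarrow>\<^sub>t Str \<rightarrow>\<^sub>t Str"
| "const_ty CTail = Str \<rightarrow>\<^sub>t Str"
| "const_ty CTrunc = Str \<rightarrow>\<^sub>t Str \<rightarrow>\<^sub>t Str"
| "const_ty CCond = Str \<rightarrow>\<^sub>t Str \<rightarrow>\<^sub>t Str \<rightarrow>\<^sub>t Str \<rightarrow>\<^sub>t Str"
| "const_ty CFlipcoin = Str \<rightarrow>\<^sub>t Str"
| "const_ty CRec = Str \<rightarrow>\<^sub>t (Str \<rightarrow>\<^sub>t Str \<rightarrow>\<^sub>t Str) \<rightarrow>\<^sub>t (Str \<rightarrow>\<^sub>t Str \<rightarrow>\<^sub>t Str)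
                   \<rightarrow>\<^sub>t (Str \<rightarrow>\<^sub>t Str) \<rightarrow>\<^sub>t Str \<rightarrow>\<^sub>t Str"
| "const_ty CTimes = Str \<rightarrow>\<^sub>t Str \<rightarrow>\<^sub>t Str"

datatype tm =
    Var nat
  | Const const
  | App tm tm (infixl "\<cdot>" 90)
  | Lam ty tm

abbreviation Zero :: tm where "Zero \<equiv> Const CZero"
abbreviation One :: tm where "One \<equiv> Const COne"
abbreviation Empty :: tm where "Empty \<equiv> Const CEps"
abbreviation Cat :: "tm \<Rightarrow> tm \<Rightarrow> tm" (infixl "\<oplus>" 75) where "t \<oplus> u \<equiv> Const CCat \<cdot> t \<cdot> u"
abbreviation Tail :: "tm \<Rightarrow> tm" where "Tail t \<equiv> Const CTail \<cdot> t"
abbreviation Trunc :: "tm \<Rightarrow> tm \<Rightarrow> tm" where "Trunc t u \<equiv> Const CTrunc \<cdot> t \<cdot> u"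
abbreviation Cond :: "tm \<Rightarrow> tm \<Rightarrow> tm \<Rightarrow> tm \<Rightarrow> tm" where
  "Cond t u v w \<equiv> Const CCond \<cdot> t \<cdot> u \<cdot> v \<cdot> w"
abbreviation Flipcoin :: "tm \<Rightarrow> tm" where "Flipcoin t \<equiv> Const CFlipcoin \<cdot> t"
abbreviation Rec :: "tm \<Rightarrow> tm \<Rightarrow> tm \<Rightarrow> tm \<Rightarrow> tm \<Rightarrow> tm" where
  "Rec x h0 h1 k y \<equiv> Const CRec \<cdot> x \<cdot> h0 \<cdot> h1 \<cdot> k \<cdot> y"
abbreviation Times :: "tm \<Rightarrow> tm \<Rightarrow> tm" where "Times t u \<equiv> Const CTimes \<cdot> t \<cdot> u"

definition ext_env :: "ty \<Rightarrow> (nat \<Rightarrow> ty) \<Rightarrow> nat \<Rightarrow> ty" (infixr ";;" 60) where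
  "\<sigma> ;; E = case_nat \<sigma> E"

inductive typing :: "(nat \<Rightarrow> ty) \<Rightarrow> tm \<Rightarrow> ty \<Rightarrow> bool" ("_ \<turnstile> _ : _" [50, 50, 50] 50) where
  "E \<turnstile> Var i : E i"
| "E \<turnstile> Const c : const_ty c"
| "E \<turnstile> t : \<sigma> \<rightarrow>\<^sub>t \<tau> \<Longrightarrow> E \<turnstile> u : \<sigma> \<Longrightarrow> E \<turnstile> t \<cdot> u : \<tau>"
| "\<sigma> ;; E \<turnstile> t : \<tau> \<Longrightarrow> E \<turnstile> Lam \<sigma> t : \<sigma> \<rightarrow>\<^sub>t \<tau>"

primrec fv :: "tm \<Rightarrow> nat set" where
  "fv (Var i) = {i}"
| "fv (Const c) = {}"
| "fv (t \<cdot> u) = fv t \<union> fv u"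
| "fv (Lam \<sigma> t) = {i. Suc i \<in> fv t}"

primrec ren :: "(nat \<Rightarrow> nat) \<Rightarrow> tm \<Rightarrow> tm" where
  "ren \<rho> (Var i) = Var (\<rho> i)"
| "ren \<rho> (Const c) = Const c"
| "ren \<rho> (t \<cdot> u) = ren \<rho> t \<cdot> ren \<rho> u"
| "ren \<rho> (Lam \<sigma> t) = Lam \<sigma> (ren (case_nat 0 (\<lambda>i. Suc (\<rho> i))) t)"

definition shift :: "tm \<Rightarrow> tm" where
  "shift = ren Suc"

definition up :: "(nat \<Rightarrow> tm) \<Rightarrow> nat \<Rightarrow> tm" where
  "up \<theta> = case_nat (Var 0) (\<lambda>i. shift (\<theta> i))"

primrec subst :: "(nat \<Rightarrow> tm) \<Rightarrow> tm \<Rightarrow> tm" where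
  "subst \<theta> (Var i) = \<theta> i"
| "subst \<theta> (Const c) = Const c"
| "subst \<theta> (t \<cdot> u) = subst \<theta> t \<cdot> subst \<theta> u"
| "subst \<theta> (Lam \<sigma> t) = Lam \<sigma> (subst (up \<theta>) t)"

definition inst :: "tm \<Rightarrow> tm \<Rightarrow> tm" where
  "inst u = subst (case_nat u Var)"


subsection \<open>Defined terms\<close>

definition B_of :: "tm \<Rightarrow> tm" where "B_of x = Cond x Empty Zero One"
definition BNeg :: "tm \<Rightarrow> tm" where "BNeg x = Cond x Empty One Zero"
definition BOr :: "tm \<Rightarrow> tm \<Rightarrow> tm" where "BOr x y = Cond (B_of x) (B_of y) (B_of y) One"
definition BAnd :: "tm \<Rightarrow> tm \<Rightarrow> tm" where "BAnd x y = Cond (B_of x) Empty Zero (B_of y)"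
definition Eps_of :: "tm \<Rightarrow> tm" where "Eps_of x = Cond x One Zero Zero"
definition Bool :: "tm \<Rightarrow> tm" where "Bool x = BAnd (Eps_of (Tail x)) (BNeg (Eps_of x))"

text \<open>
  The terms below are closed.  In the comments, \<open>w\<close> is the recursion argument and \<open>r\<close> the
  value of the recursive call.
\<close>

definition ConcC :: tm where
  \<comment> \<open>\<open>\<lambda>x y. Rec(x, \<lambda>w r. r0, \<lambda>w r. r1, \<lambda>w. xw0, y)\<close>\<close>
  "ConcC = Lam Str (Lam Str
     (Rec (Var 1)
        (Lam Str (Lam Str (Var 0 \<oplus> Zero)))
        (Lam Str (Lam Str (Var 0 \<oplus> One)))
        (Lam Str ((Var 2 \<oplus> Var 0) \<oplus> Zero))
        (Var 0)))"

definition Conc :: "tm \<Rightarrow> tm \<Rightarrow> tm" where "Conc t u = ConcC \<cdot> t \<cdot> u"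

definition DropC :: tm where
  \<comment> \<open>\<open>\<lambda>x y. Rec(x, \<lambda>w r. Tail(r), \<lambda>w r. Tail(r), \<lambda>w. Times(1,x), y)\<close>:
      \<open>x\<close> without its last \<open>|y|\<close> digits\<close>
  "DropC = Lam Str (Lam Str
     (Rec (Var 1)
        (Lam Str (Lam Str (Tail (Var 0))))
        (Lam Str (Lam Str (Tail (Var 0))))
        (Lam Str (Times One (Var 2)))
        (Var 0)))"

definition SameEnd :: "tm \<Rightarrow> tm \<Rightarrow> tm" where
  \<comment> \<open>1 if \<open>t\<close> and \<open>u\<close> are both empty or have the same last digit, else 0\<close>
  "SameEnd t u = Cond t (Cond u One Zero Zero) (Cond u Zero One Zero) (Cond u Zero Zero One)"

text \<open>
  \<open>Rec\<close> has no recursion with changing parameters, so the simultaneous recursion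
  \<open>Eq(xb,yb) = Eq(x,y)\<close>, \<open>Eq(x0,y1) = Eq(x1,y0) = Eq(xb,\<epsilon>) = Eq(\<epsilon>,yb) = 0\<close>, \<open>Eq(\<epsilon>,\<epsilon>) = 1\<close>
  is realised by comparing, for \<open>i = 0,...,|x|\<close>, the ends of \<open>x\<close> and \<open>y\<close> after removal of
  their last \<open>i\<close> digits.
\<close>

definition EqC :: tm where
  \<comment> \<open>\<open>\<lambda>x y. Rec(1, h, h, \<lambda>w. 0, x1)\<close> with
      \<open>h = \<lambda>w r. BAnd(r, SameEnd(Drop(x,w), Drop(y,w)))\<close>\<close>
  "EqC = (let h = Lam Str (Lam Str
            (BAnd (Var 0) (SameEnd (DropC \<cdot> Var 3 \<cdot> Var 1) (DropC \<cdot> Var 2 \<cdot> Var 1))))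
    in Lam Str (Lam Str (Rec One h h (Lam Str Zero) (Var 1 \<oplus> One))))"

definition Eq :: "tm \<Rightarrow> tm \<Rightarrow> tm" where "Eq t u = EqC \<cdot> t \<cdot> u"

definition SubC :: tm where
  \<comment> \<open>\<open>\<lambda>x y. Rec(Eps(x), \<lambda>w r. BOr(r, Eq(x,w0)), \<lambda>w r. BOr(r, Eq(x,w1)), \<lambda>w. 0, y)\<close>\<close>
  "SubC = Lam Str (Lam Str
     (Rec (Eps_of (Var 1))
        (Lam Str (Lam Str (BOr (Var 0) (Eq (Var 3) (Var 1 \<oplus> Zero)))))
        (Lam Str (Lam Str (BOr (Var 0) (Eq (Var 3) (Var 1 \<oplus> One)))))
        (Lam Str Zero)
        (Var 0)))"

definition Sub :: "tm \<Rightarrow> tm \<Rightarrow> tm" where "Sub t u = SubC \<cdot> t \<cdot> u"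


subsection \<open>Equational axioms\<close>

text \<open>Beta and eta in arbitrary, possibly variable-capturing, contexts with one hole.\<close>

inductive beta_eta :: "tm \<Rightarrow> tm \<Rightarrow> bool" where
  beta: "beta_eta (Lam \<sigma> t \<cdot> u) (inst u t)"
| eta: "beta_eta (Lam \<sigma> (shift t \<cdot> Var 0)) t"
| AppL: "beta_eta t t' \<Longrightarrow> beta_eta (t \<cdot> u) (t' \<cdot> u)"
| AppR: "beta_eta u u' \<Longrightarrow> beta_eta (t \<cdot> u) (t \<cdot> u')"
| LamC: "beta_eta t t' \<Longrightarrow> beta_eta (Lam \<sigma> t) (Lam \<sigma> t')"

inductive por_axiom :: "tm \<Rightarrow> tm \<Rightarrow> bool" where
  "por_axiom (Empty \<oplus> x) x"
| "por_axiom (x \<oplus> Empty) x"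
| "b \<in> {Zero, One} \<Longrightarrow> por_axiom (x \<oplus> (y \<oplus> b)) ((x \<oplus> y) \<oplus> b)"
| "por_axiom (Tail Empty) Empty"
| "b \<in> {Zero, One} \<Longrightarrow> por_axiom (Tail (x \<oplus> b)) x"
| "por_axiom (Trunc x Empty) Empty"
| "por_axiom (Trunc Empty x) Empty"
| "b \<in> {Zero, One} \<Longrightarrow> c \<in> {Zero, One} \<Longrightarrow>
     por_axiom (Trunc (x \<oplus> b) (y \<oplus> c)) (Trunc x y \<oplus> b)"
| "por_axiom (Cond Empty y z w) y"
| "por_axiom (Cond (x \<oplus> Zero) y z w) z"
| "por_axiom (Cond (x \<oplus> One) y z w) w"
| "por_axiom (Bool (Flipcoin x)) One"
| "por_axiom (Rec x h0 h1 k Empty) x"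
| "por_axiom (Rec x h0 h1 k (y \<oplus> Zero)) (Trunc (h0 \<cdot> y \<cdot> Rec x h0 h1 k y) (k \<cdot> y))"
| "por_axiom (Rec x h0 h1 k (y \<oplus> One)) (Trunc (h1 \<cdot> y \<cdot> Rec x h0 h1 k y) (k \<cdot> y))"
| "por_axiom (Times x Empty) Empty"
| "b \<in> {Zero, One} \<Longrightarrow> por_axiom (Times x (y \<oplus> b)) (Conc (Times x y) x)"
| "beta_eta t u \<Longrightarrow> por_axiom t u"


section \<open>The theory \<open>\<I>\<P>\<O>\<R>\<^sup>\<lambda>\<close>\<close>

text \<open>
  Equations may be of any type; quantifiers range over the base type \<open>Str\<close>.
  Lambda and the quantifiers share one space of indices.
\<close>

datatype pform =
    PEq tm tm (infix "\<approx>" 55)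
  | PSub tm tm (infix "\<sqsubseteq>\<^sub>P" 55)
  | PFlip tm
  | PAnd pform pform
  | POr pform pform
  | PImp pform pform
  | PEx pform
  | PAll pform

abbreviation PBot :: pform where
  "PBot \<equiv> (Zero \<approx> One)"

abbreviation PNeg :: "pform \<Rightarrow> pform" where
  "PNeg F \<equiv> PImp F PBot"

abbreviation PIff :: "pform \<Rightarrow> pform \<Rightarrow> pform" where
  "PIff F G \<equiv> PAnd (PImp F G) (PImp G F)"

primrec wf_form :: "(nat \<Rightarrow> ty) \<Rightarrow> pform \<Rightarrow> bool" where
  "wf_form E (t \<approx> u) \<longleftrightarrow> (\<exists>\<tau>. (E \<turnstile> t : \<tau>) \<and> (E \<turnstile> u : \<tau>))"
| "wf_form E (t \<sqsubseteq>\<^sub>P u) \<longleftrightarrow> (E \<turnstile> t : Str) \<and> (E \<turnstile> u : Str)"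
| "wf_form E (PFlip t) \<longleftrightarrow> (E \<turnstile> t : Str)"
| "wf_form E (PAnd F G) \<longleftrightarrow> wf_form E F \<and> wf_form E G"
| "wf_form E (POr F G) \<longleftrightarrow> wf_form E F \<and> wf_form E G"
| "wf_form E (PImp F G) \<longleftrightarrow> wf_form E F \<and> wf_form E G"
| "wf_form E (PEx F) \<longleftrightarrow> wf_form (Str ;; E) F"
| "wf_form E (PAll F) \<longleftrightarrow> wf_form (Str ;; E) F"

primrec psubst :: "(nat \<Rightarrow> tm) \<Rightarrow> pform \<Rightarrow> pform" where
  "psubst \<theta> (t \<approx> u) = (subst \<theta> t \<approx> subst \<theta> u)"
| "psubst \<theta> (t \<sqsubseteq>\<^sub>P u) = (subst \<theta> t \<sqsubseteq>\<^sub>P subst \<theta> u)"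
| "psubst \<theta> (PFlip t) = PFlip (subst \<theta> t)"
| "psubst \<theta> (PAnd F G) = PAnd (psubst \<theta> F) (psubst \<theta> G)"
| "psubst \<theta> (POr F G) = POr (psubst \<theta> F) (psubst \<theta> G)"
| "psubst \<theta> (PImp F G) = PImp (psubst \<theta> F) (psubst \<theta> G)"
| "psubst \<theta> (PEx F) = PEx (psubst (up \<theta>) F)"
| "psubst \<theta> (PAll F) = PAll (psubst (up \<theta>) F)"

definition pshift :: "pform \<Rightarrow> pform" where
  "pshift = psubst (\<lambda>i. Var (Suc i))"

definition pinst :: "tm \<Rightarrow> pform \<Rightarrow> pform" where
  "pinst t = psubst (case_nat t Var)"

definition psucc :: "tm \<Rightarrow> pform \<Rightarrow> pform" where
  "psucc b = psubst (case_nat (Var 0 \<oplus> b) (\<lambda>i. Var (Suc i)))"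

definition pbex :: "tm \<Rightarrow> pform \<Rightarrow> pform" where
  "pbex t F = PEx (PAnd (Times One (Var 0) \<sqsubseteq>\<^sub>P Times One (shift t)) F)"

definition np_predicate :: "(nat \<Rightarrow> ty) \<Rightarrow> pform \<Rightarrow> bool" where
  "np_predicate E F \<longleftrightarrow> wf_form E F \<and>
     (\<exists>t u v. F = pbex t (u \<approx> v) \<and> (\<forall>i\<in>fv t. E i = Str))"

inductive ipor_axiom :: "(nat \<Rightarrow> ty) \<Rightarrow> pform \<Rightarrow> bool" for E where
  "por_axiom t u \<Longrightarrow> ipor_axiom E (t \<approx> u)"
| "ipor_axiom E (PIff (x \<sqsubseteq>\<^sub>P y) (Sub x y \<approx> One))"
| "ipor_axiom E (POr (x \<approx> Empty) (POr (x \<approx> Tail x \<oplus> Zero) (x \<approx> Tail x \<oplus> One)))"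
| "ipor_axiom E (PImp (Zero \<approx> One) (x \<approx> Empty))"
| "ipor_axiom E (PIff (Cond x y z w \<approx> w')
     (POr (PAnd (x \<approx> Empty) (w' \<approx> y))
     (POr (PAnd (x \<approx> Tail x \<oplus> Zero) (w' \<approx> z))
          (PAnd (x \<approx> Tail x \<oplus> One) (w' \<approx> w)))))"
| "ipor_axiom E (PIff (PFlip x) (Flipcoin x \<approx> One))"
| "np_predicate (Str ;; E) F \<Longrightarrow>
     ipor_axiom E (PImp (PAnd (pinst Empty F)
                        (PAnd (PAll (PImp F (psucc Zero F)))
                              (PAll (PImp F (psucc One F)))))
                  (PAll F))"

text \<open>
  Natural deduction for intuitionistic predicate logic with equality.  The environment \<open>E\<close>
  gives the types of the free variables; the side conditions keep all formulas well-typed.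
\<close>

inductive ipor :: "(nat \<Rightarrow> ty) \<Rightarrow> pform set \<Rightarrow> pform \<Rightarrow> bool" ("_ | _ \<turnstile>\<^sub>P _" [51, 51, 51] 50) where
  Ax: "ipor_axiom E F \<Longrightarrow> wf_form E F \<Longrightarrow> E | \<Gamma> \<turnstile>\<^sub>P F"
| Assm: "F \<in> \<Gamma> \<Longrightarrow> wf_form E F \<Longrightarrow> E | \<Gamma> \<turnstile>\<^sub>P F"
| BotE: "E | \<Gamma> \<turnstile>\<^sub>P PBot \<Longrightarrow> wf_form E F \<Longrightarrow> E | \<Gamma> \<turnstile>\<^sub>P F"
| AndI: "E | \<Gamma> \<turnstile>\<^sub>P F \<Longrightarrow> E | \<Gamma> \<turnstile>\<^sub>P G \<Longrightarrow> E | \<Gamma> \<turnstile>\<^sub>P PAnd F G"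
| AndE1: "E | \<Gamma> \<turnstile>\<^sub>P PAnd F G \<Longrightarrow> E | \<Gamma> \<turnstile>\<^sub>P F"
| AndE2: "E | \<Gamma> \<turnstile>\<^sub>P PAnd F G \<Longrightarrow> E | \<Gamma> \<turnstile>\<^sub>P G"
| OrI1: "E | \<Gamma> \<turnstile>\<^sub>P F \<Longrightarrow> wf_form E G \<Longrightarrow> E | \<Gamma> \<turnstile>\<^sub>P POr F G"
| OrI2: "E | \<Gamma> \<turnstile>\<^sub>P G \<Longrightarrow> wf_form E F \<Longrightarrow> E | \<Gamma> \<turnstile>\<^sub>P POr F G"
| OrE: "E | \<Gamma> \<turnstile>\<^sub>P POr F G \<Longrightarrow> E | insert F \<Gamma> \<turnstile>\<^sub>P H \<Longrightarrow> E | insert G \<Gamma> \<turnstile>\<^sub>P H \<Longrightarrow> E | \<Gamma> \<turnstile>\<^sub>P H"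
| ImpI: "E | insert F \<Gamma> \<turnstile>\<^sub>P G \<Longrightarrow> wf_form E F \<Longrightarrow> E | \<Gamma> \<turnstile>\<^sub>P PImp F G"
| ImpE: "E | \<Gamma> \<turnstile>\<^sub>P PImp F G \<Longrightarrow> E | \<Gamma> \<turnstile>\<^sub>P F \<Longrightarrow> E | \<Gamma> \<turnstile>\<^sub>P G"
| AllI: "Str ;; E | pshift ` \<Gamma> \<turnstile>\<^sub>P F \<Longrightarrow> E | \<Gamma> \<turnstile>\<^sub>P PAll F"
| AllE: "E | \<Gamma> \<turnstile>\<^sub>P PAll F \<Longrightarrow> E \<turnstile> t : Str \<Longrightarrow> E | \<Gamma> \<turnstile>\<^sub>P pinst t F"
| ExI: "E | \<Gamma> \<turnstile>\<^sub>P pinst t F \<Longrightarrow> E \<turnstile> t : Str \<Longrightarrow> wf_form (Str ;; E) F \<Longrightarrow> E | \<Gamma> \<turnstile>\<^sub>P PEx F"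
| ExE: "E | \<Gamma> \<turnstile>\<^sub>P PEx F \<Longrightarrow> Str ;; E | insert F (pshift ` \<Gamma>) \<turnstile>\<^sub>P pshift G \<Longrightarrow> wf_form E G
         \<Longrightarrow> E | \<Gamma> \<turnstile>\<^sub>P G"
| Refl: "E \<turnstile> t : \<tau> \<Longrightarrow> E | \<Gamma> \<turnstile>\<^sub>P t \<approx> t"
| Leibniz: "E | \<Gamma> \<turnstile>\<^sub>P t \<approx> u \<Longrightarrow> E | \<Gamma> \<turnstile>\<^sub>P pinst t F \<Longrightarrow> E \<turnstile> t : \<tau> \<Longrightarrow> E \<turnstile> u : \<tau>
         \<Longrightarrow> wf_form (\<tau> ;; E) F \<Longrightarrow> E | \<Gamma> \<turnstile>\<^sub>P pinst u F"

text \<open>Theoremhood of a formula whose free variables are all of type \<open>Str\<close>.\<close>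

definition IPOR_theorem :: "pform \<Rightarrow> bool" where
  "IPOR_theorem F \<longleftrightarrow> (\<lambda>_. Str) | {} \<turnstile>\<^sub>P F"


section \<open>The translation\<close>

primrec tr_term :: "rterm \<Rightarrow> tm" where
  "tr_term (RVar i) = Var i"
| "tr_term REps = Empty"
| "tr_term RZero = Zero"
| "tr_term ROne = One"
| "tr_term (t \<frown> u) = tr_term t \<oplus> tr_term u"
| "tr_term (t \<otimes> u) = Times (tr_term t) (tr_term u)"

primrec tr :: "rform \<Rightarrow> pform" where
  "tr (RFlip t) = PFlip (tr_term t)"
| "tr (t \<doteq> u) = (tr_term t \<approx> tr_term u)"
| "tr (t \<sqsubseteq> u) = (tr_term t \<sqsubseteq>\<^sub>P tr_term u)"
| "tr (RNeg F) = PNeg (tr F)"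
| "tr (RAnd F G) = PAnd (tr F) (tr G)"
| "tr (ROr F G) = POr (tr F) (tr G)"
| "tr (RImp F G) = PImp (tr F) (tr G)"
| "tr (REx F) = PEx (tr F)"
| "tr (RAll F) = PAll (tr F)"

end

theory Submission
  imports Defs "HOL-Library.Countable_Set"
begin

text \<open>
  Induction for \<open>\<Sigma>\<^sup>b\<^sub>1\<close> formulas reduces to NP-induction once every \<open>\<Sigma>\<^sup>b\<^sub>0\<close> formula has a
  characteristic term and blocks of bounded existential quantifiers are merged by pairing.  Both,
  and the open axioms, need string arithmetic inside \<open>\<I>\<P>\<O>\<R>\<^sup>\<lambda>\<close>.  Since all the statements
  involved are decidable, this arithmetic is done classically in term models: a formula is
  provable iff it is provable in every consistent prime theory containing the hypotheses, and
  in such a theory equality, disjunction and the digit case distinction behave as in HOL.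
  Equational induction holds in these models whenever its step holds in all of them at once.
  From it the correctness of the comparison \<open>Eq\<close> follows, and then, by searching for the
  last good prefix, induction for decidable predicates within a single model.
\<close>

section \<open>Substitution and typing\<close>

text \<open>A world need not have witnesses for its existential theorems and need not settle
  implications: only equations, inclusions, \<open>PFlip\<close> and disjunctions can be read off
  it. Other connectives enter HOL through characteristic terms, and a hypothesis is handled by
  passing to all worlds that contain it. Equational induction needs a derivable step with fixed
  parameters. Hence each early lemma is a single equation, with \<open>Cond\<close> as a guard to
  express an implication, and a simultaneous recursion such as that of \<open>Eq\<close> needs a
  detour. \<open>Rec\<close> cuts every recursive value down to a bound, so the intended recursion
  equations hold only once the values are known to fit. No length order is available at that stage;
  that a value fits is expressed by exhibiting it as a factor of the string whose length is the
  bound. This is the origin of \<open>SufC\<close>. A step that holds for the elements of one world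
  is not derivable. But once equality is computed correctly, a term can compute from
  \<open>n\<close> the place where the step would fail, and "\<open>n\<close> is good or the step
  fails there" is again one equation, provable uniformly.\<close>

lemma ren_eq_subst: "ren \<rho> t = subst (\<lambda>i. Var (\<rho> i)) t"
proof (induction t arbitrary: \<rho>)
  case (Lam \<sigma> t)
  have "up (\<lambda>i. Var (\<rho> i)) = (\<lambda>i. Var (case_nat 0 (\<lambda>i. Suc (\<rho> i)) i))"
    by (auto simp: up_def shift_def fun_eq_iff split: nat.splits)
  then show ?case using Lam by simp
qed auto

lemma shift_eq_subst: "shift t = subst (\<lambda>i. Var (Suc i)) t"
  by (simp add: shift_def ren_eq_subst)

lemma up_Var: "up Var = Var"
  by (auto simp: up_def shift_def fun_eq_iff split: nat.splits)

lemma subst_Var [simp]: "subst Var t = t"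
  by (induction t) (auto simp: up_Var)

lemma subst_ren: "subst \<theta> (ren \<rho> t) = subst (\<lambda>i. \<theta> (\<rho> i)) t"
proof (induction t arbitrary: \<theta> \<rho>)
  case (Lam \<sigma> t)
  have "(\<lambda>i. up \<theta> (case_nat 0 (\<lambda>i. Suc (\<rho> i)) i)) = up (\<lambda>i. \<theta> (\<rho> i))"
    by (auto simp: up_def fun_eq_iff split: nat.splits)
  then show ?case using Lam by simp
qed auto

lemma ren_ren: "ren \<rho> (ren \<rho>' t) = ren (\<lambda>i. \<rho> (\<rho>' i)) t"
  by (simp only: ren_eq_subst[of \<rho>] subst_ren) (simp only: ren_eq_subst)

lemma ren_subst: "ren \<rho> (subst \<theta> t) = subst (\<lambda>i. ren \<rho> (\<theta> i)) t"
proof (induction t arbitrary: \<theta> \<rho>)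
  case (Lam \<sigma> t)
  have "(\<lambda>i. ren (case_nat 0 (\<lambda>i. Suc (\<rho> i))) (up \<theta> i)) = up (\<lambda>i. ren \<rho> (\<theta> i))"
    by (auto simp: up_def fun_eq_iff shift_def ren_ren split: nat.splits)
  then show ?case using Lam by simp
qed auto

lemma subst_subst: "subst \<theta> (subst \<eta> t) = subst (\<lambda>i. subst \<theta> (\<eta> i)) t"
proof (induction t arbitrary: \<theta> \<eta>)
  case (Lam \<sigma> t)
  have "(\<lambda>i. subst (up \<theta>) (up \<eta> i)) = up (\<lambda>i. subst \<theta> (\<eta> i))"
    by (auto simp: up_def fun_eq_iff shift_def subst_ren ren_subst split: nat.splits)
  then show ?case using Lam by simp
qed auto

lemma subst_up_shift: "subst (up \<theta>) (shift t) = shift (subst \<theta> t)"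
  by (simp add: shift_def subst_ren ren_subst up_def)

lemma subst_case_shift [simp]: "subst (case_nat u \<theta>) (shift t) = subst \<theta> t"
  by (simp add: shift_def subst_ren)

lemma subst_up_subst: "subst (case_nat u \<theta>) (subst (up \<eta>) t) = subst (case_nat u (\<lambda>i. subst \<theta> (\<eta> i))) t"
  by (auto simp: subst_subst up_def fun_eq_iff split: nat.splits intro!: arg_cong[where f="\<lambda>f. subst f t"])

lemma subst_inst: "subst \<theta> (inst u t) = inst (subst \<theta> u) (subst (up \<theta>) t)"
proof -
  have "(\<lambda>i. subst \<theta> (case_nat u Var i)) = (\<lambda>i. subst (case_nat (subst \<theta> u) Var) (up \<theta> i))"
    by (auto simp: fun_eq_iff up_def split: nat.splits)
  then show ?thesis by (simp add: inst_def subst_subst)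
qed

lemma subst_cong_fv: "(\<And>i. i \<in> fv t \<Longrightarrow> \<theta> i = \<eta> i) \<Longrightarrow> subst \<theta> t = subst \<eta> t"
proof (induction t arbitrary: \<theta> \<eta>)
  case (Lam \<sigma> t)
  have "subst (up \<theta>) t = subst (up \<eta>) t"
    by (rule Lam.IH) (auto simp: up_def Lam.prems split: nat.splits)
  then show ?case by simp
next
  case (App t u)
  then have "subst \<theta> t = subst \<eta> t" "subst \<theta> u = subst \<eta> u" by (metis UnCI fv.simps(3))+
  then show ?case by simp
qed simp_all

lemma subst_closed: "fv t = {} \<Longrightarrow> subst \<theta> t = t"
  using subst_cong_fv[of t \<theta> Var] by simp

lemma finite_fv: "finite (fv t)"
proof (induction t)
  case (Lam \<sigma> t)
  have "Suc ` {i. Suc i \<in> fv t} \<subseteq> fv t" by auto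
  then have "finite (Suc ` {i. Suc i \<in> fv t})" using Lam finite_subset by blast
  then show ?case by (simp add: finite_image_iff)
qed auto

lemma psubst_psubst: "psubst \<theta> (psubst \<eta> F) = psubst (\<lambda>i. subst \<theta> (\<eta> i)) F"
proof (induction F arbitrary: \<theta> \<eta>)
  case (PEx F)
  have "(\<lambda>i. subst (up \<theta>) (up \<eta> i)) = up (\<lambda>i. subst \<theta> (\<eta> i))"
    by (auto simp: up_def fun_eq_iff shift_def subst_ren ren_subst split: nat.splits)
  then show ?case using PEx by simp
next
  case (PAll F)
  have "(\<lambda>i. subst (up \<theta>) (up \<eta> i)) = up (\<lambda>i. subst \<theta> (\<eta> i))"
    by (auto simp: up_def fun_eq_iff shift_def subst_ren ren_subst split: nat.splits)
  then show ?case using PAll by simp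
qed (auto simp: subst_subst)

lemma psubst_Var [simp]: "psubst Var F = F"
  by (induction F) (auto simp: up_Var)

lemma psubst_up_pshift: "psubst (up \<theta>) (pshift F) = pshift (psubst \<theta> F)"
  by (simp add: pshift_def psubst_psubst up_def shift_eq_subst)

lemma psubst_pinst: "psubst \<theta> (pinst t F) = pinst (subst \<theta> t) (psubst (up \<theta>) F)"
proof -
  have "(\<lambda>i. subst \<theta> (case_nat t Var i)) = (\<lambda>i. subst (case_nat (subst \<theta> t) Var) (up \<theta> i))"
    by (auto simp: fun_eq_iff up_def split: nat.splits)
  then show ?thesis by (simp add: pinst_def psubst_psubst)
qed

lemma psubst_psucc:
  assumes "fv b = {}"
  shows "psubst (up \<theta>) (psucc b F) = psucc b (psubst (up \<theta>) F)"
proof -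
  have "(\<lambda>i. subst (up \<theta>) (case_nat (Var 0 \<oplus> b) (\<lambda>i. Var (Suc i)) i)) =
    (\<lambda>i. subst (case_nat (Var 0 \<oplus> b) (\<lambda>i. Var (Suc i))) (up \<theta> i))"
    using assms by (auto simp: fun_eq_iff up_def subst_closed shift_eq_subst subst_subst split: nat.splits)
  then show ?thesis by (simp add: psucc_def psubst_psubst)
qed

lemma psubst_pbex: "psubst \<theta> (pbex t F) = pbex (subst \<theta> t) (psubst (up \<theta>) F)"
  by (simp add: pbex_def subst_up_shift) (simp add: up_def)

inductive_simps typing_simps [simp]:
  "E \<turnstile> Var i : \<tau>"
  "E \<turnstile> Const c : \<tau>"
  "E \<turnstile> Lam \<sigma> t : \<tau>"

\<comment> \<open>Not a simp rule, since it introduces an existentially quantified argument type;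
  the applications of constants get rules of their own in \<open>typing_str_simps\<close>.\<close>
inductive_simps typing_App: "E \<turnstile> t \<cdot> u : \<tau>"

lemma typing_ren: "E \<turnstile> t : \<tau> \<Longrightarrow> (\<And>i. E' (\<rho> i) = E i) \<Longrightarrow> E' \<turnstile> ren \<rho> t : \<tau>"
proof (induction E t \<tau> arbitrary: E' \<rho> rule: typing.induct)
  case (4 \<sigma> E t \<tau>)
  have "\<sigma> ;; E' \<turnstile> ren (case_nat 0 (\<lambda>i. Suc (\<rho> i))) t : \<tau>"
    by (rule 4) (auto simp: ext_env_def 4 split: nat.splits)
  then show ?case by simp
next
  case (3 E t \<sigma> \<tau> u)
  have "E' \<turnstile> ren \<rho> t : \<sigma> \<rightarrow>\<^sub>t \<tau>" "E' \<turnstile> ren \<rho> u : \<sigma>" by (rule 3; rule 3)+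
  then show ?case by (auto simp: typing_App)
qed auto

lemma typing_shift: "E \<turnstile> t : \<tau> \<Longrightarrow> \<sigma> ;; E \<turnstile> shift t : \<tau>"
  by (auto simp: shift_def ext_env_def intro!: typing_ren)

lemma typing_up:
  "(\<And>i. E' \<turnstile> \<theta> i : E i) \<Longrightarrow> \<sigma> ;; E' \<turnstile> up \<theta> i : (\<sigma> ;; E) i"
  using typing_shift by (auto simp: up_def split: nat.splits) (auto simp: ext_env_def)

lemma typing_subst: "E \<turnstile> t : \<tau> \<Longrightarrow> (\<And>i. E' \<turnstile> \<theta> i : E i) \<Longrightarrow> E' \<turnstile> subst \<theta> t : \<tau>"
proof (induction E t \<tau> arbitrary: E' \<theta> rule: typing.induct)
  case (4 \<sigma> E t \<tau>)
  have "\<sigma> ;; E' \<turnstile> subst (up \<theta>) t : \<tau>"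
    by (rule 4) (rule typing_up, rule 4)
  then show ?case by simp
next
  case (3 E t \<sigma> \<tau> u)
  have "E' \<turnstile> subst \<theta> t : \<sigma> \<rightarrow>\<^sub>t \<tau>" "E' \<turnstile> subst \<theta> u : \<sigma>" by (rule 3; rule 3)+
  then show ?case by (auto simp: typing_App)
qed auto

lemma wf_psubst: "wf_form E F \<Longrightarrow> (\<And>i. E' \<turnstile> \<theta> i : E i) \<Longrightarrow> wf_form E' (psubst \<theta> F)"
proof (induction F arbitrary: E E' \<theta>)
  case (PEx F)
  have "wf_form (Str ;; E') (psubst (up \<theta>) F)"
    by (rule PEx.IH[of "Str ;; E"]) (use PEx.prems typing_up in auto)
  then show ?case by simp
next
  case (PAll F)
  have "wf_form (Str ;; E') (psubst (up \<theta>) F)"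
    by (rule PAll.IH[of "Str ;; E"]) (use PAll.prems typing_up in auto)
  then show ?case by simp
qed (auto, (metis typing_subst)+)

lemma wf_pinst: "wf_form (\<tau> ;; E) F \<Longrightarrow> E \<turnstile> t : \<tau> \<Longrightarrow> wf_form E (pinst t F)"
  unfolding pinst_def
  by (erule wf_psubst) (auto simp: ext_env_def split: nat.splits)

lemma wf_pshift: "wf_form E F \<Longrightarrow> wf_form (\<sigma> ;; E) (pshift F)"
  unfolding pshift_def by (erule wf_psubst) (auto simp: ext_env_def)


section \<open>Structural properties of derivations\<close>

lemma ipor_weaken: "E | \<Gamma> \<turnstile>\<^sub>P F \<Longrightarrow> \<Gamma> \<subseteq> \<Delta> \<Longrightarrow> E | \<Delta> \<turnstile>\<^sub>P F"
proof (induction E \<Gamma> F arbitrary: \<Delta> rule: ipor.induct)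
  case (Assm F \<Gamma> E)
  then show ?case by (intro ipor.Assm) auto
next
  case (OrE E \<Gamma> F G H)
  have "insert F \<Gamma> \<subseteq> insert F \<Delta>" "insert G \<Gamma> \<subseteq> insert G \<Delta>" using OrE.prems by auto
  then show ?case by (rule ipor.OrE[OF OrE.IH(1)[OF OrE.prems] OrE.IH(2) OrE.IH(3)])
next
  case (ImpI E F \<Gamma> G)
  have "insert F \<Gamma> \<subseteq> insert F \<Delta>" using ImpI.prems by auto
  then show ?case using ImpI.hyps by (intro ipor.ImpI ImpI.IH)
next
  case (AllI E \<Gamma> F)
  show ?case by (intro ipor.AllI AllI.IH image_mono AllI.prems)
next
  case (ExE E \<Gamma> F G)
  have "insert F (pshift ` \<Gamma>) \<subseteq> insert F (pshift ` \<Delta>)" using ExE.prems by auto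
  then show ?case by (rule ipor.ExE[OF ExE.IH(1)[OF ExE.prems] ExE.IH(2) ExE.hyps(3)])
qed (metis ipor.Ax, metis ipor.BotE, metis ipor.AndI, metis ipor.AndE1, metis ipor.AndE2, metis ipor.OrI1, metis ipor.OrI2, metis ipor.ImpE, metis ipor.AllE, metis ipor.ExI, metis ipor.Refl, metis ipor.Leibniz)

lemma ipor_wf: "E | \<Gamma> \<turnstile>\<^sub>P F \<Longrightarrow> wf_form E F"
  by (induction E \<Gamma> F rule: ipor.induct) (auto intro: wf_pinst)

text \<open>Compactness, for the unions of chains in \<open>lindenbaum\<close>. Under a quantifier
  the hypotheses are shifted; a finite set of shifted hypotheses is the image of a finite set of
  hypotheses.\<close>

lemma ipor_finite: "E | \<Gamma> \<turnstile>\<^sub>P F \<Longrightarrow> \<exists>\<Delta>. finite \<Delta> \<and> \<Delta> \<subseteq> \<Gamma> \<and> (E | \<Delta> \<turnstile>\<^sub>P F)"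
proof (induction E \<Gamma> F rule: ipor.induct)
  case (Ax E F \<Gamma>)
  then show ?case by (auto intro: ipor.Ax exI[of _ "{}"])
next
  case (Assm F \<Gamma> E)
  then show ?case by (auto intro: ipor.Assm exI[of _ "{F}"])
next
  case (BotE E \<Gamma> F)
  then show ?case by (auto intro: ipor.BotE)
next
  case (AndI E \<Gamma> F G)
  then obtain \<Delta> \<Delta>' where *: "finite \<Delta>" "\<Delta> \<subseteq> \<Gamma>" "E | \<Delta> \<turnstile>\<^sub>P F" "finite \<Delta>'" "\<Delta>' \<subseteq> \<Gamma>" "E | \<Delta>' \<turnstile>\<^sub>P G"
    by blast
  then have "E | \<Delta> \<union> \<Delta>' \<turnstile>\<^sub>P F" "E | \<Delta> \<union> \<Delta>' \<turnstile>\<^sub>P G" by (auto intro: ipor_weaken)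
  then show ?case using * by (intro exI[of _ "\<Delta> \<union> \<Delta>'"]) (auto intro: ipor.AndI)
next
  case (OrE E \<Gamma> F G H)
  then obtain A B C where *: "finite A" "A \<subseteq> \<Gamma>" "E | A \<turnstile>\<^sub>P POr F G"
    "finite B" "B \<subseteq> insert F \<Gamma>" "E | B \<turnstile>\<^sub>P H" "finite C" "C \<subseteq> insert G \<Gamma>" "E | C \<turnstile>\<^sub>P H"
    by blast
  let ?D = "A \<union> (B - {F}) \<union> (C - {G})"
  have "E | ?D \<turnstile>\<^sub>P POr F G" "E | insert F ?D \<turnstile>\<^sub>P H" "E | insert G ?D \<turnstile>\<^sub>P H"
    using *(3) *(6) *(9) by (elim ipor_weaken; blast)+
  then have "E | ?D \<turnstile>\<^sub>P H" by (rule ipor.OrE)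
  then show ?case using * by (intro exI[of _ ?D]) auto
next
  case (ImpI E F \<Gamma> G)
  then obtain B where *: "finite B" "B \<subseteq> insert F \<Gamma>" "E | B \<turnstile>\<^sub>P G" by blast
  then have "E | insert F (B - {F}) \<turnstile>\<^sub>P G" by (auto elim!: ipor_weaken)
  then have "E | B - {F} \<turnstile>\<^sub>P PImp F G" using ImpI by (auto intro: ipor.ImpI)
  then show ?case using * by (intro exI[of _ "B - {F}"]) auto
next
  case (ImpE E \<Gamma> F G)
  then obtain \<Delta> \<Delta>' where *: "finite \<Delta>" "\<Delta> \<subseteq> \<Gamma>" "E | \<Delta> \<turnstile>\<^sub>P PImp F G" "finite \<Delta>'" "\<Delta>' \<subseteq> \<Gamma>" "E | \<Delta>' \<turnstile>\<^sub>P F"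
    by blast
  then have "E | \<Delta> \<union> \<Delta>' \<turnstile>\<^sub>P PImp F G" "E | \<Delta> \<union> \<Delta>' \<turnstile>\<^sub>P F" by (auto intro: ipor_weaken)
  then show ?case using * by (intro exI[of _ "\<Delta> \<union> \<Delta>'"]) (auto intro: ipor.ImpE)
next
  case (AllI E \<Gamma> F)
  then obtain B where *: "finite B" "B \<subseteq> pshift ` \<Gamma>" "Str ;; E | B \<turnstile>\<^sub>P F" by blast
  then obtain C where "C \<subseteq> \<Gamma>" "finite C" "B = pshift ` C" by (meson finite_subset_image)
  then show ?case using * by (auto intro: ipor.AllI)
next
  case (ExE E \<Gamma> F G)
  then obtain A B where *: "finite A" "A \<subseteq> \<Gamma>" "E | A \<turnstile>\<^sub>P PEx F"
    "finite B" "B \<subseteq> insert F (pshift ` \<Gamma>)" "Str ;; E | B \<turnstile>\<^sub>P pshift G" by blast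
  then have "B - {F} \<subseteq> pshift ` \<Gamma>" "finite (B - {F})" by auto
  then obtain C where C: "C \<subseteq> \<Gamma>" "finite C" "B - {F} = pshift ` C" by (meson finite_subset_image)
  have "E | A \<union> C \<turnstile>\<^sub>P PEx F" using * by (auto intro: ipor_weaken)
  moreover have "Str ;; E | insert F (pshift ` (A \<union> C)) \<turnstile>\<^sub>P pshift G"
    using *(6) by (rule ipor_weaken) (use C in auto)
  ultimately have "E | A \<union> C \<turnstile>\<^sub>P G" using ExE by (auto intro: ipor.ExE)
  then show ?case using * C by (intro exI[of _ "A \<union> C"]) auto
next
  case (Leibniz E \<Gamma> t u F \<tau>)
  then obtain \<Delta> \<Delta>' where *: "finite \<Delta>" "\<Delta> \<subseteq> \<Gamma>" "E | \<Delta> \<turnstile>\<^sub>P t \<approx> u" "finite \<Delta>'" "\<Delta>' \<subseteq> \<Gamma>" "E | \<Delta>' \<turnstile>\<^sub>P pinst t F"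
    by blast
  then have "E | \<Delta> \<union> \<Delta>' \<turnstile>\<^sub>P t \<approx> u" "E | \<Delta> \<union> \<Delta>' \<turnstile>\<^sub>P pinst t F" by (auto intro: ipor_weaken)
  then show ?case using * Leibniz by (intro exI[of _ "\<Delta> \<union> \<Delta>'"]) (auto intro: ipor.Leibniz)
qed (metis ipor.AndE1, metis ipor.AndE2, metis ipor.OrI1, metis ipor.OrI2, metis ipor.AllE, metis ipor.ExI, metis ipor.Refl finite.emptyI empty_subsetI)

section \<open>Closure of derivability under substitution of string terms\<close>

definition strs :: "nat \<Rightarrow> ty" where
  "strs = (\<lambda>_. Str)"

lemma strs_apply [simp]: "strs i = Str"
  by (simp add: strs_def)

text \<open>A quantifier leaves this environment unchanged, so all later derivations can stay in it,
  and admissible substitutions are just those with string terms as values.\<close>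

lemma ext_strs [simp]: "Str ;; strs = strs"
  by (auto simp: strs_def ext_env_def fun_eq_iff split: nat.splits)

lemma subst_combinators [simp]:
  "subst \<theta> ConcC = ConcC" "subst \<theta> DropC = DropC" "subst \<theta> EqC = EqC" "subst \<theta> SubC = SubC"
  by (rule subst_closed; auto simp: ConcC_def DropC_def EqC_def SubC_def Let_def BAnd_def BOr_def
      B_of_def SameEnd_def Eps_of_def Eq_def)+

lemma subst_defined [simp]:
  "subst \<theta> (B_of t) = B_of (subst \<theta> t)"
  "subst \<theta> (BNeg t) = BNeg (subst \<theta> t)"
  "subst \<theta> (BOr t u) = BOr (subst \<theta> t) (subst \<theta> u)"
  "subst \<theta> (BAnd t u) = BAnd (subst \<theta> t) (subst \<theta> u)"
  "subst \<theta> (Eps_of t) = Eps_of (subst \<theta> t)"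
  "subst \<theta> (Bool t) = Bool (subst \<theta> t)"
  "subst \<theta> (Conc t u) = Conc (subst \<theta> t) (subst \<theta> u)"
  "subst \<theta> (Eq t u) = Eq (subst \<theta> t) (subst \<theta> u)"
  "subst \<theta> (Sub t u) = Sub (subst \<theta> t) (subst \<theta> u)"
  by (simp_all add: B_of_def BNeg_def BOr_def BAnd_def Eps_of_def Bool_def Conc_def Eq_def Sub_def)

lemma beta_eta_subst: "beta_eta t u \<Longrightarrow> beta_eta (subst \<theta> t) (subst \<theta> u)"
proof (induction arbitrary: \<theta> rule: beta_eta.induct)
  case (beta \<sigma> t u)
  show ?case by (simp add: subst_inst beta_eta.beta)
next
  case (eta \<sigma> t)
  show ?case using beta_eta.eta[of \<sigma> "subst \<theta> t"] by (simp add: subst_up_shift) (simp add: up_def)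
qed (auto intro: beta_eta.intros)

lemma por_axiom_subst: "por_axiom t u \<Longrightarrow> por_axiom (subst \<theta> t) (subst \<theta> u)"
proof (induction rule: por_axiom.induct)
  case (18 t u)
  then show ?case by (simp add: por_axiom.intros(18) beta_eta_subst)
qed (auto intro: por_axiom.intros(1-17))

text \<open>Only NP-induction needs an argument. Its side condition on the free variables of the
  bounding term holds automatically in \<open>strs\<close>, so a substituted NP-predicate is again
  one.\<close>

lemma ipor_axiom_subst:
  assumes "ipor_axiom strs F" and "\<And>i. strs \<turnstile> \<theta> i : Str"
  shows "ipor_axiom strs (psubst \<theta> F)"
  using assms(1)
proof cases
  case (7 G)
  then obtain t u v where G: "G = pbex t (u \<approx> v)" "wf_form strs G"
    by (auto simp: np_predicate_def)
  have "wf_form strs (psubst (up \<theta>) G)"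
    using wf_psubst[OF G(2), of strs "up \<theta>"] typing_up[of strs \<theta> strs Str] assms(2) by auto
  then have "np_predicate (Str ;; strs) (psubst (up \<theta>) G)"
    by (auto simp: np_predicate_def G(1) psubst_pbex) 
  then show ?thesis
    using ipor_axiom.intros(7) by (simp add: 7 psubst_pinst psubst_psucc)
qed (auto intro: ipor_axiom.intros(1-6) simp: por_axiom_subst)

lemma wf_psubst_strs: "wf_form strs F \<Longrightarrow> (\<And>i. strs \<turnstile> \<theta> i : Str) \<Longrightarrow> wf_form strs (psubst \<theta> F)"
  by (rule wf_psubst[of strs]) auto

lemma typing_up_strs: "(\<And>i. strs \<turnstile> \<theta> i : Str) \<Longrightarrow> strs \<turnstile> up \<theta> i : Str"
  using typing_up[of strs \<theta> strs Str] by simp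

lemma typing_subst_strs: "strs \<turnstile> t : \<tau> \<Longrightarrow> (\<And>i. strs \<turnstile> \<theta> i : Str) \<Longrightarrow> strs \<turnstile> subst \<theta> t : \<tau>"
  by (rule typing_subst[of strs]) auto

lemma ipor_subst:
  "strs | \<Gamma> \<turnstile>\<^sub>P F \<Longrightarrow> (\<And>i. strs \<turnstile> \<theta> i : Str) \<Longrightarrow> strs | psubst \<theta> ` \<Gamma> \<turnstile>\<^sub>P psubst \<theta> F"
proof (induction strs \<Gamma> F arbitrary: \<theta> rule: ipor.induct)
  case (Ax F \<Gamma>)
  then show ?case by (metis ipor.Ax ipor_axiom_subst wf_psubst_strs)
next
  case (Assm F \<Gamma>)
  then show ?case by (metis ipor.Assm image_eqI wf_psubst_strs)
next
  case (BotE \<Gamma> F)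
  have "wf_form strs (psubst \<theta> F)" by (rule wf_psubst_strs[OF BotE(3) BotE.prems])
  then show ?case using BotE(2)[of \<theta>] BotE.prems by (metis ipor.BotE psubst.simps(1) subst.simps(2))
next
  case (AndI \<Gamma> F G)
  show ?case using AndI(2,4)[of \<theta>] AndI.prems by (auto intro: ipor.AndI)
next
  case (AndE1 \<Gamma> F G)
  show ?case using AndE1(2)[of \<theta>] AndE1.prems by (metis ipor.AndE1 psubst.simps(4))
next
  case (AndE2 \<Gamma> F G)
  show ?case using AndE2(2)[of \<theta>] AndE2.prems by (metis ipor.AndE2 psubst.simps(4))
next
  case (OrI1 \<Gamma> F G)
  have "wf_form strs (psubst \<theta> G)" by (rule wf_psubst_strs[OF OrI1(3) OrI1.prems])
  then show ?case using OrI1(2)[of \<theta>] OrI1.prems by (simp add: ipor.OrI1)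
next
  case (OrI2 \<Gamma> G F)
  have "wf_form strs (psubst \<theta> F)" by (rule wf_psubst_strs[OF OrI2(3) OrI2.prems])
  then show ?case using OrI2(2)[of \<theta>] OrI2.prems by (simp add: ipor.OrI2)
next
  case (OrE \<Gamma> F G H)
  show ?case using OrE(2,4,6)[of \<theta>] OrE.prems
    by (simp add: ipor.OrE[of _ _ "psubst \<theta> F" "psubst \<theta> G"])
next
  case (ImpI F \<Gamma> G)
  have "wf_form strs (psubst \<theta> F)" by (rule wf_psubst_strs[OF ImpI(3) ImpI.prems])
  then show ?case using ImpI(2)[of \<theta>] ImpI.prems by (simp add: ipor.ImpI)
next
  case (ImpE \<Gamma> F G)
  show ?case using ImpE(2,4)[of \<theta>] ImpE.prems by (metis ipor.ImpE psubst.simps(6))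
next
  case (AllI \<Gamma> F)
  have "strs | psubst (up \<theta>) ` pshift ` \<Gamma> \<turnstile>\<^sub>P psubst (up \<theta>) F"
    by (rule AllI, simp, rule typing_up_strs[OF AllI.prems])
  then show ?case by (simp add: ipor.AllI image_image psubst_up_pshift)
next
  case (AllE \<Gamma> F t)
  have "strs \<turnstile> subst \<theta> t : Str" by (rule typing_subst_strs[OF AllE(3) AllE.prems])
  then show ?case using AllE(2)[of \<theta>] AllE.prems by (simp add: psubst_pinst ipor.AllE)
next
  case (ExI \<Gamma> t F)
  have "wf_form strs (psubst (up \<theta>) F)"
    by (rule wf_psubst[of strs]) (use ExI(4) typing_up_strs[OF ExI.prems] in simp_all)
  moreover have "strs \<turnstile> subst \<theta> t : Str" by (rule typing_subst_strs[OF ExI(3) ExI.prems])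
  ultimately show ?case using ExI(2)[of \<theta>] ExI.prems
    by (simp add: psubst_pinst ipor.ExI[of _ _ "subst \<theta> t"])
next
  case (ExE \<Gamma> F G)
  have "strs | psubst (up \<theta>) ` insert F (pshift ` \<Gamma>) \<turnstile>\<^sub>P psubst (up \<theta>) (pshift G)"
    by (rule ExE, simp, rule typing_up_strs[OF ExE.prems])
  moreover have "strs | psubst \<theta> ` \<Gamma> \<turnstile>\<^sub>P PEx (psubst (up \<theta>) F)" using ExE(2)[of \<theta>] ExE.prems by simp
  moreover have "wf_form strs (psubst \<theta> G)" by (rule wf_psubst_strs[OF ExE(5) ExE.prems])
  ultimately show ?case
    by (simp add: ipor.ExE[of _ _ "psubst (up \<theta>) F"] image_image psubst_up_pshift)
next
  case (Refl t \<tau> \<Gamma>)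
  then show ?case by (metis ipor.Refl typing_subst_strs psubst.simps(1))
next
  case (Leibniz \<Gamma> t u F \<tau>)
  have "wf_form (\<tau> ;; strs) (psubst (up \<theta>) F)"
    by (rule wf_psubst[of "\<tau> ;; strs"]) (use Leibniz(7) typing_up[of strs \<theta> strs \<tau>] Leibniz.prems in simp_all)
  moreover have "strs \<turnstile> subst \<theta> t : \<tau>" "strs \<turnstile> subst \<theta> u : \<tau>"
    by (rule typing_subst_strs[OF Leibniz(5) Leibniz.prems] typing_subst_strs[OF Leibniz(6) Leibniz.prems])+
  ultimately show ?case using Leibniz(2,4)[of \<theta>] Leibniz.prems
    by (simp add: psubst_pinst ipor.Leibniz[of _ _ "subst \<theta> t"])
qed

section \<open>Equational reasoning\<close>

abbreviation prov :: "pform set \<Rightarrow> pform \<Rightarrow> bool" (infix "\<tturnstile>" 50) where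
  "\<Gamma> \<tturnstile> F \<equiv> strs | \<Gamma> \<turnstile>\<^sub>P F"

abbreviation str_tm :: "tm \<Rightarrow> bool" where
  "str_tm t \<equiv> strs \<turnstile> t : Str"

declare strs_apply [simp del]

lemma eq_strs_apply [simp]: "\<tau> = strs i \<longleftrightarrow> \<tau> = Str"
  by (simp add: strs_apply)

lemma typing_str_simps [simp]:
  "str_tm (Var i)"
  "str_tm (t \<oplus> u) \<longleftrightarrow> str_tm t \<and> str_tm u"
  "str_tm (Tail t) \<longleftrightarrow> str_tm t"
  "str_tm (Trunc t u) \<longleftrightarrow> str_tm t \<and> str_tm u"
  "str_tm (Cond t u v w) \<longleftrightarrow> str_tm t \<and> str_tm u \<and> str_tm v \<and> str_tm w"
  "str_tm (Flipcoin t) \<longleftrightarrow> str_tm t"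
  "str_tm (Times t u) \<longleftrightarrow> str_tm t \<and> str_tm u"
  "str_tm (Rec x (Lam Str (Lam Str b0)) (Lam Str (Lam Str b1)) (Lam Str k) y) \<longleftrightarrow>
     str_tm x \<and> str_tm b0 \<and> str_tm b1 \<and> str_tm k \<and> str_tm y"
  by (auto simp: typing_App strs_apply)

lemma typing_defined [simp]:
  "str_tm (B_of t) \<longleftrightarrow> str_tm t"
  "str_tm (BNeg t) \<longleftrightarrow> str_tm t"
  "str_tm (BOr t u) \<longleftrightarrow> str_tm t \<and> str_tm u"
  "str_tm (BAnd t u) \<longleftrightarrow> str_tm t \<and> str_tm u"
  "str_tm (Eps_of t) \<longleftrightarrow> str_tm t"
  "str_tm (Bool t) \<longleftrightarrow> str_tm t"
  "str_tm (SameEnd t u) \<longleftrightarrow> str_tm t \<and> str_tm u"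
  by (auto simp: B_of_def BNeg_def BOr_def BAnd_def Eps_of_def Bool_def SameEnd_def)

lemma typing_combinators:
  "strs \<turnstile> ConcC : Str \<rightarrow>\<^sub>t Str \<rightarrow>\<^sub>t Str"
  "strs \<turnstile> DropC : Str \<rightarrow>\<^sub>t Str \<rightarrow>\<^sub>t Str"
  "strs \<turnstile> EqC : Str \<rightarrow>\<^sub>t Str \<rightarrow>\<^sub>t Str"
  "strs \<turnstile> SubC : Str \<rightarrow>\<^sub>t Str \<rightarrow>\<^sub>t Str"
proof -
  show c: "strs \<turnstile> ConcC : Str \<rightarrow>\<^sub>t Str \<rightarrow>\<^sub>t Str" "strs \<turnstile> DropC : Str \<rightarrow>\<^sub>t Str \<rightarrow>\<^sub>t Str"
    by (simp_all add: ConcC_def DropC_def)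
  have d: "str_tm (DropC \<cdot> t \<cdot> u)" if "str_tm t" "str_tm u" for t u
    using that c by (auto simp: typing_App)
  show e: "strs \<turnstile> EqC : Str \<rightarrow>\<^sub>t Str \<rightarrow>\<^sub>t Str"
    by (simp add: EqC_def Let_def d)
  have "str_tm (Eq t u)" if "str_tm t" "str_tm u" for t u
    using that e by (auto simp: typing_App Eq_def)
  then show "strs \<turnstile> SubC : Str \<rightarrow>\<^sub>t Str \<rightarrow>\<^sub>t Str"
    by (simp add: SubC_def)
qed

lemma str_tm_app2: "strs \<turnstile> f : Str \<rightarrow>\<^sub>t Str \<rightarrow>\<^sub>t Str \<Longrightarrow> str_tm t \<Longrightarrow> str_tm u \<Longrightarrow> str_tm (f \<cdot> t \<cdot> u)"
  by (auto simp: typing_App)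

lemma str_tm_combinators [simp]:
  "str_tm t \<Longrightarrow> str_tm u \<Longrightarrow> str_tm (Conc t u)"
  "str_tm t \<Longrightarrow> str_tm u \<Longrightarrow> str_tm (DropC \<cdot> t \<cdot> u)"
  "str_tm t \<Longrightarrow> str_tm u \<Longrightarrow> str_tm (Eq t u)"
  "str_tm t \<Longrightarrow> str_tm u \<Longrightarrow> str_tm (Sub t u)"
  by (simp_all add: Conc_def Eq_def Sub_def str_tm_app2 typing_combinators)

lemma str_tm_subst [simp]: "str_tm t \<Longrightarrow> (\<And>i. str_tm (\<theta> i)) \<Longrightarrow> str_tm (subst \<theta> t)"
  by (rule typing_subst_strs)

lemma str_tm_shift [simp]: "str_tm t \<Longrightarrow> str_tm (shift t)"
  using typing_shift[of strs t Str Str] by simp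

lemma str_tm_inst [simp]: "str_tm t \<Longrightarrow> str_tm u \<Longrightarrow> str_tm (inst u t)"
  unfolding inst_def by (rule str_tm_subst) (auto split: nat.splits)

lemma prov_eq_typed:
  assumes "\<Gamma> \<tturnstile> t \<approx> u"
  obtains \<tau> where "strs \<turnstile> t : \<tau>" "strs \<turnstile> u : \<tau>"
  using ipor_wf[OF assms] by auto

lemma pinst_eq [simp]: "pinst s (t \<approx> u) = (inst s t \<approx> inst s u)"
  by (simp add: pinst_def inst_def)

lemma inst_simps [simp]:
  "inst s (Var 0) = s" "inst s (shift t) = t" "inst s (t \<cdot> u) = inst s t \<cdot> inst s u"
  "inst s (Const c) = Const c"
  by (simp_all add: inst_def)

lemma ext_env_simps [simp]: "(\<tau> ;; E) 0 = \<tau>" "(\<tau> ;; E) (Suc i) = E i"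
  by (simp_all add: ext_env_def)

lemma typing_unique: "E \<turnstile> t : \<tau> \<Longrightarrow> E \<turnstile> t : \<tau>' \<Longrightarrow> \<tau> = \<tau>'"
proof (induction E t \<tau> arbitrary: \<tau>' rule: typing.induct)
  case (3 E t \<sigma> \<tau> u)
  from 3(5) obtain \<sigma>' where "E \<turnstile> t : \<sigma>' \<rightarrow>\<^sub>t \<tau>'" by (auto simp: typing_App)
  from 3(3)[OF this] show ?case by simp
next
  case (4 \<sigma> E t \<tau>)
  from 4(3) obtain \<tau>'' where "\<tau>' = \<sigma> \<rightarrow>\<^sub>t \<tau>''" "\<sigma> ;; E \<turnstile> t : \<tau>''" by auto
  with 4(2) show ?case by simp
qed simp_all

lemma eq_sym: "\<Gamma> \<tturnstile> t \<approx> u \<Longrightarrow> \<Gamma> \<tturnstile> u \<approx> t"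
proof -
  assume 1: "\<Gamma> \<tturnstile> t \<approx> u"
  then obtain \<tau> where ty: "strs \<turnstile> t : \<tau>" "strs \<turnstile> u : \<tau>" by (rule prov_eq_typed)
  have "\<Gamma> \<tturnstile> pinst t (Var 0 \<approx> shift t)" using ty by (auto intro: ipor.Refl)
  from ipor.Leibniz[OF 1 this ty] show ?thesis using typing_shift[OF ty(1)] by simp
qed

lemma eq_inst:
  assumes "\<Gamma> \<tturnstile> t \<approx> u" "strs \<turnstile> t : \<tau>" "strs \<turnstile> u : \<tau>" "\<tau> ;; strs \<turnstile> b : \<tau>'"
  shows "\<Gamma> \<tturnstile> inst t b \<approx> inst u b"
proof -
  have ty: "strs \<turnstile> inst t b : \<tau>'"
    unfolding inst_def by (rule typing_subst[OF assms(4)]) (auto simp: ext_env_def assms split: nat.splits)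
  have "\<Gamma> \<tturnstile> pinst t (shift (inst t b) \<approx> b)" using ty by (simp add: ipor.Refl)
  from ipor.Leibniz[OF assms(1) this assms(2,3)] show ?thesis
    using typing_shift[OF ty] assms(4) by auto
qed

lemma eq_trans: "\<Gamma> \<tturnstile> s \<approx> t \<Longrightarrow> \<Gamma> \<tturnstile> t \<approx> u \<Longrightarrow> \<Gamma> \<tturnstile> s \<approx> u"
proof -
  assume 1: "\<Gamma> \<tturnstile> s \<approx> t" and 2: "\<Gamma> \<tturnstile> t \<approx> u"
  from 1 obtain \<tau> where ty: "strs \<turnstile> s : \<tau>" "strs \<turnstile> t : \<tau>" by (rule prov_eq_typed)
  from 2 ty(2) have ty': "strs \<turnstile> u : \<tau>" by (metis prov_eq_typed typing_unique)
  have "\<Gamma> \<tturnstile> pinst t (shift s \<approx> Var 0)" using 1 by simp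
  from ipor.Leibniz[OF 2 this ty(2) ty'] show ?thesis using typing_shift[OF ty(1)] by simp
qed

lemma eq_App:
  assumes "\<Gamma> \<tturnstile> f \<approx> f'" "\<Gamma> \<tturnstile> t \<approx> t'" "strs \<turnstile> f : \<sigma> \<rightarrow>\<^sub>t \<tau>" "strs \<turnstile> t : \<sigma>"
  shows "\<Gamma> \<tturnstile> f \<cdot> t \<approx> f' \<cdot> t'"
proof -
  have ty: "strs \<turnstile> f' : \<sigma> \<rightarrow>\<^sub>t \<tau>" "strs \<turnstile> t' : \<sigma>"
    using assms by (metis prov_eq_typed typing_unique)+
  have "\<Gamma> \<tturnstile> inst f (Var 0 \<cdot> shift t) \<approx> inst f' (Var 0 \<cdot> shift t)"
    by (rule eq_inst[OF assms(1,3) ty(1)]) (auto simp: typing_App typing_shift assms(4))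
  moreover have "\<Gamma> \<tturnstile> inst t (shift f' \<cdot> Var 0) \<approx> inst t' (shift f' \<cdot> Var 0)"
    by (rule eq_inst[OF assms(2,4) ty(2), where \<tau>' = \<tau>])
      (auto simp: typing_App intro!: exI[of _ \<sigma>] typing_shift ty(1))
  ultimately show ?thesis by (simp add: eq_trans[of _ _ "f' \<cdot> t"])
qed

text \<open>\<open>Leibniz\<close> replaces one variable at a time, a substitution all at once.
  \<open>mix S\<close> has switched the variables in the finite set \<open>S\<close> from \<theta>
  to \<eta>; once \<open>S\<close> is the set of free variables of \<open>t\<close>, the remaining
  ones do not matter.\<close>

lemma eq_subst:
  assumes "strs \<turnstile> t : \<tau>" and ok: "\<And>i. str_tm (\<theta> i)" "\<And>i. str_tm (\<eta> i)"
    and eq: "\<And>i. \<Gamma> \<tturnstile> \<theta> i \<approx> \<eta> i"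
  shows "\<Gamma> \<tturnstile> subst \<theta> t \<approx> subst \<eta> t"
proof -
  define mix where "mix S = (\<lambda>i. if i \<in> S then \<eta> i else \<theta> i)" for S
  have mix: "str_tm (mix S i)" for S i using ok by (simp add: mix_def)
  have "\<Gamma> \<tturnstile> subst \<theta> t \<approx> subst (mix S) t" if "finite S" for S
    using that
  proof (induction S)
    case empty
    have "strs \<turnstile> subst \<theta> t : \<tau>" using assms(1) ok(1) by (rule typing_subst_strs)
    then show ?case by (simp add: mix_def ipor.Refl)
  next
    case (insert j S)
    let ?b = "subst (\<lambda>i. if i = j then Var 0 else shift (mix S i)) t"
    have b: "strs \<turnstile> ?b : \<tau>" using assms(1) by (rule typing_subst_strs) (simp add: mix)
    have "inst x ?b = subst ((mix S)(j := x)) t" for x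
      by (auto simp: inst_def subst_subst intro!: arg_cong[where f="\<lambda>f. subst f t"])
    moreover have "(mix S)(j := \<theta> j) = mix S" "(mix S)(j := \<eta> j) = mix (insert j S)"
      using insert by (auto simp: mix_def)
    moreover have "\<Gamma> \<tturnstile> inst (\<theta> j) ?b \<approx> inst (\<eta> j) ?b"
      by (rule eq_inst[OF eq ok]) (simp, rule b)
    ultimately show ?case using insert eq_trans by metis
  qed
  from this[OF finite_fv] have "\<Gamma> \<tturnstile> subst \<theta> t \<approx> subst (mix (fv t)) t" .
  moreover have "subst (mix (fv t)) t = subst \<eta> t"
    by (rule subst_cong_fv) (simp add: mix_def)
  ultimately show ?thesis by simp
qed

lemma eq_axiom: "por_axiom t u \<Longrightarrow> str_tm t \<Longrightarrow> str_tm u \<Longrightarrow> \<Gamma> \<tturnstile> t \<approx> u"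
  by (auto intro!: ipor.Ax ipor_axiom.intros)

lemma prov_cut: "insert F \<Delta> \<tturnstile> G \<Longrightarrow> \<Gamma> \<tturnstile> F \<Longrightarrow> \<Delta> \<subseteq> \<Gamma> \<Longrightarrow> \<Gamma> \<tturnstile> G"
  by (rule ipor.ImpE[of _ _ F]) (blast intro: ipor.ImpI ipor_weaken dest: ipor_wf)+

text \<open>Index 0 is instantiated by \<open>AllE\<close> and the other indices by
  \<open>ipor_subst\<close>; together they yield any simultaneous substitution.\<close>

lemma prov_instance:
  assumes "{} \<tturnstile> PAll F" and "\<And>i. str_tm (\<theta> i)"
  shows "\<Gamma> \<tturnstile> psubst \<theta> F"
proof -
  have "{} \<tturnstile> PAll (psubst (up (\<lambda>i. \<theta> (Suc i))) F)"
    using ipor_subst[OF assms(1), of "\<lambda>i. \<theta> (Suc i)"] assms(2) by simp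
  then have "{} \<tturnstile> pinst (\<theta> 0) (psubst (up (\<lambda>i. \<theta> (Suc i))) F)"
    using assms(2) by (rule ipor.AllE)
  moreover have "(\<lambda>i. subst (case_nat (\<theta> 0) Var) (up (\<lambda>i. \<theta> (Suc i)) i)) = \<theta>"
    by (auto simp: up_def fun_eq_iff split: nat.splits)
  ultimately show ?thesis by (auto simp: pinst_def psubst_psubst intro: ipor_weaken)
qed


section \<open>Worlds\<close>

text \<open>
  A world is a consistent prime theory.  Its elements are the classes of provably equal string
  terms.  There are countably infinitely many of them, so they can be numbered by a type, and
  the equations of the theory become unconditional equations of HOL.
\<close>

instance ty :: countable by countable_datatype
instance const :: countable by countable_datatype
instance tm :: countable by countable_datatype

datatype elt = Elt nat

text \<open>A constant of its own in place of \<open>case_nat\<close>, so that valuations and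
  substitutions are looked up by rewriting, also at numerals.\<close>

definition ext :: "'a \<Rightarrow> (nat \<Rightarrow> 'a) \<Rightarrow> nat \<Rightarrow> 'a" (infixr "\<triangleright>" 65) where
  "a \<triangleright> \<rho> = case_nat a \<rho>"

lemma ext_simps [simp]:
  "(a \<triangleright> \<rho>) 0 = a" "(a \<triangleright> \<rho>) (Suc i) = \<rho> i" "(a \<triangleright> \<rho>) 2 = \<rho> 1" "(a \<triangleright> \<rho>) 3 = \<rho> 2"
  "(a \<triangleright> \<rho>) 4 = \<rho> 3" "(a \<triangleright> \<rho>) 5 = \<rho> 4"
  by (simp_all add: ext_def eval_nat_numeral)

lemma ext_eta [simp]: "\<rho> 0 \<triangleright> (\<lambda>i. \<rho> (Suc i)) = \<rho>"
  by (auto simp: ext_def fun_eq_iff split: nat.splits)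

lemma comp_ext: "(\<lambda>i. f ((a \<triangleright> \<rho>) i)) = f a \<triangleright> (\<lambda>i. f (\<rho> i))"
  by (auto simp: ext_def fun_eq_iff split: nat.splits)

text \<open>The strings of \<open>n\<close> ones are pairwise different in every world; they show
  that a world is infinite.\<close>

primrec numeral_tm :: "nat \<Rightarrow> tm" where
  "numeral_tm 0 = Empty"
| "numeral_tm (Suc n) = numeral_tm n \<oplus> One"

lemma str_tm_numeral_tm [simp]: "str_tm (numeral_tm n)"
  by (induction n) auto

locale world =
  fixes \<Gamma> :: "pform set"
  assumes consistent: "\<not> \<Gamma> \<tturnstile> PBot"
    and prime: "\<Gamma> \<tturnstile> POr F G \<Longrightarrow> \<Gamma> \<tturnstile> F \<or> \<Gamma> \<tturnstile> G"

text \<open>Zorn's lemma for the extensions that do not prove \<open>H\<close>. A maximal one is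
  prime: adding an unprovable disjunct enlarges it and so makes \<open>H\<close> provable, and if
  this happens for both disjuncts, \<open>OrE\<close> proves \<open>H\<close> already.\<close>

theorem lindenbaum:
  assumes "\<not> \<Gamma> \<tturnstile> H" "wf_form strs H"
  obtains \<Delta> where "world \<Delta>" "\<Gamma> \<subseteq> \<Delta>" "\<not> \<Delta> \<tturnstile> H"
proof -
  let ?A = "{\<Delta>. \<Gamma> \<subseteq> \<Delta> \<and> \<not> \<Delta> \<tturnstile> H}"
  have "\<exists>M\<in>?A. \<forall>X\<in>?A. M \<subseteq> X \<longrightarrow> X = M"
  proof (rule subset_Zorn_nonempty)
    show "?A \<noteq> {}" using assms by blast
    fix C assume C: "C \<noteq> {}" "subset.chain ?A C"
    have "\<not> \<Union>C \<tturnstile> H"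
    proof
      assume "\<Union>C \<tturnstile> H"
      then obtain X where X: "finite X" "X \<subseteq> \<Union>C" "X \<tturnstile> H" using ipor_finite[of strs "\<Union>C" H] by auto
      then obtain Y where "Y \<in> C" "X \<subseteq> Y"
        using finite_subset_Union_chain[OF X(1,2) C] by auto
      then show False using ipor_weaken[OF X(3), of Y] C(2) by (auto simp: subset_chain_def)
    qed
    moreover obtain Y where "Y \<in> C" using C(1) by auto
    moreover from this have "\<Gamma> \<subseteq> Y" using C(2) by (auto simp: subset_chain_def)
    ultimately show "\<Union>C \<in> ?A" by auto
  qed
  then obtain M where M: "\<Gamma> \<subseteq> M" "\<not> M \<tturnstile> H"
    and max: "\<And>X. \<Gamma> \<subseteq> X \<Longrightarrow> \<not> X \<tturnstile> H \<Longrightarrow> M \<subseteq> X \<Longrightarrow> X = M" by auto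
  have "world M"
  proof
    show "\<not> M \<tturnstile> PBot" using M(2) ipor.BotE[OF _ assms(2)] by auto
    fix F G assume or: "M \<tturnstile> POr F G"
    then have wf: "wf_form strs F" "wf_form strs G" using ipor_wf[OF or] by auto
    have "insert K M \<tturnstile> H" if "\<not> M \<tturnstile> K" "wf_form strs K" for K
    proof (rule ccontr)
      assume "\<not> insert K M \<tturnstile> H"
      then have "insert K M = M" using max[of "insert K M"] M(1) by blast
      then show False using that ipor.Assm[of K M strs] by auto
    qed
    then show "M \<tturnstile> F \<or> M \<tturnstile> G" using ipor.OrE[OF or, of H] wf M(2) by auto
  qed
  then show ?thesis using M by (intro that)
qed

context world
begin

definition cls :: "tm \<Rightarrow> tm set" where
  "cls t = {u. \<Gamma> \<tturnstile> t \<approx> u}"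

definition den :: "tm \<Rightarrow> elt" where
  "den t = Elt (to_nat_on (cls ` Collect str_tm) (cls t))"

definition rep :: "elt \<Rightarrow> tm" where
  "rep a = (SOME t. str_tm t \<and> den t = a)"

definition sem :: "(nat \<Rightarrow> elt) \<Rightarrow> tm \<Rightarrow> elt" where
  "sem \<rho> t = den (subst (\<lambda>i. rep (\<rho> i)) t)"

lemma cls_eq_iff: "str_tm t \<Longrightarrow> cls t = cls u \<longleftrightarrow> \<Gamma> \<tturnstile> t \<approx> u"
  unfolding cls_def using eq_sym eq_trans ipor.Refl[of strs]
  by (smt (verit) Collect_cong mem_Collect_eq)

text \<open>\<open>Cond\<close> tells the two apart: inserted into its first argument, the equation
  would give \<open>Zero \<approx> One\<close>.\<close>

lemma Empty_not_snoc: "\<not> \<Gamma> \<tturnstile> Empty \<approx> t \<oplus> One" if t: "str_tm t"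
proof
  assume 1: "\<Gamma> \<tturnstile> Empty \<approx> t \<oplus> One"
  have "\<Gamma> \<tturnstile> inst Empty (Cond (Var 0) Zero One One) \<approx> inst (t \<oplus> One) (Cond (Var 0) Zero One One)"
    using 1 by (rule eq_inst[where \<tau>=Str and \<tau>'=Str]) (use t in auto)
  then have "\<Gamma> \<tturnstile> Cond Empty Zero One One \<approx> Cond (t \<oplus> One) Zero One One" by simp
  moreover have "\<Gamma> \<tturnstile> Cond Empty Zero One One \<approx> Zero"
    by (rule eq_axiom) (auto intro: por_axiom.intros)
  moreover have "\<Gamma> \<tturnstile> Cond (t \<oplus> One) Zero One One \<approx> One"
    by (rule eq_axiom) (auto intro: por_axiom.intros t)
  ultimately have "\<Gamma> \<tturnstile> Zero \<approx> One" by (metis eq_sym eq_trans)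
  then show False using consistent by simp
qed

lemma numeral_tm_eq: "\<Gamma> \<tturnstile> numeral_tm m \<approx> numeral_tm n \<Longrightarrow> m = n"
proof (induction m arbitrary: n)
  case 0
  then show ?case using Empty_not_snoc by (cases n) auto
next
  case (Suc m)
  show ?case
  proof (cases n)
    case 0
    then show ?thesis using Suc.prems Empty_not_snoc eq_sym by fastforce
  next
    case (Suc k)
    have tl: "\<Gamma> \<tturnstile> Tail (t \<oplus> One) \<approx> t" if "str_tm t" for t
      by (rule eq_axiom) (auto intro: por_axiom.intros that)
    have "\<Gamma> \<tturnstile> Tail (numeral_tm m \<oplus> One) \<approx> Tail (numeral_tm k \<oplus> One)"
      by (rule eq_App[of _ _ _ _ _ Str Str]) (use Suc Suc.prems in \<open>auto intro: ipor.Refl\<close>)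
    then have "\<Gamma> \<tturnstile> numeral_tm m \<approx> numeral_tm k"
      by (metis tl str_tm_numeral_tm eq_sym eq_trans)
    then show ?thesis using Suc.IH Suc by simp
  qed
qed

text \<open>Surjectivity is the point: every value of type \<open>elt\<close> is the class of a
  string term, so equations between elements need no side condition.\<close>

lemma bij_numbering: "bij_betw (to_nat_on (cls ` Collect str_tm)) (cls ` Collect str_tm) UNIV"
proof (rule to_nat_on_infinite)
  show "countable (cls ` Collect str_tm)" by simp
  have "inj (\<lambda>n. cls (numeral_tm n))"
    by (rule injI) (simp add: cls_eq_iff numeral_tm_eq)
  then have "infinite (range (\<lambda>n. cls (numeral_tm n)))" by (rule range_inj_infinite)
  then show "infinite (cls ` Collect str_tm)"
    by (rule infinite_super[rotated]) auto
qed

lemma den_eq_iff: "str_tm t \<Longrightarrow> str_tm u \<Longrightarrow> den t = den u \<longleftrightarrow> \<Gamma> \<tturnstile> t \<approx> u"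
  using bij_betw_imp_inj_on[OF bij_numbering] cls_eq_iff[of t u]
  by (auto simp: den_def dest: inj_onD)

lemma rep: "str_tm (rep a) \<and> den (rep a) = a"
  unfolding rep_def
proof (rule someI_ex)
  obtain n where a: "a = Elt n" by (cases a)
  have "n \<in> to_nat_on (cls ` Collect str_tm) ` cls ` Collect str_tm"
    using bij_betw_imp_surj_on[OF bij_numbering] by simp
  then show "\<exists>t. str_tm t \<and> den t = a" by (auto simp: den_def a)
qed

lemma str_tm_rep [simp]: "str_tm (rep a)" and den_rep [simp]: "den (rep a) = a"
  using rep by auto

lemma den_subst:
  assumes "str_tm t" "\<And>i. str_tm (\<theta> i)" "\<And>i. str_tm (\<eta> i)" "\<And>i. den (\<theta> i) = den (\<eta> i)"
  shows "den (subst \<theta> t) = den (subst \<eta> t)"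
  using assms eq_subst[of t Str \<theta> \<eta> \<Gamma>] by (simp add: den_eq_iff)

lemma sem_subst [simp]:
  assumes "str_tm t" "\<And>i. str_tm (\<theta> i)"
  shows "sem \<rho> (subst \<theta> t) = sem (\<lambda>i. sem \<rho> (\<theta> i)) t"
  unfolding sem_def subst_subst by (rule den_subst) (use assms in auto)

lemma sem_shift [simp]: "str_tm t \<Longrightarrow> sem \<rho> (shift t) = sem (\<lambda>i. \<rho> (Suc i)) t"
  by (simp add: sem_def shift_eq_subst subst_subst)

lemma sem_Var [simp]: "sem \<rho> (Var i) = \<rho> i"
  by (simp add: sem_def)

lemma sem_inst [simp]: "str_tm t \<Longrightarrow> str_tm u \<Longrightarrow> sem \<rho> (inst u t) = sem (sem \<rho> u \<triangleright> \<rho>) t"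
proof -
  assume "str_tm t" "str_tm u"
  then have "sem \<rho> (inst u t) = sem (\<lambda>i. sem \<rho> (case_nat u Var i)) t"
    unfolding inst_def by (intro sem_subst) (auto split: nat.splits)
  also have "(\<lambda>i. sem \<rho> (case_nat u Var i)) = sem \<rho> u \<triangleright> \<rho>"
    by (auto simp: ext_def fun_eq_iff split: nat.splits)
  finally show ?thesis .
qed

lemma sem_cong: "(\<And>i. i \<in> fv t \<Longrightarrow> \<rho> i = \<rho>' i) \<Longrightarrow> sem \<rho> t = sem \<rho>' t"
  unfolding sem_def by (metis (mono_tags, lifting) subst_cong_fv)

text \<open>The canonical valuation of the term model: every variable denotes its own class. Truth
  of an equation under it is provability from \<Gamma>.\<close>

definition generic :: "nat \<Rightarrow> elt" where
  "generic i = den (Var i)"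

lemma sem_generic: "str_tm t \<Longrightarrow> sem generic t = den t"
  using den_subst[of t "\<lambda>i. rep (generic i)" Var] by (simp add: sem_def generic_def)

lemma prov_eq_iff_sem: "str_tm t \<Longrightarrow> str_tm u \<Longrightarrow> \<Gamma> \<tturnstile> t \<approx> u \<longleftrightarrow> sem generic t = sem generic u"
  by (simp add: sem_generic den_eq_iff)

lemma sem_axiom: "por_axiom t u \<Longrightarrow> str_tm t \<Longrightarrow> str_tm u \<Longrightarrow> sem \<rho> t = sem \<rho> u"
  unfolding sem_def by (subst den_eq_iff) (auto intro!: eq_axiom por_axiom_subst)

text \<open>A theorem without hypotheses survives every substitution and so holds under every
  valuation. Theorems of \<Gamma> itself are only true under \<open>generic\<close>, as \<Gamma> is
  not closed under substitution.\<close>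

lemma sem_valid:
  assumes "{} \<tturnstile> t \<approx> u" "str_tm t" "str_tm u"
  shows "sem \<rho> t = sem \<rho> u"
  using ipor_subst[OF assms(1), of "\<lambda>i. rep (\<rho> i)"] assms(2,3)
  unfolding sem_def by (subst den_eq_iff) (auto intro: ipor_weaken)

end

section \<open>Operations on the elements of a world\<close>

abbreviation RecF :: "tm \<Rightarrow> tm \<Rightarrow> tm \<Rightarrow> tm \<Rightarrow> tm" where
  "RecF x h0 h1 k \<equiv> Const CRec \<cdot> x \<cdot> Lam Str (Lam Str h0) \<cdot> Lam Str (Lam Str h1) \<cdot> Lam Str k"

lemma typing_RecF: "str_tm x \<Longrightarrow> str_tm b0 \<Longrightarrow> str_tm b1 \<Longrightarrow> str_tm k \<Longrightarrow> strs \<turnstile> RecF x b0 b1 k : Str \<rightarrow>\<^sub>t Str"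
  by (auto simp: typing_App)

lemma fv_combinators [simp]: "fv ConcC = {}" "fv DropC = {}" "fv EqC = {}" "fv SubC = {}"
  by (auto simp: ConcC_def DropC_def EqC_def SubC_def Let_def BAnd_def BOr_def
      B_of_def SameEnd_def Eps_of_def Eq_def)

lemma fv_defined [simp]:
  "fv (B_of t) = fv t" "fv (BNeg t) = fv t" "fv (BOr t u) = fv t \<union> fv u"
  "fv (BAnd t u) = fv t \<union> fv u" "fv (Eps_of t) = fv t" "fv (Conc t u) = fv t \<union> fv u"
  "fv (Eq t u) = fv t \<union> fv u" "fv (Sub t u) = fv t \<union> fv u" "fv (SameEnd t u) = fv t \<union> fv u"
  by (auto simp: B_of_def BNeg_def BOr_def BAnd_def Eps_of_def Conc_def Eq_def Sub_def SameEnd_def)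

context world
begin

lemma sem_op:
  assumes "str_tm t" "\<And>i. str_tm (\<theta> i)" "\<And>i. i \<in> fv t \<Longrightarrow> sem \<rho> (\<theta> i) = \<rho>' i"
  shows "sem \<rho> (subst \<theta> t) = sem \<rho>' t"
  using assms by (auto intro: sem_cong)

definition eps :: elt where "eps = den Empty"
text \<open>Here and below, each operation is the value of an open term with the arguments in the
  valuation. The constant tail supplies the last argument; the indices after it do not occur in the
  term.\<close>

definition cat :: "elt \<Rightarrow> elt \<Rightarrow> elt" where "cat a b = sem (a \<triangleright> (\<lambda>_. b)) (Var 0 \<oplus> Var 1)"
definition dg :: "bool \<Rightarrow> elt \<Rightarrow> elt" where "dg b a = cat a (den (if b then One else Zero))"
definition tail :: "elt \<Rightarrow> elt" where "tail a = sem (\<lambda>_. a) (Tail (Var 0))"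
definition trunc :: "elt \<Rightarrow> elt \<Rightarrow> elt" where "trunc a b = sem (a \<triangleright> (\<lambda>_. b)) (Trunc (Var 0) (Var 1))"
definition cond :: "elt \<Rightarrow> elt \<Rightarrow> elt \<Rightarrow> elt \<Rightarrow> elt" where
  "cond a b c d = sem (a \<triangleright> b \<triangleright> c \<triangleright> (\<lambda>_. d)) (Cond (Var 0) (Var 1) (Var 2) (Var 3))"
definition flip :: "elt \<Rightarrow> elt" where "flip a = sem (\<lambda>_. a) (Flipcoin (Var 0))"
definition times :: "elt \<Rightarrow> elt \<Rightarrow> elt" where "times a b = sem (a \<triangleright> (\<lambda>_. b)) (Times (Var 0) (Var 1))"
definition conc :: "elt \<Rightarrow> elt \<Rightarrow> elt" where "conc a b = sem (a \<triangleright> (\<lambda>_. b)) (Conc (Var 0) (Var 1))"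
definition drop :: "elt \<Rightarrow> elt \<Rightarrow> elt" where "drop a b = sem (a \<triangleright> (\<lambda>_. b)) (DropC \<cdot> Var 0 \<cdot> Var 1)"
definition eqf :: "elt \<Rightarrow> elt \<Rightarrow> elt" where "eqf a b = sem (a \<triangleright> (\<lambda>_. b)) (Eq (Var 0) (Var 1))"
definition sub :: "elt \<Rightarrow> elt \<Rightarrow> elt" where "sub a b = sem (a \<triangleright> (\<lambda>_. b)) (Sub (Var 0) (Var 1))"

abbreviation bit :: "bool \<Rightarrow> elt" where "bit b \<equiv> dg b eps"

lemma sem_op1: "str_tm s \<Longrightarrow> str_tm t \<Longrightarrow> fv s \<subseteq> {0} \<Longrightarrow>
    sem \<rho> (subst (\<lambda>_. t) s) = sem (\<lambda>_. sem \<rho> t) s"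
  by (rule sem_op) auto

lemma sem_op2: "str_tm s \<Longrightarrow> str_tm t \<Longrightarrow> str_tm u \<Longrightarrow> fv s \<subseteq> {0, 1} \<Longrightarrow>
    sem \<rho> (subst (t \<triangleright> (\<lambda>_. u)) s) = sem (sem \<rho> t \<triangleright> (\<lambda>_. sem \<rho> u)) s"
  by (rule sem_op) (auto simp: ext_def split: nat.splits)

lemma sem_op4: "str_tm s \<Longrightarrow> str_tm t \<Longrightarrow> str_tm u \<Longrightarrow> str_tm v \<Longrightarrow> str_tm w \<Longrightarrow>
    sem \<rho> (subst (t \<triangleright> u \<triangleright> v \<triangleright> (\<lambda>_. w)) s) =
    sem (sem \<rho> t \<triangleright> sem \<rho> u \<triangleright> sem \<rho> v \<triangleright> (\<lambda>_. sem \<rho> w)) s"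
  by (rule sem_op) (auto simp: ext_def split: nat.splits)

lemma sem_Empty [simp]: "sem \<rho> Empty = eps"
  by (simp add: sem_def eps_def)

lemma sem_ops [simp]:
  "str_tm t \<Longrightarrow> str_tm u \<Longrightarrow> sem \<rho> (t \<oplus> u) = cat (sem \<rho> t) (sem \<rho> u)"
  "str_tm t \<Longrightarrow> sem \<rho> (Tail t) = tail (sem \<rho> t)"
  "str_tm t \<Longrightarrow> str_tm u \<Longrightarrow> sem \<rho> (Trunc t u) = trunc (sem \<rho> t) (sem \<rho> u)"
  "str_tm t \<Longrightarrow> str_tm u \<Longrightarrow> str_tm v \<Longrightarrow> str_tm w \<Longrightarrow>
     sem \<rho> (Cond t u v w) = cond (sem \<rho> t) (sem \<rho> u) (sem \<rho> v) (sem \<rho> w)"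
  "str_tm t \<Longrightarrow> sem \<rho> (Flipcoin t) = flip (sem \<rho> t)"
  "str_tm t \<Longrightarrow> str_tm u \<Longrightarrow> sem \<rho> (Times t u) = times (sem \<rho> t) (sem \<rho> u)"
  "str_tm t \<Longrightarrow> str_tm u \<Longrightarrow> sem \<rho> (Conc t u) = conc (sem \<rho> t) (sem \<rho> u)"
  "str_tm t \<Longrightarrow> str_tm u \<Longrightarrow> sem \<rho> (DropC \<cdot> t \<cdot> u) = drop (sem \<rho> t) (sem \<rho> u)"
  "str_tm t \<Longrightarrow> str_tm u \<Longrightarrow> sem \<rho> (Eq t u) = eqf (sem \<rho> t) (sem \<rho> u)"
  "str_tm t \<Longrightarrow> str_tm u \<Longrightarrow> sem \<rho> (Sub t u) = sub (sem \<rho> t) (sem \<rho> u)"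
  using sem_op2[of "Var 0 \<oplus> Var 1" t u \<rho>] sem_op1[of "Tail (Var 0)" t \<rho>]
    sem_op2[of "Trunc (Var 0) (Var 1)" t u \<rho>]
    sem_op4[of "Cond (Var 0) (Var 1) (Var 2) (Var 3)" t u v w \<rho>]
    sem_op1[of "Flipcoin (Var 0)" t \<rho>] sem_op2[of "Times (Var 0) (Var 1)" t u \<rho>]
    sem_op2[of "Conc (Var 0) (Var 1)" t u \<rho>] sem_op2[of "DropC \<cdot> Var 0 \<cdot> Var 1" t u \<rho>]
    sem_op2[of "Eq (Var 0) (Var 1)" t u \<rho>] sem_op2[of "Sub (Var 0) (Var 1)" t u \<rho>]
  by (simp_all add: cat_def tail_def trunc_def cond_def flip_def times_def conc_def drop_def
      eqf_def sub_def)

lemma cat_eps_left [simp]: "cat eps x = x"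
  using sem_axiom[OF por_axiom.intros(1)[of "Var 0"], of "\<lambda>_. x"] by simp

lemma sem_bits [simp]: "sem \<rho> Zero = bit False" "sem \<rho> One = bit True"
  by (simp_all add: dg_def sem_def)

lemma cat_bit [simp]: "cat x (bit b) = dg b x"
  by (simp add: dg_def)

lemma cat_eps_right [simp]: "cat x eps = x"
  using sem_axiom[OF por_axiom.intros(2)[of "Var 0"], of "\<lambda>_. x"] by simp

lemma cat_dg [simp]: "cat x (dg b y) = dg b (cat x y)"
  using sem_axiom[OF por_axiom.intros(3)[of "if b then One else Zero" "Var 0" "Var 1"], of "x \<triangleright> (\<lambda>_. y)"]
  by (cases b) simp_all

lemma tail_eps [simp]: "tail eps = eps"
  using sem_axiom[OF por_axiom.intros(4)] by simp

lemma tail_dg [simp]: "tail (dg b x) = x"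
  using sem_axiom[OF por_axiom.intros(5)[of "if b then One else Zero" "Var 0"], of "\<lambda>_. x"]
  by (cases b) simp_all

lemma trunc_eps [simp]: "trunc x eps = eps" "trunc eps x = eps"
  using sem_axiom[OF por_axiom.intros(6)[of "Var 0"], of "\<lambda>_. x"]
    sem_axiom[OF por_axiom.intros(7)[of "Var 0"], of "\<lambda>_. x"] by simp_all

lemma trunc_dg [simp]: "trunc (dg b x) (dg c y) = dg b (trunc x y)"
  using sem_axiom[OF por_axiom.intros(8)[of "if b then One else Zero" "if c then One else Zero" "Var 0" "Var 1"],
      of "x \<triangleright> (\<lambda>_. y)"]
  by (cases b; cases c) simp_all

lemma cond_eps [simp]: "cond eps y z w = y"
  using sem_axiom[OF por_axiom.intros(9)[of "Var 0" "Var 1" "Var 2"], of "y \<triangleright> z \<triangleright> (\<lambda>_. w)"] by simp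

lemma cond_dg [simp]: "cond (dg b x) y z w = (if b then w else z)"
  using sem_axiom[OF por_axiom.intros(10)[of "Var 3" "Var 0" "Var 1" "Var 2"], of "y \<triangleright> z \<triangleright> w \<triangleright> (\<lambda>_. x)"]
    sem_axiom[OF por_axiom.intros(11)[of "Var 3" "Var 0" "Var 1" "Var 2"], of "y \<triangleright> z \<triangleright> w \<triangleright> (\<lambda>_. x)"]
  by simp

lemma times_eps [simp]: "times x eps = eps"
  using sem_axiom[OF por_axiom.intros(16)[of "Var 0"], of "\<lambda>_. x"] by simp

lemma times_dg_conc: "times x (dg b y) = conc (times x y) x"
  using sem_axiom[OF por_axiom.intros(17)[of "if b then One else Zero" "Var 0" "Var 1"], of "x \<triangleright> (\<lambda>_. y)"]
  by (cases b) simp_all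

lemma bit_neq: "bit True \<noteq> bit False"
proof
  assume "bit True = bit False"
  then have "sem generic Zero = sem generic One" by simp
  then show False using consistent by (subst (asm) prov_eq_iff_sem[symmetric]) simp_all
qed

lemma dg_neq_eps [simp]: "dg b x \<noteq> eps" "eps \<noteq> dg b x"
proof -
  have False if "dg b x = eps"
    using arg_cong[OF that, of "\<lambda>u. cond u (bit True) (bit False) (bit False)"] bit_neq by simp
  then show "dg b x \<noteq> eps" "eps \<noteq> dg b x" by auto
qed

lemma dg_inject [simp]: "dg b x = dg c y \<longleftrightarrow> b = c \<and> x = y"
proof
  assume 1: "dg b x = dg c y"
  show "b = c \<and> x = y"
    using arg_cong[OF 1, of tail] arg_cong[OF 1, of "\<lambda>u. cond u eps (bit False) (bit True)"] bit_neq
    by (auto split: if_splits)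
qed simp

text \<open>Primeness, applied to the axiom of digit case distinction for a representative of
  \<open>x\<close>.\<close>

lemma elt_cases [case_names eps dg, cases type: elt]:
  obtains "x = eps" | b y where "x = dg b y"
proof -
  let ?t = "rep x"
  have "\<Gamma> \<tturnstile> POr (?t \<approx> Empty) (POr (?t \<approx> Tail ?t \<oplus> Zero) (?t \<approx> Tail ?t \<oplus> One))"
    by (rule ipor.Ax) (auto intro!: ipor_axiom.intros(3) exI[of _ Str])
  then have "\<Gamma> \<tturnstile> ?t \<approx> Empty \<or> \<Gamma> \<tturnstile> ?t \<approx> Tail ?t \<oplus> Zero \<or> \<Gamma> \<tturnstile> ?t \<approx> Tail ?t \<oplus> One"
    using prime by blast
  moreover have "sem generic ?t = x" by (simp add: sem_generic)
  ultimately have "x = eps \<or> x = dg False (tail x) \<or> x = dg True (tail x)"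
    by (simp add: prov_eq_iff_sem)
  then show ?thesis using that by blast
qed

lemma por_beta: "por_axiom (Lam \<sigma> t \<cdot> u) (inst u t)"
  by (rule por_axiom.intros(18)) (rule beta_eta.beta)

lemma por_beta2: "por_axiom (Lam \<sigma> t \<cdot> u \<cdot> v) (inst u t \<cdot> v)"
  by (rule por_axiom.intros(18)) (rule beta_eta.AppL, rule beta_eta.beta)

lemma den_axiom: "por_axiom t u \<Longrightarrow> str_tm t \<Longrightarrow> str_tm u \<Longrightarrow> den t = den u"
  by (simp add: den_eq_iff eq_axiom)

lemma den_Lam:
  assumes "str_tm b" "str_tm t"
  shows "den (Lam Str (subst (up (\<lambda>i. rep (\<rho> i))) b) \<cdot> t) = sem (den t \<triangleright> \<rho>) b"
proof -
  let ?B = "subst (up (\<lambda>i. rep (\<rho> i))) b"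
  have B: "str_tm ?B" using assms(1) by (intro str_tm_subst typing_up_strs) auto
  have "den (Lam Str ?B \<cdot> t) = den (inst t ?B)"
    by (rule den_axiom[OF por_beta]) (use B assms in \<open>auto simp: typing_App\<close>)
  also have "inst t ?B = subst (case_nat t (\<lambda>i. rep (\<rho> i))) b"
    by (simp add: inst_def subst_up_subst)
  also have "den \<dots> = sem (den t \<triangleright> \<rho>) b" unfolding sem_def
    by (rule den_subst) (use assms in \<open>auto simp: ext_def split: nat.splits\<close>)
  finally show ?thesis .
qed

lemma den_Lam2:
  assumes "str_tm b" "str_tm t" "str_tm u"
  shows "den (Lam Str (Lam Str (subst (up (up (\<lambda>i. rep (\<rho> i)))) b)) \<cdot> t \<cdot> u) = sem (den u \<triangleright> den t \<triangleright> \<rho>) b"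
proof -
  let ?B = "subst (up (up (\<lambda>i. rep (\<rho> i)))) b"
  let ?C = "subst (up (case_nat t (\<lambda>i. rep (\<rho> i)))) b"
  have B: "str_tm ?B" using assms(1) by (intro str_tm_subst typing_up_strs) auto
  have C: "str_tm ?C" using assms(1,2)
    by (intro str_tm_subst typing_up_strs) (auto split: nat.splits)
  have eq: "inst t (Lam Str ?B) = Lam Str ?C"
  proof -
    have up: "up \<theta> 0 = Var 0" "up \<theta> (Suc i) = shift (\<theta> i)" for \<theta> i
      by (simp_all add: up_def)
    have "subst (case_nat t Var) (up (\<lambda>i. rep (\<rho> i)) j) = case_nat t (\<lambda>i. rep (\<rho> i)) j" for j
      by (cases j) (simp_all add: up)
    then have "subst (up (case_nat t Var)) (up (up (\<lambda>i. rep (\<rho> i))) i) = up (case_nat t (\<lambda>i. rep (\<rho> i))) i" for i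
      by (cases i) (simp_all add: up subst_up_shift)
    then show ?thesis by (simp add: inst_def subst_subst)
  qed
  have "den (Lam Str (Lam Str ?B) \<cdot> t \<cdot> u) = den (Lam Str ?C \<cdot> u)"
    unfolding eq[symmetric]
    by (rule den_axiom[OF por_beta2], unfold eq) (use B C assms in \<open>auto simp: typing_App\<close>)
  also have "\<dots> = den (inst u ?C)"
    by (rule den_axiom[OF por_beta]) (use C assms in \<open>auto simp: typing_App\<close>)
  also have "inst u ?C = subst (case_nat u (case_nat t (\<lambda>i. rep (\<rho> i)))) b"
    by (simp add: inst_def subst_up_subst)
  also have "den \<dots> = sem (den u \<triangleright> den t \<triangleright> \<rho>) b" unfolding sem_def
    by (rule den_subst) (use assms in \<open>auto simp: ext_def split: nat.splits\<close>)
  finally show ?thesis .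
qed

lemma sem_Lam2 [simp]:
  assumes "str_tm b" "str_tm t" "str_tm u"
  shows "sem \<rho> (Lam Str (Lam Str b) \<cdot> t \<cdot> u) = sem (sem \<rho> u \<triangleright> sem \<rho> t \<triangleright> \<rho>) b"
  using den_Lam2[OF assms(1), of "subst (\<lambda>i. rep (\<rho> i)) t" "subst (\<lambda>i. rep (\<rho> i)) u" \<rho>] assms
  by (simp add: sem_def)

text \<open>A term of type \<open>Str \<rightarrow>\<^sub>t Str\<close> has no value in
  \<open>elt\<close>, but its action on elements does. A \<open>Rec\<close> without its last
  argument is treated this way, as a function on the world.\<close>

definition appl :: "(nat \<Rightarrow> elt) \<Rightarrow> tm \<Rightarrow> elt \<Rightarrow> elt" where
  "appl \<rho> f n = den (subst (\<lambda>i. rep (\<rho> i)) f \<cdot> rep n)"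

lemma sem_appl: "strs \<turnstile> f : Str \<rightarrow>\<^sub>t Str \<Longrightarrow> str_tm t \<Longrightarrow> sem \<rho> (f \<cdot> t) = appl \<rho> f (sem \<rho> t)"
proof -
  assume "strs \<turnstile> f : Str \<rightarrow>\<^sub>t Str" "str_tm t"
  then have "strs \<turnstile> subst (\<lambda>i. rep (\<rho> i)) f : Str \<rightarrow>\<^sub>t Str" (is "strs \<turnstile> ?f : _") and
    t: "str_tm (subst (\<lambda>i. rep (\<rho> i)) t)" (is "str_tm ?t")
    by (auto intro: typing_subst_strs)
  then have "\<Gamma> \<tturnstile> ?f \<cdot> ?t \<approx> ?f \<cdot> rep (den ?t)"
    by (intro eq_App[of _ _ _ _ _ Str Str] ipor.Refl) (auto simp: den_eq_iff[symmetric])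
  moreover have "str_tm (?f \<cdot> ?t)" "str_tm (?f \<cdot> rep (den ?t))"
    using \<open>strs \<turnstile> ?f : _\<close> t by (auto simp: typing_App)
  ultimately show ?thesis by (simp add: appl_def sem_def den_eq_iff)
qed

lemma den_app1: "strs \<turnstile> f : Str \<rightarrow>\<^sub>t Str \<Longrightarrow> str_tm t \<Longrightarrow> str_tm u \<Longrightarrow> den t = den u \<Longrightarrow> den (f \<cdot> t) = den (f \<cdot> u)"
  using sem_appl[of f _ generic] sem_generic[of t] sem_generic[of u] sem_generic[of "f \<cdot> t"]
    sem_generic[of "f \<cdot> u"] by (metis typing.intros(3))

lemma den_Trunc: "str_tm t \<Longrightarrow> str_tm u \<Longrightarrow> den (Trunc t u) = trunc (den t) (den u)"
  using sem_generic[of "Trunc t u"] by (simp add: sem_generic)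

lemma appl_cong: "(\<And>i. i \<in> fv f \<Longrightarrow> \<rho> i = \<rho>' i) \<Longrightarrow> appl \<rho> f n = appl \<rho>' f n"
  unfolding appl_def by (metis (mono_tags, lifting) subst_cong_fv)

lemma sem_Rec [simp]:
  "str_tm x \<Longrightarrow> str_tm b0 \<Longrightarrow> str_tm b1 \<Longrightarrow> str_tm k \<Longrightarrow> str_tm y \<Longrightarrow>
   sem \<rho> (RecF x b0 b1 k \<cdot> y) = appl \<rho> (RecF x b0 b1 k) (sem \<rho> y)"
  by (rule sem_appl) (auto simp: typing_App)

lemma appl_Rec [simp]:
  assumes "str_tm x" "str_tm b0" "str_tm b1" "str_tm k"
  shows "appl \<rho> (RecF x b0 b1 k) eps = sem \<rho> x"
    and "appl \<rho> (RecF x b0 b1 k) (dg b n) =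
      trunc (sem (appl \<rho> (RecF x b0 b1 k) n \<triangleright> n \<triangleright> \<rho>) (if b then b1 else b0)) (sem (n \<triangleright> \<rho>) k)"
proof -
  have "sem \<rho> (RecF x b0 b1 k \<cdot> Empty) = sem \<rho> x"
    by (rule sem_axiom) (use assms in \<open>auto intro: por_axiom.intros\<close>)
  then show "appl \<rho> (RecF x b0 b1 k) eps = sem \<rho> x" using assms by simp
  let ?\<sigma> = "\<lambda>i. rep (\<rho> i)"
  let ?F = "subst ?\<sigma> (RecF x b0 b1 k)"
  let ?h = "\<lambda>b. Lam Str (Lam Str (subst (up (up ?\<sigma>)) b))" and ?k = "Lam Str (subst (up ?\<sigma>) k)"
  have tyF: "strs \<turnstile> ?F : Str \<rightarrow>\<^sub>t Str"
    by (rule typing_subst_strs[OF typing_RecF]) (use assms in auto)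
  then have ty: "str_tm (?F \<cdot> t)" if "str_tm t" for t using that by (auto simp: typing_App)
  have tyh: "strs \<turnstile> ?h u : Str \<rightarrow>\<^sub>t Str \<rightarrow>\<^sub>t Str" if "str_tm u" for u
    using that by (auto intro!: str_tm_subst typing_up_strs)
  have tyk: "strs \<turnstile> ?k : Str \<rightarrow>\<^sub>t Str"
    using assms by (auto intro!: str_tm_subst typing_up_strs)
  let ?b = "if b then b1 else b0"
  have tyb: "str_tm ?b" using assms by simp
  let ?d = "if b then One else Zero"
  have "den (rep n \<oplus> ?d) = dg b n"
    using sem_generic[of "rep n \<oplus> ?d"] by (cases b) (simp_all add: sem_generic)
  then have "den (?F \<cdot> rep (dg b n)) = den (?F \<cdot> (rep n \<oplus> ?d))"
    by (intro den_app1[OF tyF]) auto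
  also have "\<dots> = den (Trunc (?h ?b \<cdot> rep n \<cdot> (?F \<cdot> rep n)) (?k \<cdot> rep n))"
  proof (rule den_axiom)
    show "por_axiom (?F \<cdot> (rep n \<oplus> ?d)) (Trunc (?h ?b \<cdot> rep n \<cdot> (?F \<cdot> rep n)) (?k \<cdot> rep n))"
      using por_axiom.intros(14,15) by simp
    show "str_tm (?F \<cdot> (rep n \<oplus> ?d))" by (rule ty) simp
    have "str_tm (?h ?b \<cdot> rep n \<cdot> (?F \<cdot> rep n))"
      by (rule str_tm_app2[OF tyh[OF tyb]]) (auto intro: ty simp del: subst.simps)
    moreover have "str_tm (?k \<cdot> rep n)" using tyk typing_App str_tm_rep by blast
    ultimately show "str_tm (Trunc (?h ?b \<cdot> rep n \<cdot> (?F \<cdot> rep n)) (?k \<cdot> rep n))" by simp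
  qed
  also have "\<dots> = trunc (den (?h ?b \<cdot> rep n \<cdot> (?F \<cdot> rep n))) (den (?k \<cdot> rep n))"
  proof (rule den_Trunc)
    show "str_tm (?h ?b \<cdot> rep n \<cdot> (?F \<cdot> rep n))"
      by (rule str_tm_app2[OF tyh[OF tyb]]) (auto intro: ty simp del: subst.simps)
    show "str_tm (?k \<cdot> rep n)" using tyk typing_App str_tm_rep by blast
  qed
  also have "den (?h ?b \<cdot> rep n \<cdot> (?F \<cdot> rep n)) = sem (den (?F \<cdot> rep n) \<triangleright> den (rep n) \<triangleright> \<rho>) ?b"
    by (rule den_Lam2[OF tyb]) (auto intro: ty simp del: subst.simps)
  also have "den (?k \<cdot> rep n) = sem (den (rep n) \<triangleright> \<rho>) k"
    by (rule den_Lam) (use assms in auto)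
  finally show "appl \<rho> (RecF x b0 b1 k) (dg b n) =
      trunc (sem (appl \<rho> (RecF x b0 b1 k) n \<triangleright> n \<triangleright> \<rho>) ?b) (sem (n \<triangleright> \<rho>) k)"
    unfolding appl_def den_rep .
qed

end

section \<open>Equational induction over all worlds\<close>

lemma prov_eqI:
  assumes "\<And>\<Delta>. world \<Delta> \<Longrightarrow> \<Gamma> \<subseteq> \<Delta> \<Longrightarrow>
      world.sem \<Delta> (world.generic \<Delta>) t = world.sem \<Delta> (world.generic \<Delta>) u"
    and "str_tm t" "str_tm u"
  shows "\<Gamma> \<tturnstile> t \<approx> u"
proof (rule ccontr)
  assume "\<not> \<Gamma> \<tturnstile> t \<approx> u"
  then obtain \<Delta> where "world \<Delta>" "\<Gamma> \<subseteq> \<Delta>" "\<not> \<Delta> \<tturnstile> t \<approx> u"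
    by (rule lindenbaum) (use assms(2,3) in auto)
  then show False using assms world.prov_eq_iff_sem by metis
qed

lemma shift_simps [simp]:
  "shift (Var i) = Var (Suc i)" "shift (Const c) = Const c" "shift (t \<cdot> u) = shift t \<cdot> shift u"
  by (simp_all add: shift_def)

lemma prov_pall: "{} \<tturnstile> F \<Longrightarrow> {} \<tturnstile> PAll F"
  by (rule ipor.AllI) simp

lemma np_induct:
  assumes "np_predicate strs F" and 0: "{} \<tturnstile> pinst Empty F"
    and s0: "{F} \<tturnstile> psucc Zero F" and s1: "{F} \<tturnstile> psucc One F"
  shows "{} \<tturnstile> PAll F"
proof -
  have wf: "wf_form strs F" using assms(1) by (simp add: np_predicate_def)
  have "{} \<tturnstile> PAll (PImp F (psucc Zero F))" "{} \<tturnstile> PAll (PImp F (psucc One F))"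
    using s0 s1 wf by (auto intro!: prov_pall ipor.ImpI)
  with 0 have "{} \<tturnstile> PAnd (pinst Empty F) (PAnd (PAll (PImp F (psucc Zero F))) (PAll (PImp F (psucc One F))))"
    (is "_ \<tturnstile> ?P") by (intro ipor.AndI)
  moreover have "{} \<tturnstile> PImp ?P (PAll F)"
    by (rule ipor.Ax) (use assms(1) wf ipor_wf[OF calculation] in \<open>auto intro: ipor_axiom.intros(7)\<close>)
  ultimately show ?thesis using ipor.ImpE by blast
qed

context world
begin

section \<open>Boolean operations and the recursion equations of the defined terms, truncations
  included\<close>

definition bof :: "elt \<Rightarrow> elt" where "bof x = cond x eps (bit False) (bit True)"
definition band :: "elt \<Rightarrow> elt \<Rightarrow> elt" where "band x y = cond (bof x) eps (bit False) (bof y)"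
definition bor :: "elt \<Rightarrow> elt \<Rightarrow> elt" where "bor x y = cond (bof x) (bof y) (bof y) (bit True)"
definition bneg :: "elt \<Rightarrow> elt" where "bneg x = cond x eps (bit True) (bit False)"

lemma bits [simp]:
  "bof eps = eps" "bof (dg b x) = bit b"
  "band (bit b) (bit c) = bit (b \<and> c)" "band eps x = eps"
  "bor (bit b) (bit c) = bit (b \<or> c)"
  "bneg (bit b) = bit (\<not> b)"
  by (auto simp: bof_def band_def bor_def bneg_def)

lemma sem_bops [simp]:
  "str_tm t \<Longrightarrow> sem \<rho> (B_of t) = bof (sem \<rho> t)"
  "str_tm t \<Longrightarrow> str_tm u \<Longrightarrow> sem \<rho> (BAnd t u) = band (sem \<rho> t) (sem \<rho> u)"
  "str_tm t \<Longrightarrow> str_tm u \<Longrightarrow> sem \<rho> (BOr t u) = bor (sem \<rho> t) (sem \<rho> u)"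
  "str_tm t \<Longrightarrow> sem \<rho> (BNeg t) = bneg (sem \<rho> t)"
  by (simp_all add: B_of_def BAnd_def BOr_def BNeg_def bof_def band_def bor_def bneg_def)

lemma sem_Eps_of [simp]: "str_tm t \<Longrightarrow> sem \<rho> (Eps_of t) = bit (sem \<rho> t = eps)"
  by (cases "sem \<rho> t") (auto simp: Eps_of_def)

lemma sem_SameEnd [simp]:
  "str_tm t \<Longrightarrow> str_tm u \<Longrightarrow> sem \<rho> (SameEnd t u) = bit (bof (sem \<rho> t) = bof (sem \<rho> u))"
  by (cases "sem \<rho> t"; cases "sem \<rho> u") (auto simp: SameEnd_def)

lemma sem_appl_shift [simp]:
  assumes "strs \<turnstile> f : Str \<rightarrow>\<^sub>t Str"
  shows "sem (n \<triangleright> \<rho>) (shift f \<cdot> Var 0) = appl \<rho> f n"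
proof -
  have "strs \<turnstile> shift f : Str \<rightarrow>\<^sub>t Str" using typing_shift[OF assms, of Str] by simp
  then have "sem (n \<triangleright> \<rho>) (shift f \<cdot> Var 0) = appl (n \<triangleright> \<rho>) (shift f) n" by (simp add: sem_appl)
  also have "\<dots> = appl \<rho> f n"
    by (simp add: appl_def comp_ext[of rep]) (simp add: ext_def)
  finally show ?thesis .
qed

lemma conc_eps [simp]: "conc x eps = x"
  unfolding conc_def Conc_def ConcC_def by simp

lemma conc_dg: "conc x (dg b y) = trunc (dg b (conc x y)) (dg False (cat x y))"
proof -
  let ?F = "RecF (Var 1) (Var 0 \<oplus> Zero) (Var 0 \<oplus> One) ((Var 2 \<oplus> Var 0) \<oplus> Zero)"
  have c: "conc x y = appl (y \<triangleright> x \<triangleright> x \<triangleright> (\<lambda>_. y)) ?F y" for x y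
    unfolding conc_def Conc_def ConcC_def by simp
  \<comment> \<open>The valuation also contains the recursion argument, but the only free index of
    \<open>?F\<close> is 1, which holds \<open>x\<close>; so both valuations give the same
    function.\<close>
  have "appl (dg b y \<triangleright> x \<triangleright> x \<triangleright> (\<lambda>_. dg b y)) ?F y = conc x y"
    unfolding c by (rule appl_cong) auto
  then show ?thesis by (simp add: c[of x "dg b y"])
qed

abbreviation ones :: "elt \<Rightarrow> elt" where "ones x \<equiv> times (bit True) x"

lemma drop_eps [simp]: "drop x eps = x"
  unfolding drop_def DropC_def by simp

lemma drop_dg_trunc: "drop x (dg b y) = trunc (tail (drop x y)) (ones x)"
proof -
  let ?F = "RecF (Var 1) (Tail (Var 0)) (Tail (Var 0)) (Times One (Var 2))"
  have c: "drop x y = appl (y \<triangleright> x \<triangleright> x \<triangleright> (\<lambda>_. y)) ?F y" for x y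
    unfolding drop_def DropC_def by simp
  have "appl (dg b y \<triangleright> x \<triangleright> x \<triangleright> (\<lambda>_. dg b y)) ?F y = drop x y"
    unfolding c by (rule appl_cong) auto
  then show ?thesis by (simp add: c[of x "dg b y"])
qed

lemma sub_eps: "sub x eps = bit (x = eps)"
  unfolding sub_def Sub_def SubC_def by simp

lemma sub_dg: "sub x (dg b y) = trunc (bor (sub x y) (eqf x (dg b y))) (bit False)"
proof -
  let ?F = "RecF (Eps_of (Var 1)) (BOr (Var 0) (Eq (Var 3) (Var 1 \<oplus> Zero)))
    (BOr (Var 0) (Eq (Var 3) (Var 1 \<oplus> One))) Zero"
  have c: "sub x y = appl (y \<triangleright> x \<triangleright> x \<triangleright> (\<lambda>_. y)) ?F y" for x y
    unfolding sub_def Sub_def SubC_def by simp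
  have "appl (dg b y \<triangleright> x \<triangleright> x \<triangleright> (\<lambda>_. dg b y)) ?F y = sub x y"
    unfolding c by (rule appl_cong) auto
  then show ?thesis by (simp add: c[of x "dg b y"])
qed

end

text \<open>The induction axiom only accepts bounded existential formulas. The equation is disguised
  as one with a dummy quantifier of bound \<open>Empty\<close>, which is equivalent to it because
  the empty string is a witness.\<close>

lemma eq_induct:
  assumes ty: "str_tm t" "str_tm u"
    and 0: "{} \<tturnstile> inst Empty t \<approx> inst Empty u"
    and s0: "{t \<approx> u} \<tturnstile> psucc Zero (t \<approx> u)" and s1: "{t \<approx> u} \<tturnstile> psucc One (t \<approx> u)"
  shows "{} \<tturnstile> PAll (t \<approx> u)"
proof -
  let ?A = "t \<approx> u" and ?F = "pbex Empty (shift t \<approx> shift u)"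
  let ?s = "Times One Empty"
  have wf: "wf_form strs ?F" using ty
    by (auto simp: pbex_def intro!: exI[of _ Str])
  \<comment> \<open>The only inclusion needed for the dummy bound. \<open>?s\<close> evaluates to
    the empty string, where \<open>Sub\<close> reduces to \<open>Eps_of\<close>; the correctness of
    \<open>Eq\<close>, unproved at this stage, is not involved.\<close>
  have "{} \<tturnstile> Sub ?s ?s \<approx> One"
  proof (rule prov_eqI)
    fix \<Delta> assume "world \<Delta>"
    then interpret world \<Delta> .
    show "sem generic (Sub ?s ?s) = sem generic One" by (simp add: sub_eps)
  qed auto
  moreover have "{} \<tturnstile> PIff (?s \<sqsubseteq>\<^sub>P ?s) (Sub ?s ?s \<approx> One)"
    by (rule ipor.Ax) (auto intro!: ipor_axiom.intros(2) exI[of _ Str])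
  ultimately have "{} \<tturnstile> ?s \<sqsubseteq>\<^sub>P ?s" by (metis ipor.ImpE ipor.AndE2)
  then have "{?A} \<tturnstile> ?s \<sqsubseteq>\<^sub>P ?s" by (rule ipor_weaken) simp
  moreover have "{?A} \<tturnstile> ?A" by (rule ipor.Assm) (use ty in auto)
  ultimately have "{?A} \<tturnstile> PAnd (?s \<sqsubseteq>\<^sub>P ?s) ?A" by (rule ipor.AndI)
  then have "{?A} \<tturnstile> pinst Empty (PAnd (Times One (Var 0) \<sqsubseteq>\<^sub>P Times One (shift Empty)) (shift t \<approx> shift u))"
    by (simp add: pinst_def)
  then have AF: "{?A} \<tturnstile> ?F" unfolding pbex_def
    by (rule ipor.ExI) (use wf in \<open>simp_all add: pbex_def\<close>)
  let ?M = "PAnd (Times One (Var 0) \<sqsubseteq>\<^sub>P Times One (shift Empty)) (shift t \<approx> shift u)"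
  have "insert ?M (pshift ` {?F}) \<tturnstile> ?M" by (rule ipor.Assm) (use wf in \<open>auto simp: pbex_def\<close>)
  then have "insert ?M (pshift ` {?F}) \<tturnstile> pshift ?A" unfolding pshift_def psubst.simps shift_eq_subst
    by (rule ipor.AndE2)
  then have FA: "{?F} \<tturnstile> ?A"
    using ipor.ExE[of strs "{?F}" ?M ?A] ipor.Assm[of ?F "{?F}" strs] wf ty
    by (auto simp: pbex_def intro!: exI[of _ Str])
  have inst: "{psubst \<theta> ?A} \<tturnstile> psubst \<theta> ?F" if "\<And>i. str_tm (\<theta> i)" for \<theta>
    using ipor_subst[OF AF that] by simp
  have "{} \<tturnstile> PAll ?F"
  proof (rule np_induct)
    show "np_predicate strs ?F" using wf unfolding np_predicate_def ext_strs
      by (intro conjI exI[of _ Empty] exI[of _ "shift t"] exI[of _ "shift u"]) auto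
    have "{pinst Empty ?A} \<tturnstile> pinst Empty ?F" unfolding pinst_def
      by (rule inst) (auto split: nat.splits)
    then show "{} \<tturnstile> pinst Empty ?F" by (rule prov_cut) (use 0 in auto)
    have "{psucc b ?A} \<tturnstile> psucc b ?F" if "str_tm b" for b unfolding psucc_def
      by (rule inst) (use that in \<open>auto split: nat.splits\<close>)
    then show "{?F} \<tturnstile> psucc Zero ?F" "{?F} \<tturnstile> psucc One ?F"
      using prov_cut[OF _ prov_cut[OF s0 FA], of "{}"] prov_cut[OF _ prov_cut[OF s1 FA], of "{}"] by simp_all
  qed
  from prov_instance[OF this, of Var] have "{} \<tturnstile> ?F" by simp
  with FA have "{} \<tturnstile> ?A" by (rule prov_cut) simp
  then show ?thesis by (rule prov_pall)
qed

text \<open>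
  The elements of one world need not satisfy induction a priori; but a step that holds in every
  world is derivable, so that the induction axiom applies.
\<close>

lemma rule_ind:
  assumes ty: "str_tm t" "str_tm u"
    and 0: "\<And>\<Delta> \<rho>. world \<Delta> \<Longrightarrow>
      world.sem \<Delta> (world.eps \<Delta> \<triangleright> \<rho>) t = world.sem \<Delta> (world.eps \<Delta> \<triangleright> \<rho>) u"
    and s: "\<And>\<Delta> n b \<rho>. world \<Delta> \<Longrightarrow> world.sem \<Delta> (n \<triangleright> \<rho>) t = world.sem \<Delta> (n \<triangleright> \<rho>) u \<Longrightarrow>
      world.sem \<Delta> (world.dg \<Delta> b n \<triangleright> \<rho>) t = world.sem \<Delta> (world.dg \<Delta> b n \<triangleright> \<rho>) u"
    and "world \<Gamma>"
  shows "world.sem \<Gamma> \<rho> t = world.sem \<Gamma> \<rho> u"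
proof -
  have "{} \<tturnstile> PAll (t \<approx> u)"
  proof (rule eq_induct[OF ty])
    show "{} \<tturnstile> inst Empty t \<approx> inst Empty u"
    proof (rule prov_eqI)
      fix \<Delta> assume "world \<Delta>"
      then interpret world \<Delta> .
      show "sem generic (inst Empty t) = sem generic (inst Empty u)"
        using 0[OF \<open>world \<Delta>\<close>] ty by simp
    qed (use ty in auto)
    have "{t \<approx> u} \<tturnstile> psucc (if b then One else Zero) (t \<approx> u)" for b
    proof -
      let ?\<theta> = "Var 0 \<oplus> (if b then One else Zero) \<triangleright> (\<lambda>i. Var (Suc i))"
      have \<theta>: "str_tm (?\<theta> i)" for i by (auto simp: ext_def split: nat.splits)
      have "{t \<approx> u} \<tturnstile> subst ?\<theta> t \<approx> subst ?\<theta> u"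
      proof (rule prov_eqI)
        fix \<Delta> assume "world \<Delta>" and sub: "{t \<approx> u} \<subseteq> \<Delta>"
        then interpret world \<Delta> by simp
        have "\<Delta> \<tturnstile> t \<approx> u" by (rule ipor.Assm) (use sub ty in auto)
        \<comment> \<open>In \<Delta> the induction hypothesis is known under the generic valuation
          only. This is the instance that the step needs, since \<open>s\<close> keeps the
          parameters \<rho> fixed.\<close>
        then have "sem (generic 0 \<triangleright> (\<lambda>i. generic (Suc i))) t = sem (generic 0 \<triangleright> (\<lambda>i. generic (Suc i))) u"
          using ty by (simp add: prov_eq_iff_sem)
        from s[OF \<open>world \<Delta>\<close> this]
        have "sem (dg b (generic 0) \<triangleright> (\<lambda>i. generic (Suc i))) t = sem (dg b (generic 0) \<triangleright> (\<lambda>i. generic (Suc i))) u" .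
        moreover have "(\<lambda>i. sem generic (?\<theta> i)) = dg b (generic 0) \<triangleright> (\<lambda>i. generic (Suc i))"
          unfolding comp_ext by (cases b) simp_all
        ultimately show "sem generic (subst ?\<theta> t) = sem generic (subst ?\<theta> u)"
          using ty \<theta> by simp
      qed (use ty \<theta> in auto)
      then show ?thesis by (simp add: psucc_def ext_def)
    qed
    from this[of False] this[of True]
    show "{t \<approx> u} \<tturnstile> psucc Zero (t \<approx> u)" "{t \<approx> u} \<tturnstile> psucc One (t \<approx> u)" by simp_all
  qed
  from prov_instance[OF this, of Var] have "{} \<tturnstile> t \<approx> u" by simp
  then show ?thesis using world.sem_valid[OF \<open>world \<Gamma>\<close>] ty by blast
qed


section \<open>Strings in a world\<close>

context world
begin

lemma trunc_self [simp]: "trunc z z = z"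
proof -
  have "sem (z \<triangleright> generic) (Trunc (Var 0) (Var 0)) = sem (z \<triangleright> generic) (Var 0)"
  \<comment> \<open>The goals 1 and 2 are typing conditions; 3 is the base case and 4 the step, each
    in an arbitrary world. The same pattern recurs below.\<close>
  proof (rule rule_ind[OF _ _ _ _ world_axioms], goal_cases)
    case (3 \<Delta> \<rho>)
    then interpret w: world \<Delta> .
    show ?case by simp
  next
    case (4 \<Delta> n b \<rho>)
    then interpret w: world \<Delta> by simp
    show ?case using 4(2) by simp
  qed simp_all
  then show ?thesis by simp
qed

text \<open>The truncation bound in \<open>ConcC\<close> is one digit longer than the concatenation
  so far. By the induction hypothesis it has exactly the length of the new value, so
  \<open>trunc_self\<close> removes it.\<close>

lemma conc_cat [simp]: "conc x y = cat x y"
proof -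
  have "sem (y \<triangleright> x \<triangleright> generic) (Conc (Var 1) (Var 0)) = sem (y \<triangleright> x \<triangleright> generic) (Var 1 \<oplus> Var 0)"
  proof (rule rule_ind[OF _ _ _ _ world_axioms], goal_cases)
    case (3 \<Delta> \<rho>)
    then interpret w: world \<Delta> .
    show ?case by simp
  next
    case (4 \<Delta> n b \<rho>)
    then interpret w: world \<Delta> by simp
    show ?case using 4(2) by (simp add: w.conc_dg)
  qed simp_all
  then show ?thesis by simp
qed

lemma times_dg [simp]: "times x (dg b y) = cat (times x y) x"
  by (simp add: times_dg_conc)

lemma cat_assoc: "cat x (cat y z) = cat (cat x y) z"
proof -
  have "sem (z \<triangleright> y \<triangleright> x \<triangleright> generic) (Var 2 \<oplus> (Var 1 \<oplus> Var 0)) =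
      sem (z \<triangleright> y \<triangleright> x \<triangleright> generic) ((Var 2 \<oplus> Var 1) \<oplus> Var 0)"
  proof (rule rule_ind[OF _ _ _ _ world_axioms], goal_cases)
    case (3 \<Delta> \<rho>)
    then interpret w: world \<Delta> .
    show ?case by simp
  next
    case (4 \<Delta> n b \<rho>)
    then interpret w: world \<Delta> by simp
    show ?case using 4(2) by simp
  qed simp_all
  then show ?thesis by simp
qed

lemma cat_dg_ones: "cat (dg True a) (ones x) = dg True (cat a (ones x))"
proof -
  have "sem (x \<triangleright> a \<triangleright> generic) ((Var 1 \<oplus> One) \<oplus> Times One (Var 0)) =
      sem (x \<triangleright> a \<triangleright> generic) ((Var 1 \<oplus> Times One (Var 0)) \<oplus> One)"
  proof (rule rule_ind[OF _ _ _ _ world_axioms], goal_cases)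
    case (3 \<Delta> \<rho>)
    then interpret w: world \<Delta> .
    show ?case by simp
  next
    case (4 \<Delta> n b \<rho>)
    then interpret w: world \<Delta> by simp
    show ?case using 4(2) by simp
  qed simp_all
  then show ?thesis by simp
qed

lemma times_cat: "times a (cat x y) = cat (times a x) (times a y)"
proof -
  have "sem (y \<triangleright> x \<triangleright> a \<triangleright> generic) (Times (Var 2) (Var 1 \<oplus> Var 0)) =
      sem (y \<triangleright> x \<triangleright> a \<triangleright> generic) (Times (Var 2) (Var 1) \<oplus> Times (Var 2) (Var 0))"
  proof (rule rule_ind[OF _ _ _ _ world_axioms], goal_cases)
    case (3 \<Delta> \<rho>)
    then interpret w: world \<Delta> .
    show ?case by simp
  next
    case (4 \<Delta> n b \<rho>)
    then interpret w: world \<Delta> by simp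
    show ?case using 4(2) by (simp add: w.cat_assoc)
  qed simp_all
  then show ?thesis by simp
qed

lemma ones_commute: "cat (ones x) (ones y) = cat (ones y) (ones x)"
proof -
  have "sem (y \<triangleright> x \<triangleright> generic) (Times One (Var 1) \<oplus> Times One (Var 0)) =
      sem (y \<triangleright> x \<triangleright> generic) (Times One (Var 0) \<oplus> Times One (Var 1))"
  proof (rule rule_ind[OF _ _ _ _ world_axioms], goal_cases)
    case (3 \<Delta> \<rho>)
    then interpret w: world \<Delta> .
    show ?case by simp
  next
    case (4 \<Delta> n b \<rho>)
    then interpret w: world \<Delta> by simp
    show ?case using 4(2) by (simp add: w.cat_dg_ones)
  qed simp_all
  then show ?thesis by simp
qed

text \<open>\<open>Trunc\<close> matches digits from the right: after as many steps as
  \<open>d\<close> has digits the first argument is used up, whatever \<open>e\<close> is.\<close>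

lemma trunc_ones: "trunc d (cat e (ones d)) = d"
proof -
  have "sem (d \<triangleright> e \<triangleright> generic) (Trunc (Var 0) (Var 1 \<oplus> Times One (Var 0))) = sem (d \<triangleright> e \<triangleright> generic) (Var 0)"
  proof (rule rule_ind[OF _ _ _ _ world_axioms], goal_cases)
    case (3 \<Delta> \<rho>)
    then interpret w: world \<Delta> .
    show ?case by simp
  next
    case (4 \<Delta> n b \<rho>)
    then interpret w: world \<Delta> by simp
    show ?case using 4(2) by simp
  qed simp_all
  then show ?thesis by simp
qed

text \<open>Both factors of a string fit under its length. This takes the place of a length
  comparison when truncations have to be shown harmless.\<close>

lemma trunc_ones_cat [simp]: "trunc d (ones (cat d e)) = d" "trunc e (ones (cat d e)) = e"
  by (simp_all add: times_cat trunc_ones ones_commute[of d e]) (simp add: ones_commute[of e d] trunc_ones)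

end

text \<open>The last digits of the first argument, as many as the second has, or all of them if
  there are fewer: the part that \<open>DropC\<close> removes. Each step puts the last digit of what
  \<open>DropC\<close> has left in front. It is introduced for the identity \<open>drop_suf\<close>,
  which shows that the truncations of \<open>DropC\<close> are harmless.\<close>

definition SufC :: tm where
  "SufC = Lam Str (Lam Str (RecF Empty (B_of (DropC \<cdot> Var 3 \<cdot> Var 1) \<oplus> Var 0)
     (B_of (DropC \<cdot> Var 3 \<cdot> Var 1) \<oplus> Var 0) (Times One (Var 2)) \<cdot> Var 0))"

lemma typing_SufC: "strs \<turnstile> SufC : Str \<rightarrow>\<^sub>t Str \<rightarrow>\<^sub>t Str"
  by (simp add: SufC_def typing_combinators)

lemma str_tm_SufC [simp]: "str_tm t \<Longrightarrow> str_tm u \<Longrightarrow> str_tm (SufC \<cdot> t \<cdot> u)"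
  by (simp add: str_tm_app2 typing_SufC)

lemma fv_SufC [simp]: "fv SufC = {}"
  by (auto simp: SufC_def B_of_def)

lemma subst_SufC [simp]: "subst \<theta> SufC = SufC"
  by (simp add: subst_closed)

text \<open>The comparison loop of \<open>EqC\<close>, with the two strings as indices 0 and 1.\<close>

definition EqLoop :: tm where
  "EqLoop = (let h = BAnd (Var 0) (SameEnd (DropC \<cdot> Var 3 \<cdot> Var 1) (DropC \<cdot> Var 2 \<cdot> Var 1))
     in RecF One h h Zero)"

lemma typing_EqLoop: "strs \<turnstile> EqLoop : Str \<rightarrow>\<^sub>t Str"
  unfolding EqLoop_def Let_def by (rule typing_RecF) simp_all

context world
begin

definition suf :: "elt \<Rightarrow> elt \<Rightarrow> elt" where "suf a b = sem (a \<triangleright> (\<lambda>_. b)) (SufC \<cdot> Var 0 \<cdot> Var 1)"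

lemma sem_SufC [simp]: "str_tm t \<Longrightarrow> str_tm u \<Longrightarrow> sem \<rho> (SufC \<cdot> t \<cdot> u) = suf (sem \<rho> t) (sem \<rho> u)"
  using sem_op2[of "SufC \<cdot> Var 0 \<cdot> Var 1" t u \<rho>] by (simp add: suf_def)

lemma suf_eps [simp]: "suf x eps = eps"
  unfolding suf_def SufC_def by simp

lemma suf_dg_trunc: "suf x (dg b y) = trunc (cat (bof (drop x y)) (suf x y)) (ones x)"
proof -
  let ?h = "B_of (DropC \<cdot> Var 3 \<cdot> Var 1) \<oplus> Var 0"
  let ?F = "RecF Empty ?h ?h (Times One (Var 2))"
  have c: "suf x y = appl (y \<triangleright> x \<triangleright> x \<triangleright> (\<lambda>_. y)) ?F y" for x y
    unfolding suf_def SufC_def by simp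
  have "appl (dg b y \<triangleright> x \<triangleright> x \<triangleright> (\<lambda>_. dg b y)) ?F y = suf x y"
    unfolding c by (rule appl_cong) auto
  then show ?thesis by (simp add: c[of x "dg b y"])
qed

text \<open>By the hypothesis the values to be truncated are factors of \<open>x\<close>, so
  \<open>trunc_ones_cat\<close> applies to both. What remains is the move of one digit from the end
  of the first factor to the front of the second. The factorization is a hypothesis because
  \<open>drop_suf\<close> uses this as its induction step in every world.\<close>

lemma drop_suf_step:
  assumes "cat (drop x y) (suf x y) = x"
  shows "drop x (dg b y) = tail (drop x y)" "suf x (dg b y) = cat (bof (drop x y)) (suf x y)"
    "cat (drop x (dg b y)) (suf x (dg b y)) = x"
proof -
  show 1: "drop x (dg b y) = tail (drop x y)"
  proof (cases "drop x y")
    case (dg c d)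
    with assms have "x = cat d (cat (bit c) (suf x y))" by (simp add: cat_assoc)
    then have "trunc d (ones x) = d" by (metis trunc_ones_cat(1))
    then show ?thesis by (simp add: drop_dg_trunc dg)
  qed (simp add: drop_dg_trunc)
  show 2: "suf x (dg b y) = cat (bof (drop x y)) (suf x y)"
  proof (cases "drop x y")
    case eps
    with assms show ?thesis by (simp add: suf_dg_trunc) (metis cat_eps_left trunc_ones_cat(2))
  next
    case (dg c d)
    with assms have "x = cat d (cat (bit c) (suf x y))" by (simp add: cat_assoc)
    then have "trunc (cat (bit c) (suf x y)) (ones x) = cat (bit c) (suf x y)"
      by (metis trunc_ones_cat(2))
    then show ?thesis by (simp add: suf_dg_trunc dg)
  qed
  show "cat (drop x (dg b y)) (suf x (dg b y)) = x"
    using assms by (cases "drop x y") (simp_all add: 1 2 cat_assoc)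
qed

lemma drop_suf [simp]: "cat (drop x y) (suf x y) = x"
proof -
  have "sem (y \<triangleright> x \<triangleright> generic) (DropC \<cdot> Var 1 \<cdot> Var 0 \<oplus> SufC \<cdot> Var 1 \<cdot> Var 0) = sem (y \<triangleright> x \<triangleright> generic) (Var 1)"
  proof (rule rule_ind[OF _ _ _ _ world_axioms], goal_cases)
    case (3 \<Delta> \<rho>)
    then interpret w: world \<Delta> .
    show ?case by simp
  next
    case (4 \<Delta> n b \<rho>)
    then interpret w: world \<Delta> by simp
    show ?case using 4(2) by (simp add: w.drop_suf_step(3))
  qed simp_all
  then show ?thesis by simp
qed

lemmas drop_dg [simp] = drop_suf_step(1)[OF drop_suf]
  and suf_dg [simp] = drop_suf_step(2)[OF drop_suf]

lemma drop_tail: "drop (tail x) y = tail (drop x y)"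
proof -
  have "sem (y \<triangleright> x \<triangleright> generic) (DropC \<cdot> Tail (Var 1) \<cdot> Var 0) = sem (y \<triangleright> x \<triangleright> generic) (Tail (DropC \<cdot> Var 1 \<cdot> Var 0))"
  proof (rule rule_ind[OF _ _ _ _ world_axioms], goal_cases)
    case (3 \<Delta> \<rho>)
    then interpret w: world \<Delta> .
    show ?case by simp
  next
    case (4 \<Delta> n b \<rho>)
    then interpret w: world \<Delta> by simp
    show ?case using 4(2) by simp
  qed simp_all
  then show ?thesis by simp
qed

text \<open>The recursion in both arguments at once, which \<open>Rec\<close> does not offer; it
  comes from the commutation of \<open>drop\<close> with \<open>tail\<close>.\<close>

lemma drop_dg_dg: "drop (dg b x) (dg c y) = drop x y"
  using drop_tail[of "dg b x" y] by simp

lemma drop_cat [simp]: "drop (cat x y) y = x"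
proof -
  have "sem (y \<triangleright> x \<triangleright> generic) (DropC \<cdot> (Var 1 \<oplus> Var 0) \<cdot> Var 0) = sem (y \<triangleright> x \<triangleright> generic) (Var 1)"
  proof (rule rule_ind[OF _ _ _ _ world_axioms], goal_cases)
    case (3 \<Delta> \<rho>)
    then interpret w: world \<Delta> .
    show ?case by simp
  next
    case (4 \<Delta> n b \<rho>)
    then interpret w: world \<Delta> by simp
    show ?case using 4(2) by (simp add: w.drop_dg_dg del: w.drop_dg)
  qed simp_all
  then show ?thesis by simp
qed

lemma drop_self [simp]: "drop x x = eps"
  using drop_cat[of eps x] by simp

lemma suf_self [simp]: "suf x x = x"
  using drop_suf[of x x] by simp

section \<open>Correctness of the comparison \<open>Eq\<close>\<close>

definition eqloop :: "elt \<Rightarrow> elt \<Rightarrow> elt \<Rightarrow> elt" where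
  "eqloop x y n = appl (y \<triangleright> (\<lambda>_. x)) EqLoop n"

lemma eqf_eqloop: "eqf x y = eqloop x y (dg True x)"
proof -
  have "eqf x y = appl (y \<triangleright> x \<triangleright> x \<triangleright> (\<lambda>_. y)) EqLoop (dg True x)"
    unfolding eqf_def Eq_def EqC_def EqLoop_def Let_def by simp
  also have "\<dots> = eqloop x y (dg True x)"
    unfolding eqloop_def EqLoop_def Let_def by (rule appl_cong) auto
  finally show ?thesis .
qed

lemma sem_EqLoop: "sem (n \<triangleright> \<rho>) (shift EqLoop \<cdot> Var 0) = eqloop (\<rho> 1) (\<rho> 0) n"
proof -
  have "sem (n \<triangleright> \<rho>) (shift EqLoop \<cdot> Var 0) = appl \<rho> EqLoop n"
    using typing_EqLoop by (rule sem_appl_shift)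
  also have "\<dots> = eqloop (\<rho> 1) (\<rho> 0) n"
    unfolding eqloop_def EqLoop_def Let_def by (rule appl_cong) auto
  finally show ?thesis .
qed

lemma eqloop_eps [simp]: "eqloop x y eps = bit True"
  by (simp add: eqloop_def EqLoop_def Let_def)

lemma eqloop_dg: "eqloop x y (dg b n) =
    trunc (band (eqloop x y n) (bit (bof (drop x n) = bof (drop y n)))) (bit False)"
  by (simp add: eqloop_def EqLoop_def Let_def)

lemma str_tm_EqLoop [simp]: "str_tm (shift EqLoop \<cdot> Var 0)"
  using typing_shift[OF typing_EqLoop, of Str] by (auto simp: typing_App)

text \<open>Being a bit is a disjunction and out of reach of equational induction. Being nonempty is
  an equation, with \<open>Cond\<close> as a test; one unfolding of the loop then yields
  \<open>eqloop_bit\<close>.\<close>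

lemma eqloop_neq_eps: "eqloop x y n \<noteq> eps"
proof -
  let ?t = "shift EqLoop \<cdot> Var 0"
  have "sem (n \<triangleright> y \<triangleright> (\<lambda>_. x)) (Cond ?t Empty One One) = sem (n \<triangleright> y \<triangleright> (\<lambda>_. x)) One"
  proof (rule rule_ind[OF _ _ _ _ world_axioms], goal_cases)
    case (3 \<Delta> \<rho>)
    then interpret w: world \<Delta> .
    show ?case by (simp add: w.sem_EqLoop)
  next
    case (4 \<Delta> n b \<rho>)
    then interpret w: world \<Delta> by simp
    show ?case using 4(2)
      by (cases "w.eqloop (\<rho> 1) (\<rho> 0) n" rule: w.elt_cases)
        (auto simp: w.sem_EqLoop w.eqloop_dg w.band_def split: if_splits)
  qed simp_all
  then show ?thesis by (auto simp: sem_EqLoop)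
qed

lemma eqloop_bit: obtains b where "eqloop x y n = bit b"
proof -
  have "\<exists>b. eqloop x y n = bit b"
  proof (cases n)
    case (dg b m)
    then show ?thesis using eqloop_neq_eps[of x y m]
      by (cases "eqloop x y m") (auto simp: eqloop_dg band_def)
  qed auto
  then show ?thesis using that by blast
qed

lemma eqloop_dg_iff: "eqloop x y (dg b n) = bit True \<longleftrightarrow>
    eqloop x y n = bit True \<and> bof (drop x n) = bof (drop y n)"
  by (rule eqloop_bit[of x y n]) (auto simp: eqloop_dg)

lemma eqloop_refl: "eqloop x x n = bit True"
proof -
  \<comment> \<open>The diagonal: index 0 remains the recursion argument, and both strings become
    index 1.\<close>
  let ?\<theta> = "Var 0 \<triangleright> Var 1 \<triangleright> (\<lambda>_. Var 1)"
  let ?t = "subst ?\<theta> (shift EqLoop \<cdot> Var 0)"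
  have ty: "str_tm (?\<theta> i)" for i by (auto simp: ext_def split: nat.splits)
  have "sem (n \<triangleright> (\<lambda>_. x)) ?t = sem (n \<triangleright> (\<lambda>_. x)) One"
  proof (rule rule_ind[OF _ _ _ _ world_axioms], goal_cases)
    case 1
    show ?case using ty by (intro str_tm_subst) simp_all
  next
    case (3 \<Delta> \<rho>)
    then interpret w: world \<Delta> .
    show ?case using ty by (simp add: w.sem_subst comp_ext w.sem_EqLoop del: subst.simps)
  next
    case (4 \<Delta> n b \<rho>)
    then interpret w: world \<Delta> by simp
    show ?case using 4(2) ty by (simp add: w.sem_subst comp_ext w.sem_EqLoop w.eqloop_dg_iff del: subst.simps)
  qed simp_all
  then show ?thesis using ty by (simp add: comp_ext sem_EqLoop del: subst.simps)
qed

text \<open>The implication is coded as an equation between two \<open>Cond\<close> terms with the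
  same guard, both empty unless the loop has returned 1. In the step, the digits that the loop
  compares are the ones that \<open>suf\<close> puts in front.\<close>

lemma eqloop_suf: "eqloop x y n = bit True \<Longrightarrow> suf x n = suf y n"
proof -
  assume eq: "eqloop x y n = bit True"
  let ?t = "shift EqLoop \<cdot> Var 0"
  have "sem (n \<triangleright> y \<triangleright> (\<lambda>_. x)) (Cond ?t Empty Empty (SufC \<cdot> Var 2 \<cdot> Var 0)) =
    sem (n \<triangleright> y \<triangleright> (\<lambda>_. x)) (Cond ?t Empty Empty (SufC \<cdot> Var 1 \<cdot> Var 0))"
  proof (rule rule_ind[OF _ _ _ _ world_axioms], goal_cases)
    case (3 \<Delta> \<rho>)
    then interpret w: world \<Delta> .
    show ?case by simp
  next
    case (4 \<Delta> n b \<rho>)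
    then interpret w: world \<Delta> by simp
    show ?case using 4(2) w.eqloop_dg_iff[of "\<rho> 1" "\<rho> 0" b n]
      by (cases rule: w.eqloop_bit[of "\<rho> 1" "\<rho> 0" "w.dg b n"]) (auto simp: w.sem_EqLoop)
  qed simp_all
  then show ?thesis using eq by (simp add: sem_EqLoop)
qed

lemma eqf_bit [simp]: "eqf x y = bit (x = y)"
proof (rule eqloop_bit[of x y "dg True x"])
  fix b assume b: "eqloop x y (dg True x) = bit b"
  have "b \<longleftrightarrow> x = y"
  proof
    assume b
    with b have "eqloop x y (dg True x) = bit True" by simp
    then have *: "eqloop x y x = bit True" "bof (drop x x) = bof (drop y x)"
      unfolding eqloop_dg_iff by blast+
    \<comment> \<open>Here the extra digit in the loop argument counts: when as many digits as
      \<open>x\<close> has are removed, nothing is left of \<open>x\<close>, and the last comparison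
      forces the same for \<open>y\<close>.\<close>
    have "drop y x = eps" using *(2) by (cases "drop y x") auto
    then have "suf y x = y" using drop_suf[of y x] by simp
    with eqloop_suf[OF *(1)] show "x = y" by simp
  next
    assume "x = y"
    with b show b by (simp add: eqloop_refl)
  qed
  with b show ?thesis by (simp add: eqf_eqloop)
qed

section \<open>The prefix relation, and the provability of inclusions and flips\<close>

lemma sub_bit: obtains b where "sub x y = bit b"
proof -
  have neq: "sub x y \<noteq> eps" for x y
  proof -
    have "sem (y \<triangleright> x \<triangleright> generic) (Cond (Sub (Var 1) (Var 0)) Empty One One) = sem (y \<triangleright> x \<triangleright> generic) One"
    proof (rule rule_ind[OF _ _ _ _ world_axioms], goal_cases)
      case (3 \<Delta> \<rho>)
      then interpret w: world \<Delta> .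
      show ?case by (simp add: w.sub_eps)
    next
      case (4 \<Delta> n b \<rho>)
      then interpret w: world \<Delta> by simp
      show ?case
        by (cases "w.sub (\<rho> 0) n" rule: w.elt_cases) (auto simp: w.sub_dg w.bor_def)
    qed simp_all
    then show ?thesis by auto
  qed
  have "\<exists>b. sub x y = bit b"
  proof (cases y)
    case (dg b m)
    then show ?thesis using neq[of x m]
      by (cases "sub x m") (auto simp: sub_dg bor_def)
  qed (auto simp: sub_eps)
  then show ?thesis using that by blast
qed

definition pre :: "elt \<Rightarrow> elt \<Rightarrow> bool" where
  "pre x y \<longleftrightarrow> sub x y = bit True"

lemma sub_pre [simp]: "sub x y = bit (pre x y)"
  by (rule sub_bit[of x y]) (auto simp: pre_def)

lemma pre_eps [simp]: "pre x eps \<longleftrightarrow> x = eps"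
  by (simp add: pre_def sub_eps del: sub_pre)

lemma pre_dg: "pre x (dg b y) \<longleftrightarrow> pre x y \<or> x = dg b y"
  using sub_dg[of x b y] by simp

lemma prov_sub_iff:
  assumes "str_tm t" "str_tm u"
  shows "\<Gamma> \<tturnstile> t \<sqsubseteq>\<^sub>P u \<longleftrightarrow> pre (sem generic t) (sem generic u)"
proof -
  have "\<Gamma> \<tturnstile> PIff (t \<sqsubseteq>\<^sub>P u) (Sub t u \<approx> One)"
    by (rule ipor.Ax) (use assms in \<open>auto intro!: ipor_axiom.intros(2) exI[of _ Str]\<close>)
  then have "\<Gamma> \<tturnstile> t \<sqsubseteq>\<^sub>P u \<longleftrightarrow> \<Gamma> \<tturnstile> Sub t u \<approx> One" by (metis ipor.ImpE ipor.AndE1 ipor.AndE2)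
  then show ?thesis using assms by (simp add: prov_eq_iff_sem)
qed

lemma prov_flip_iff:
  assumes "str_tm t"
  shows "\<Gamma> \<tturnstile> PFlip t \<longleftrightarrow> flip (sem generic t) = bit True"
proof -
  have "\<Gamma> \<tturnstile> PIff (PFlip t) (Flipcoin t \<approx> One)"
    by (rule ipor.Ax) (use assms in \<open>auto intro!: ipor_axiom.intros(6) exI[of _ Str]\<close>)
  then have "\<Gamma> \<tturnstile> PFlip t \<longleftrightarrow> \<Gamma> \<tturnstile> Flipcoin t \<approx> One" by (metis ipor.ImpE ipor.AndE1 ipor.AndE2)
  then show ?thesis using assms by (simp add: prov_eq_iff_sem)
qed


subsection \<open>Induction inside a world\<close>

text \<open>Definability with parameters: the other variables of the term take their generic values,
  and every element of the world is the generic value of some term.\<close>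

definition definable :: "(elt \<Rightarrow> elt) \<Rightarrow> bool" where
  "definable f \<longleftrightarrow> (\<exists>t. str_tm t \<and> (\<forall>n. f n = sem (n \<triangleright> generic) t))"

definition decidable :: "(elt \<Rightarrow> bool) \<Rightarrow> bool" where
  "decidable P \<longleftrightarrow> definable (\<lambda>n. bit (P n))"

lemma definable_sem: 
  assumes t: "str_tm t" and F: "\<And>i. definable (\<lambda>n. F n i)"
  shows "definable (\<lambda>n. sem (F n) t)"
proof -
  have "\<exists>u. str_tm u \<and> (\<forall>n. F n i = sem (n \<triangleright> generic) u)" for i
    using F by (simp add: definable_def)
  then obtain \<theta> where \<theta>: "\<And>i. str_tm (\<theta> i)" "\<And>i n. F n i = sem (n \<triangleright> generic) (\<theta> i)" by metis
  then have F: "F n = (\<lambda>i. sem (n \<triangleright> generic) (\<theta> i))" for n by (simp add: fun_eq_iff)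
  have "sem (F n) t = sem (n \<triangleright> generic) (subst \<theta> t)" for n
    using \<theta>(1) t by (simp add: F)
  then show ?thesis unfolding definable_def
    using t \<theta>(1) by (intro exI[of _ "subst \<theta> t"]) simp
qed

lemma definable_id: "definable (\<lambda>n. n)"
  unfolding definable_def by (intro exI[of _ "Var 0"]) simp

lemma definable_const: "definable (\<lambda>_. c)"
  unfolding definable_def by (intro exI[of _ "shift (rep c)"]) (simp add: sem_generic)

lemma definable_ext: "definable f \<Longrightarrow> (\<And>i. definable (\<lambda>n. F n i)) \<Longrightarrow> definable (\<lambda>n. (f n \<triangleright> F n) i)"
  by (cases i) simp_all

lemma definable_op2:
  assumes "str_tm t" "definable f" "definable g"
  shows "definable (\<lambda>n. sem (f n \<triangleright> (\<lambda>_. g n)) t)"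
  using assms by (intro definable_sem definable_ext)

lemma definable_unops:
  assumes "definable f"
  shows "definable (\<lambda>n. dg b (f n))" "definable (\<lambda>n. bneg (f n))"
  using definable_op2[OF _ assms assms, of "Var 0 \<oplus> (if b then One else Zero)"]
    definable_op2[OF _ assms assms, of "BNeg (Var 0)"] by (cases b; simp)+

lemma definable_binops:
  assumes f: "definable f" and g: "definable g"
  shows "definable (\<lambda>n. cat (f n) (g n))" "definable (\<lambda>n. times (f n) (g n))"
    "definable (\<lambda>n. drop (f n) (g n))" "definable (\<lambda>n. suf (f n) (g n))"
    "definable (\<lambda>n. band (f n) (g n))"
    "decidable (\<lambda>n. f n = g n)" "decidable (\<lambda>n. pre (f n) (g n))"
proof -
  note op = definable_op2[OF _ f g]
  show "definable (\<lambda>n. cat (f n) (g n))" using op[of "Var 0 \<oplus> Var 1"] by simp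
  show "definable (\<lambda>n. times (f n) (g n))" using op[of "Times (Var 0) (Var 1)"] by simp
  show "definable (\<lambda>n. drop (f n) (g n))" using op[of "DropC \<cdot> Var 0 \<cdot> Var 1"] by simp
  show "definable (\<lambda>n. suf (f n) (g n))" using op[of "SufC \<cdot> Var 0 \<cdot> Var 1"] by simp
  show "definable (\<lambda>n. band (f n) (g n))" using op[of "BAnd (Var 0) (Var 1)"] by simp
  show "decidable (\<lambda>n. f n = g n)" unfolding decidable_def using op[of "Eq (Var 0) (Var 1)"] by simp
  show "decidable (\<lambda>n. pre (f n) (g n))" unfolding decidable_def using op[of "Sub (Var 0) (Var 1)"] by simp
qed

lemma decidable_not: "decidable P \<Longrightarrow> decidable (\<lambda>n. \<not> P n)"
  using definable_unops(2)[of "\<lambda>n. bit (P n)"] by (simp add: decidable_def)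

lemma decidable_imp: "decidable P \<Longrightarrow> decidable Q \<Longrightarrow> decidable (\<lambda>n. P n \<longrightarrow> Q n)"
  using definable_unops(2)[OF definable_binops(5)[of "\<lambda>n. bit (P n)" "\<lambda>n. bit (\<not> Q n)"]] decidable_not[of Q]
  by (simp add: decidable_def)

lemmas definable_intros = definable_id definable_const definable_unops definable_binops
  decidable_not decidable_imp

end

section \<open>Search along the prefixes of a string\<close>

abbreviation digit :: "bool \<Rightarrow> tm" where "digit b \<equiv> (if b then One else Zero)"

text \<open>\<open>next_at b t\<close> is \<open>t(w b)\<close> where \<open>t(x)\<close> has \<open>x\<close> as index 0 and \<open>w\<close> is the recursion argument.\<close>

definition next_at :: "bool \<Rightarrow> tm \<Rightarrow> tm" where
  "next_at b t = subst (Var 1 \<oplus> digit b \<triangleright> (\<lambda>i. Var (Suc (Suc i)))) t"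

text \<open>The comparisons with \<open>One\<close> turn all values into single digits, so that the
  bound \<open>Zero\<close>, of length one, cuts nothing off.\<close>

definition all_prefixes :: "tm \<Rightarrow> tm" where
  "all_prefixes t = RecF (Eq (inst Empty t) One)
     (BAnd (Eq (Var 0) One) (Eq (next_at False t) One))
     (BAnd (Eq (Var 0) One) (Eq (next_at True t) One)) Zero"

definition ex_prefix :: "tm \<Rightarrow> tm" where
  "ex_prefix t = RecF (Eq (inst Empty t) One)
     (BOr (Eq (Var 0) One) (Eq (next_at False t) One))
     (BOr (Eq (Var 0) One) (Eq (next_at True t) One)) Zero"

text \<open>How many digits to remove from \<open>y\<close> to reach the last prefix at which \<open>all_prefixes t\<close> holds.\<close>

definition overshoot :: "tm \<Rightarrow> tm" where
  "overshoot t = (let h = Cond (Eq (subst (Var 1 \<triangleright> (\<lambda>i. Var (Suc (Suc i)))) (shift (all_prefixes t) \<cdot> Var 0)) One)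
       Empty (Var 0 \<oplus> One) One in RecF Empty h h (Var 0 \<oplus> One))"

lemma str_tm_ext: "str_tm t \<Longrightarrow> (\<And>i. str_tm (\<theta> i)) \<Longrightarrow> str_tm ((t \<triangleright> \<theta>) i)"
  by (cases i) auto

lemma str_tm_next_at [simp]: "str_tm t \<Longrightarrow> str_tm (next_at b t)"
  unfolding next_at_def by (intro str_tm_subst str_tm_ext) auto

lemma typing_all_prefixes: "str_tm t \<Longrightarrow> strs \<turnstile> all_prefixes t : Str \<rightarrow>\<^sub>t Str"
  unfolding all_prefixes_def by (rule typing_RecF) simp_all

lemma typing_ex_prefix: "str_tm t \<Longrightarrow> strs \<turnstile> ex_prefix t : Str \<rightarrow>\<^sub>t Str"
  unfolding ex_prefix_def by (rule typing_RecF) simp_all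

lemma str_tm_shift_App [simp]: "strs \<turnstile> f : Str \<rightarrow>\<^sub>t Str \<Longrightarrow> str_tm u \<Longrightarrow> str_tm (shift f \<cdot> u)"
  using typing_shift[of strs f _ Str] by (auto simp: typing_App)

lemma str_tm_overshoot_test:
  "str_tm t \<Longrightarrow> str_tm (subst (Var 1 \<triangleright> (\<lambda>i. Var (Suc (Suc i)))) (shift (all_prefixes t) \<cdot> Var 0))"
  by (intro str_tm_subst str_tm_ext) (simp_all add: typing_all_prefixes)

lemma typing_overshoot: "str_tm t \<Longrightarrow> strs \<turnstile> overshoot t : Str \<rightarrow>\<^sub>t Str"
  unfolding overshoot_def Let_def
  by (rule typing_RecF) (simp_all add: str_tm_overshoot_test del: subst.simps One_nat_def)

context world
begin

lemma sem_next_at [simp]: "str_tm t \<Longrightarrow> sem (r \<triangleright> w \<triangleright> \<rho>) (next_at b t) = sem (dg b w \<triangleright> \<rho>) t"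
  unfolding next_at_def by (subst sem_subst) (auto intro!: str_tm_ext simp: comp_ext)

lemma appl_all_prefixes [simp]:
  assumes "str_tm t"
  shows "appl \<rho> (all_prefixes t) eps = bit (sem (eps \<triangleright> \<rho>) t = bit True)"
    "appl \<rho> (all_prefixes t) (dg b n) =
      bit (appl \<rho> (all_prefixes t) n = bit True \<and> sem (dg b n \<triangleright> \<rho>) t = bit True)"
  using assms by (simp_all add: all_prefixes_def)

lemma appl_ex_prefix [simp]:
  assumes "str_tm t"
  shows "appl \<rho> (ex_prefix t) eps = bit (sem (eps \<triangleright> \<rho>) t = bit True)"
    "appl \<rho> (ex_prefix t) (dg b n) =
      bit (appl \<rho> (ex_prefix t) n = bit True \<or> sem (dg b n \<triangleright> \<rho>) t = bit True)"
  using assms by (simp_all add: ex_prefix_def)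

lemma appl_overshoot_trunc:
  assumes "str_tm t"
  shows "appl \<rho> (overshoot t) eps = eps"
    "appl \<rho> (overshoot t) (dg b n) =
      trunc (if appl \<rho> (all_prefixes t) n = bit True then bit True else dg True (appl \<rho> (overshoot t) n)) (dg True n)"
proof -
  note ty = str_tm_overshoot_test[OF assms]
  have "sem (r \<triangleright> n \<triangleright> \<rho>) (subst (Var 1 \<triangleright> (\<lambda>i. Var (Suc (Suc i)))) (shift (all_prefixes t) \<cdot> Var 0)) =
    appl \<rho> (all_prefixes t) n" for r
    using typing_all_prefixes[OF assms]
    by (subst sem_subst) (auto intro!: str_tm_ext simp: comp_ext simp del: subst.simps)
  then show "appl \<rho> (overshoot t) eps = eps"
    "appl \<rho> (overshoot t) (dg b n) =
      trunc (if appl \<rho> (all_prefixes t) n = bit True then bit True else dg True (appl \<rho> (overshoot t) n)) (dg True n)"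
    using ty by (simp_all add: overshoot_def Let_def del: subst.simps)
qed

text \<open>The overshoot at \<open>n\<close> fits under \<open>n\<close>: it is either reset to one
  digit or grows by one digit together with \<open>n\<close>. So the bound, one digit longer than
  the recursion argument, is harmless.\<close>

lemma trunc_overshoot:
  assumes "str_tm t"
  shows "trunc (appl \<rho> (overshoot t) n) n = appl \<rho> (overshoot t) n"
proof -
  note ty = typing_overshoot[OF assms]
  let ?t = "shift (overshoot t) \<cdot> Var 0"
  have "sem (n \<triangleright> \<rho>) (Trunc ?t (Var 0)) = sem (n \<triangleright> \<rho>) ?t"
  proof (rule rule_ind[OF _ _ _ _ world_axioms], goal_cases)
    case (3 \<Delta> \<rho>)
    then interpret w: world \<Delta> .
    show ?case using ty by (simp add: w.appl_overshoot_trunc[OF assms])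
  next
    case (4 \<Delta> n b \<rho>)
    then interpret w: world \<Delta> by simp
    show ?case using 4(2) ty by (simp add: w.appl_overshoot_trunc[OF assms])
  qed (use ty in simp_all)
  then show ?thesis using ty by simp
qed

lemma appl_overshoot [simp]:
  assumes "str_tm t"
  shows "appl \<rho> (overshoot t) eps = eps"
    "appl \<rho> (overshoot t) (dg b n) =
      (if appl \<rho> (all_prefixes t) n = bit True then bit True else dg True (appl \<rho> (overshoot t) n))"
  by (simp_all add: appl_overshoot_trunc trunc_overshoot assms)

text \<open>The passage from uniform induction to a single world. The place \<open>s\<close> is not
  merely asserted to exist but computed from \<open>n\<close>, as the last prefix of
  \<open>n\<close> up to which \<open>t\<close> holds throughout. This makes the statement one
  equation, which equational induction proves in all worlds at once.\<close>

lemma counterexample: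
  fixes t \<rho> defines "f \<equiv> \<lambda>n. sem (n \<triangleright> \<rho>) t = bit True" and "a \<equiv> \<lambda>n. appl \<rho> (all_prefixes t) n = bit True"
  assumes t: "str_tm t" and "f eps"
  shows "a n \<or> (\<exists>s. a s \<and> \<not> (f (dg False s) \<and> f (dg True s)))"
proof -
  define A where "A = shift (all_prefixes t) \<cdot> Var 0"
  define C where "C = shift (overshoot t) \<cdot> Var 0"
  let ?p = "\<lambda>i. Var (Suc i)"
  define S where "S = DropC \<cdot> Var 0 \<cdot> C"
  define T where "T x = subst (x \<triangleright> ?p) t" for x
  have ty: "str_tm A" "str_tm C" "str_tm S" "\<And>x. str_tm x \<Longrightarrow> str_tm (T x)"
    "\<And>x. str_tm x \<Longrightarrow> str_tm (subst (x \<triangleright> ?p) A)"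
    using typing_all_prefixes[OF t] typing_overshoot[OF t]
    by (auto simp: A_def C_def S_def T_def t simp del: subst.simps intro!: str_tm_subst str_tm_ext)
  define cl where "cl = BOr (Eq A One) (BAnd (Eq (subst (S \<triangleright> ?p) A) One)
     (BNeg (BAnd (Eq (T (S \<oplus> Zero)) One) (Eq (T (S \<oplus> One)) One))))"
  \<comment> \<open>The outer \<open>Cond\<close> encodes the premise \<open>f eps\<close>: if it
    fails, the value is \<open>One\<close> regardless of \<open>cl\<close>.\<close>
  let ?u = "Cond (Eq (T Empty) One) Empty One cl"
  have sA: "world.sem \<Delta> (n \<triangleright> \<rho>) A = world.appl \<Delta> \<rho> (all_prefixes t) n"
    and sC: "world.sem \<Delta> (n \<triangleright> \<rho>) C = world.appl \<Delta> \<rho> (overshoot t) n"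
    if "world \<Delta>" for \<Delta> n \<rho>
    using world.sem_appl_shift[OF that] typing_all_prefixes[OF t] typing_overshoot[OF t]
    by (auto simp: A_def C_def)
  have sT: "world.sem \<Delta> (n \<triangleright> \<rho>) (T x) = world.sem \<Delta> (world.sem \<Delta> (n \<triangleright> \<rho>) x \<triangleright> \<rho>) t"
    if "world \<Delta>" "str_tm x" for \<Delta> n x \<rho>
  proof -
    interpret w: world \<Delta> by fact
    show ?thesis unfolding T_def by (subst w.sem_subst) (auto intro!: str_tm_ext simp: comp_ext t that)
  qed
  have sA2: "world.sem \<Delta> (n \<triangleright> \<rho>) (subst (x \<triangleright> ?p) A) = world.appl \<Delta> \<rho> (all_prefixes t) (world.sem \<Delta> (n \<triangleright> \<rho>) x)"
    if "world \<Delta>" "str_tm x" for \<Delta> n x \<rho>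
  proof -
    interpret w: world \<Delta> by fact
    show ?thesis by (subst w.sem_subst) (auto intro!: str_tm_ext simp: comp_ext ty that sA[OF that(1)])
  qed
  have sem_cl: "world.sem \<Delta> (n \<triangleright> \<rho>) ?u = world.dg \<Delta> 
     (world.sem \<Delta> (world.eps \<Delta> \<triangleright> \<rho>) t = world.bit \<Delta> True \<longrightarrow>
     (let s = world.drop \<Delta> n (world.appl \<Delta> \<rho> (overshoot t) n) in
      world.appl \<Delta> \<rho> (all_prefixes t) n = world.bit \<Delta> True \<or>
      (world.appl \<Delta> \<rho> (all_prefixes t) s = world.bit \<Delta> True \<and>
       \<not> (world.sem \<Delta> (world.dg \<Delta> False s \<triangleright> \<rho>) t = world.bit \<Delta> True \<and>
          world.sem \<Delta> (world.dg \<Delta> True s \<triangleright> \<rho>) t = world.bit \<Delta> True)))) (world.eps \<Delta>)"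
    if w: "world \<Delta>" for \<Delta> n \<rho>
  proof -
    interpret w: world \<Delta> by fact
    have S: "w.sem (n \<triangleright> \<rho>) S = w.drop n (w.appl \<rho> (overshoot t) n)"
      by (simp add: S_def ty sC[OF w])
    show ?thesis
      by (simp add: cl_def ty sT[OF w] sA[OF w] sA2[OF w] S Let_def)
  qed
  have "sem (n \<triangleright> \<rho>) ?u = sem (n \<triangleright> \<rho>) One"
  proof (rule rule_ind[OF _ _ _ _ world_axioms], goal_cases)
    case (3 \<Delta> \<rho>)
    then interpret w: world \<Delta> .
    show ?case using 3 by (simp add: sem_cl t Let_def)
  next
    case (4 \<Delta> n b \<rho>)
    then interpret w: world \<Delta> by simp
    \<comment> \<open>If all prefixes of \<open>n\<close> are good but the new string is not, the
      overshoot is one digit, \<open>s\<close> is \<open>n\<close>, and the step fails there. If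
      \<open>n\<close> was bad already, the overshoot grows with the string, so \<open>s\<close> and
      the failure at it stay the same.\<close>
    show ?case using 4
      by (simp add: sem_cl t Let_def w.drop_dg_dg del: w.drop_dg) (cases b; auto)
  qed (simp_all add: cl_def ty)
  then show ?thesis using assms unfolding sem_cl[OF world_axioms] by (auto simp: Let_def)
qed

theorem elt_induct [case_names decidable eps dg]:
  assumes "decidable P" and "P eps" and step: "\<And>b n. P n \<Longrightarrow> P (dg b n)"
  shows "P n"
proof -
  obtain t where t: "str_tm t" "\<And>n. bit (P n) = sem (n \<triangleright> generic) t"
    using assms(1) by (auto simp: decidable_def definable_def)
  have P: "P n \<longleftrightarrow> sem (n \<triangleright> generic) t = bit True" for n
    by (simp add: t(2)[symmetric])
  have aP: "P n" if "appl generic (all_prefixes t) n = bit True" for n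
    using that t(1) by (cases n) (auto simp: P)
  from counterexample[OF t(1), of generic n] assms(2) show ?thesis
    using aP step by (auto simp: P[symmetric])
qed


lemma definable_appl:
  assumes "strs \<turnstile> F : Str \<rightarrow>\<^sub>t Str" "definable f"
  shows "definable (\<lambda>n. appl \<rho> F (f n))"
proof -
  have "definable (\<lambda>n. sem (f n \<triangleright> \<rho>) (shift F \<cdot> Var 0))"
    by (rule definable_sem) (use assms in \<open>auto intro!: definable_ext definable_const\<close>)
  then show ?thesis using assms(1) by simp
qed

section \<open>Prefixes, suffixes and lengths, by induction within a world\<close>

lemma pre_refl [simp]: "pre x x"
  by (cases x) (auto simp: pre_dg)

lemma eps_pre [simp]: "pre eps x"
proof (induction x rule: elt_induct)
  case decidable
  show ?case by (intro definable_intros)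
qed (auto simp: pre_dg)

lemma pre_dgD: "pre (dg b x) y \<Longrightarrow> pre x y"
proof -
  have "pre (dg b x) y \<longrightarrow> pre x y"
  proof (induction y rule: elt_induct)
    case decidable
    show ?case by (intro definable_intros)
  qed (auto simp: pre_dg)
  then show "pre (dg b x) y \<Longrightarrow> pre x y" by simp
qed

text \<open>The existential statement is not known to be decidable, so the forward direction is by
  contradiction: if there is no witness, the decidable statement that the search fails at each
  prefix of \<open>n\<close> is inductive.\<close>

lemma appl_ex_prefix_iff:
  assumes t: "str_tm t"
  shows "appl \<rho> (ex_prefix t) n = bit True \<longleftrightarrow> (\<exists>v. pre v n \<and> sem (v \<triangleright> \<rho>) t = bit True)"
proof
  note F = typing_ex_prefix[OF t]
  assume ap: "appl \<rho> (ex_prefix t) n = bit True"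
  show "\<exists>v. pre v n \<and> sem (v \<triangleright> \<rho>) t = bit True"
  proof (rule ccontr)
    assume none: "\<not> ?thesis"
    have "pre s n \<longrightarrow> appl \<rho> (ex_prefix t) s \<noteq> bit True" for s
    proof (induction s rule: elt_induct)
      case decidable
      show ?case by (intro definable_intros definable_appl F)
    qed (use none pre_dgD in \<open>auto simp: t\<close>)
    with ap show False by auto
  qed
next
  note F = typing_ex_prefix[OF t]
  assume "\<exists>v. pre v n \<and> sem (v \<triangleright> \<rho>) t = bit True"
  then obtain v where v: "pre v n" "sem (v \<triangleright> \<rho>) t = bit True" by auto
  have "pre v n \<longrightarrow> appl \<rho> (ex_prefix t) n = bit True"
  proof (induction n rule: elt_induct)
    case decidable
    show ?case by (intro definable_intros definable_appl F)
  qed (use v(2) in \<open>auto simp: pre_dg t\<close>)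
  with v show "appl \<rho> (ex_prefix t) n = bit True" by simp
qed

lemma pre_iff_cat: "pre x y \<longleftrightarrow> (\<exists>e. y = cat x e)"
proof
  assume pre: "pre x y"
  show "\<exists>e. y = cat x e"
  proof (rule ccontr)
    assume none: "\<not> ?thesis"
    have "pre x (drop y k)" for k
    proof (induction k rule: elt_induct)
      case decidable
      show ?case by (intro definable_intros)
    next
      case (dg b k)
      have "drop y k \<noteq> x" using none drop_suf[of y k] by metis
      with dg show ?case by (cases "drop y k") (auto simp: pre_dg)
    qed (simp add: pre)
    from this[of y] have "x = eps" by simp
    with none show False by simp
  qed
next
  assume "\<exists>e. y = cat x e"
  then obtain e where y: "y = cat x e" by auto
  have "pre x (cat x e)"
  proof (induction e rule: elt_induct)
    case decidable
    show ?case by (intro definable_intros)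
  qed (auto simp: pre_dg)
  with y show "pre x y" by simp
qed

lemma pre_cat [simp]: "pre x (cat x e)"
  by (auto simp: pre_iff_cat)

lemma pre_trans: "pre x y \<Longrightarrow> pre y z \<Longrightarrow> pre x z"
  by (auto simp: pre_iff_cat cat_assoc[symmetric])

lemma drop_ones [simp]: "drop x (ones y) = drop x y"
proof (induction y rule: elt_induct)
  case decidable
  show ?case by (intro definable_intros)
qed auto

lemma suf_ones [simp]: "suf x (ones y) = suf x y"
proof (induction y rule: elt_induct)
  case decidable
  show ?case by (intro definable_intros)
qed auto

lemma suf_dg_dg: "suf (dg b x) (dg c y) = dg b (suf x y)"
proof -
  have "suf (dg b x) (dg True y) = dg b (suf x y)"
  proof (induction y rule: elt_induct)
    case decidable
    show ?case by (intro definable_intros)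
  next
    case (dg d y)
    have "drop (dg b x) (dg d y) = drop x y" by (rule drop_dg_dg)
    moreover have "suf (dg b x) (dg d y) = suf (dg b x) (dg True y)" by simp
    ultimately show ?case using dg
      by (subst suf_dg) (simp del: suf_dg drop_dg, simp)
  qed simp
  then show ?thesis by simp
qed

lemma suf_cat [simp]: "suf (cat x y) y = y"
proof (induction y rule: elt_induct)
  case decidable
  show ?case by (intro definable_intros)
next
  case (dg b y)
  then show ?case by (simp add: suf_dg_dg del: suf_dg)
qed simp

lemma tail_ones: "tail (ones x) = ones (tail x)"
  by (cases x) simp_all

lemma ones_drop: "ones (drop x y) = drop (ones x) y"
proof (induction y rule: elt_induct)
  case decidable
  show ?case by (intro definable_intros)
qed (simp_all add: tail_ones[symmetric])

lemma times_ones: "times x (ones y) = times x y"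
proof (induction y rule: elt_induct)
  case decidable
  show ?case by (intro definable_intros)
qed simp_all

definition shorter :: "elt \<Rightarrow> elt \<Rightarrow> bool" where
  "shorter x y \<longleftrightarrow> pre (ones x) (ones y)"

text \<open>Cutting \<open>y\<close> by the excess \<open>e\<close> of its length over that of
  \<open>x\<close> leaves a prefix with the length of \<open>x\<close>, as \<open>ones\<close>
  commutes with \<open>drop\<close>.\<close>

lemma shorter_iff: "shorter x y \<longleftrightarrow> (\<exists>c d. y = cat c d \<and> ones c = ones x)"
proof
  assume "shorter x y"
  then obtain e where e: "ones y = cat (ones x) e" by (auto simp: shorter_def pre_iff_cat)
  then have "ones (drop y e) = ones x" by (simp add: ones_drop)
  then show "\<exists>c d. y = cat c d \<and> ones c = ones x" using drop_suf[of y e] by metis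
next
  assume "\<exists>c d. y = cat c d \<and> ones c = ones x"
  then obtain c d where "y = cat c d" "ones c = ones x" by auto
  then show "shorter x y" by (simp add: shorter_def times_cat)
qed

lemma shorter_refl [simp]: "shorter x x"
  by (simp add: shorter_def)

lemma shorter_trans: "shorter x y \<Longrightarrow> shorter y z \<Longrightarrow> shorter x z"
  by (auto simp: shorter_def intro: pre_trans)

lemma shorter_cat: "shorter x y \<Longrightarrow> shorter x' y' \<Longrightarrow> shorter (cat x x') (cat y y')"
proof -
  assume "shorter x y" "shorter x' y'"
  then obtain c d c' d' where y: "y = cat c d" "y' = cat c' d'" and x: "ones c = ones x" "ones c' = ones x'"
    by (auto simp: shorter_iff)
  have "ones (cat y y') = cat (ones x) (cat (cat (ones d) (ones x')) (ones d'))"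
    by (simp add: y x times_cat cat_assoc)
  also have "cat (ones d) (ones x') = cat (ones x') (ones d)" by (rule ones_commute)
  finally show ?thesis by (simp add: shorter_def times_cat cat_assoc) (metis cat_assoc pre_cat)
qed

text \<open>Monotonicity in the first argument is by induction on \<open>x'\<close>. For the second,
  \<open>x'\<close> is replaced by a prefix of \<open>y'\<close> of the same length, since
  \<open>times\<close> sees only the length of its second argument.\<close>

lemma shorter_times: "shorter x y \<Longrightarrow> shorter x' y' \<Longrightarrow> shorter (times x x') (times y y')"
proof -
  assume xy: "shorter x y" and "shorter x' y'"
  then obtain c d where y': "y' = cat c d" "ones c = ones x'" by (auto simp: shorter_iff)
  have "shorter (times x x') (times y x')"
  proof (induction x' rule: elt_induct)
    case decidable
    show ?case unfolding shorter_def
      by (intro definable_intros)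
  qed (simp_all add: shorter_cat xy)
  also have "times y x' = times y c" using y'(2) times_ones by metis
  finally have "shorter (times x x') (times y c)" .
  moreover have "shorter (times y c) (times y y')" by (simp add: y' shorter_def times_cat)
  ultimately show ?thesis by (rule shorter_trans)
qed

lemma shorter_suffix: "shorter x (cat w x)"
  using ones_commute[of w x] by (simp add: shorter_def times_cat)

end

section \<open>The translation\<close>

lemma tr_rtsubst: "tr_term (rtsubst \<sigma> t) = subst (\<lambda>i. tr_term (\<sigma> i)) (tr_term t)"
  by (induction t) auto

lemma tr_rtshift [simp]: "tr_term (rtshift t) = shift (tr_term t)"
  by (simp add: rtshift_def tr_rtsubst shift_eq_subst)

lemma tr_rsubst: "tr (rsubst \<sigma> F) = psubst (\<lambda>i. tr_term (\<sigma> i)) (tr F)"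
proof (induction F arbitrary: \<sigma>)
  case (REx F)
  have "(\<lambda>i. tr_term (rup \<sigma> i)) = up (\<lambda>i. tr_term (\<sigma> i))"
    by (auto simp: rup_def up_def fun_eq_iff split: nat.splits)
  then show ?case using REx by simp
next
  case (RAll F)
  have "(\<lambda>i. tr_term (rup \<sigma> i)) = up (\<lambda>i. tr_term (\<sigma> i))"
    by (auto simp: rup_def up_def fun_eq_iff split: nat.splits)
  then show ?case using RAll by simp
qed (auto simp: tr_rtsubst)

lemma tr_rshift [simp]: "tr (rshift F) = pshift (tr F)"
  by (simp add: rshift_def pshift_def tr_rsubst)

lemma tr_rinst [simp]: "tr (rinst t F) = pinst (tr_term t) (tr F)"
proof -
  have "(\<lambda>i. tr_term (case_nat t RVar i)) = case_nat (tr_term t) Var"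
    by (auto simp: fun_eq_iff split: nat.splits)
  then show ?thesis by (simp add: rinst_def pinst_def tr_rsubst)
qed

lemma tr_rsucc [simp]: "tr (rsucc b F) = psucc (tr_term b) (tr F)"
proof -
  have "(\<lambda>i. tr_term (case_nat (RVar 0 \<frown> b) (\<lambda>i. RVar (Suc i)) i)) =
      case_nat (Var 0 \<oplus> tr_term b) (\<lambda>i. Var (Suc i))"
    by (auto simp: fun_eq_iff split: nat.splits)
  then show ?thesis by (simp add: rsucc_def psucc_def tr_rsubst)
qed

lemma str_tm_tr [simp]: "str_tm (tr_term t)"
  by (induction t) auto

lemma wf_tr [simp]: "wf_form strs (tr F)"
  by (induction F) (auto intro!: exI[of _ Str])


section \<open>Characteristic terms\<close>

lemma provI:
  assumes "\<And>\<Delta>. world \<Delta> \<Longrightarrow> \<Gamma> \<subseteq> \<Delta> \<Longrightarrow> \<Delta> \<tturnstile> F" and "wf_form strs F"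
  shows "\<Gamma> \<tturnstile> F"
proof (rule ccontr)
  assume "\<not> \<Gamma> \<tturnstile> F"
  then obtain \<Delta> where "world \<Delta>" "\<Gamma> \<subseteq> \<Delta>" "\<not> \<Delta> \<tturnstile> F"
    using assms(2) by (rule lindenbaum)
  then show False using assms(1) by metis
qed

lemma wf_eq_One [simp]: "wf_form strs (c \<approx> One) \<longleftrightarrow> str_tm c"
  by auto

definition characteristic :: "tm \<Rightarrow> pform \<Rightarrow> bool" where
  "characteristic c F \<longleftrightarrow> str_tm c \<and> wf_form strs F \<and> {} \<tturnstile> PIff F (c \<approx> One)"

lemma prov_PIffI: "insert F \<Gamma> \<tturnstile> G \<Longrightarrow> insert G \<Gamma> \<tturnstile> F \<Longrightarrow> \<Gamma> \<tturnstile> PIff F G"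
  by (metis ipor.AndI ipor.ImpI ipor_wf)

lemma prov_PIff_iff: "{} \<tturnstile> PIff F G \<Longrightarrow> \<Gamma> \<tturnstile> F \<longleftrightarrow> \<Gamma> \<tturnstile> G"
  using ipor_weaken[of strs "{}" "PIff F G" \<Gamma>] by (metis empty_subsetI ipor.AndE1 ipor.AndE2 ipor.ImpE)

lemma prov_PIff_subst: "{} \<tturnstile> PIff F G \<Longrightarrow> (\<And>i. str_tm (\<theta> i)) \<Longrightarrow> {} \<tturnstile> PIff (psubst \<theta> F) (psubst \<theta> G)"
  using ipor_subst[of "{}" "PIff F G" \<theta>] by simp

lemma characteristicI:
  assumes c: "str_tm c" and wf: "wf_form strs F"
    and iff: "\<And>\<Delta>. world \<Delta> \<Longrightarrow> \<Delta> \<tturnstile> F \<longleftrightarrow>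
      world.sem \<Delta> (world.generic \<Delta>) c = world.bit \<Delta> True"
  shows "characteristic c F"
proof -
  have eq: "\<Delta> \<tturnstile> c \<approx> One \<longleftrightarrow> world.sem \<Delta> (world.generic \<Delta>) c = world.bit \<Delta> True"
    if "world \<Delta>" for \<Delta>
  proof -
    interpret world \<Delta> by fact
    show ?thesis using c by (simp add: prov_eq_iff_sem)
  qed
  have "{} \<tturnstile> PIff F (c \<approx> One)"
  proof (rule prov_PIffI; rule provI)
    fix \<Delta> assume "world \<Delta>" "insert F {} \<subseteq> \<Delta>"
    then show "\<Delta> \<tturnstile> c \<approx> One" using iff eq wf by (metis insert_subset ipor.Assm)
  next
    fix \<Delta> assume "world \<Delta>" "insert (c \<approx> One) {} \<subseteq> \<Delta>"
    then show "\<Delta> \<tturnstile> F" using iff eq c by (metis insert_subset ipor.Assm wf_eq_One)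
  qed (use c wf in auto)
  then show ?thesis using c wf by (simp add: characteristic_def)
qed

lemma characteristic_str_tm: "characteristic c F \<Longrightarrow> str_tm c"
  and characteristic_wf: "characteristic c F \<Longrightarrow> wf_form strs F"
  by (simp_all add: characteristic_def)

text \<open>The equivalence with the characteristic term is derivable without hypotheses; so it can
  be substituted into and used in every world.\<close>

lemma (in world) characteristic_psubst:
  assumes c: "characteristic c F" and \<theta>: "\<And>i. str_tm (\<theta> i)"
  shows "\<Gamma> \<tturnstile> psubst \<theta> F \<longleftrightarrow> sem (\<lambda>i. sem generic (\<theta> i)) c = bit True"
proof -
  have "{} \<tturnstile> PIff (psubst \<theta> F) (psubst \<theta> (c \<approx> One))"
    using c \<theta> prov_PIff_subst by (metis characteristic_def)
  from prov_PIff_iff[OF this] have "\<Gamma> \<tturnstile> psubst \<theta> F \<longleftrightarrow> \<Gamma> \<tturnstile> subst \<theta> c \<approx> One" by simp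
  then show ?thesis using characteristic_str_tm[OF c] \<theta> by (simp add: prov_eq_iff_sem)
qed

lemma (in world) characteristic_iff:
  "characteristic c F \<Longrightarrow> \<Gamma> \<tturnstile> F \<longleftrightarrow> sem generic c = bit True"
  using characteristic_psubst[of c F Var] by simp

lemma characteristic_subst:
  assumes c: "characteristic c F" and \<theta>: "\<And>i. str_tm (\<theta> i)"
  shows "characteristic (subst \<theta> c) (psubst \<theta> F)"
proof (rule characteristicI)
  fix \<Delta> assume "world \<Delta>"
  then interpret world \<Delta> .
  show "\<Delta> \<tturnstile> psubst \<theta> F \<longleftrightarrow> sem generic (subst \<theta> c) = bit True"
    using c \<theta> by (simp add: characteristic_psubst characteristic_str_tm)
qed (use c \<theta> in \<open>auto intro: wf_psubst_strs simp: characteristic_def\<close>)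

lemma characteristic_shift: "characteristic c F \<Longrightarrow> characteristic (shift c) (pshift F)"
  using characteristic_subst[of c F "\<lambda>i. Var (Suc i)"] by (simp add: shift_eq_subst pshift_def)

lemma characteristic_Eq: "str_tm t \<Longrightarrow> str_tm u \<Longrightarrow> characteristic (Eq t u) (t \<approx> u)"
proof (rule characteristicI)
  fix \<Delta> assume "world \<Delta>" "str_tm t" "str_tm u"
  then interpret world \<Delta> by simp
  show "\<Delta> \<tturnstile> t \<approx> u \<longleftrightarrow> sem generic (Eq t u) = bit True"
    using \<open>str_tm t\<close> \<open>str_tm u\<close> by (simp add: prov_eq_iff_sem)
qed auto

lemma characteristic_Sub: "str_tm t \<Longrightarrow> str_tm u \<Longrightarrow> characteristic (Sub t u) (t \<sqsubseteq>\<^sub>P u)"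
proof (rule characteristicI)
  fix \<Delta> assume "world \<Delta>" "str_tm t" "str_tm u"
  then interpret world \<Delta> by simp
  show "\<Delta> \<tturnstile> t \<sqsubseteq>\<^sub>P u \<longleftrightarrow> sem generic (Sub t u) = bit True"
    using \<open>str_tm t\<close> \<open>str_tm u\<close> by (simp add: prov_sub_iff)
qed auto

lemma characteristic_Flip: "str_tm t \<Longrightarrow> characteristic (Flipcoin t) (PFlip t)"
proof (rule characteristicI)
  fix \<Delta> assume "world \<Delta>" "str_tm t"
  then interpret world \<Delta> by simp
  show "\<Delta> \<tturnstile> PFlip t \<longleftrightarrow> sem generic (Flipcoin t) = bit True"
    using \<open>str_tm t\<close> by (simp add: prov_flip_iff)
qed auto

text \<open>A characteristic term is only known to be 1 exactly on truth. Its other values are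
  normalized to 0 here, before the Boolean operations are applied.\<close>

definition Test :: "tm \<Rightarrow> tm" where "Test c = Eq c One"

lemma str_tm_Test [simp]: "str_tm c \<Longrightarrow> str_tm (Test c)"
  by (simp add: Test_def)

lemma (in world) sem_Test [simp]: "str_tm c \<Longrightarrow> sem \<rho> (Test c) = bit (sem \<rho> c = bit True)"
  by (simp add: Test_def)

lemma characteristic_And:
  assumes c: "characteristic c F" and d: "characteristic d G"
  shows "characteristic (BAnd (Test c) (Test d)) (PAnd F G)"
proof (rule characteristicI)
  fix \<Delta> assume "world \<Delta>"
  then interpret world \<Delta> .
  have "\<Delta> \<tturnstile> PAnd F G \<longleftrightarrow> \<Delta> \<tturnstile> F \<and> \<Delta> \<tturnstile> G" by (metis ipor.AndI ipor.AndE1 ipor.AndE2)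
  then show "\<Delta> \<tturnstile> PAnd F G \<longleftrightarrow> sem generic (BAnd (Test c) (Test d)) = bit True"
    using c d by (simp add: characteristic_iff characteristic_str_tm)
qed (use c d in \<open>auto simp: characteristic_def\<close>)

lemma characteristic_Or:
  assumes c: "characteristic c F" and d: "characteristic d G"
  shows "characteristic (BOr (Test c) (Test d)) (POr F G)"
proof (rule characteristicI)
  fix \<Delta> assume "world \<Delta>"
  then interpret world \<Delta> .
  have "\<Delta> \<tturnstile> POr F G \<longleftrightarrow> \<Delta> \<tturnstile> F \<or> \<Delta> \<tturnstile> G"
    by (metis prime ipor.OrI1 ipor.OrI2 c d characteristic_wf)
  then show "\<Delta> \<tturnstile> POr F G \<longleftrightarrow> sem generic (BOr (Test c) (Test d)) = bit True"
    using c d by (simp add: characteristic_iff characteristic_str_tm)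
qed (use c d in \<open>auto simp: characteristic_def\<close>)

text \<open>An implication is not determined by what one world proves of its two sides. Its
  characteristic equation, however, persists in all larger worlds, and in each of those that prove
  \<open>F\<close> it gives \<open>G\<close>.\<close>

lemma characteristic_Imp:
  assumes c: "characteristic c F" and d: "characteristic d G"
  shows "characteristic (BOr (BNeg (Test c)) (Test d)) (PImp F G)" (is "characteristic ?e _")
proof (rule characteristicI)
  note ty = characteristic_str_tm[OF c] characteristic_str_tm[OF d]
  have e: "world.sem \<Delta> \<rho> ?e = world.bit \<Delta> True \<longleftrightarrow>
      (world.sem \<Delta> \<rho> c = world.bit \<Delta> True \<longrightarrow> world.sem \<Delta> \<rho> d = world.bit \<Delta> True)"
    if "world \<Delta>" for \<Delta> \<rho>
  proof -
    interpret world \<Delta> by fact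
    show ?thesis using ty by auto
  qed
  fix \<Delta> assume w: "world \<Delta>"
  then interpret world \<Delta> .
  show "\<Delta> \<tturnstile> PImp F G \<longleftrightarrow> sem generic ?e = bit True"
  proof
    assume "\<Delta> \<tturnstile> PImp F G"
    then have "\<Delta> \<tturnstile> F \<longrightarrow> \<Delta> \<tturnstile> G" using ipor.ImpE[of strs \<Delta> F G] by auto
    then show "sem generic ?e = bit True" unfolding e[OF w]
      using c d by (simp add: characteristic_iff)
  next
    assume "sem generic ?e = bit True"
    then have e\<Delta>: "\<Delta> \<tturnstile> ?e \<approx> One" using ty by (simp add: prov_eq_iff_sem del: sem_bops)
    have "insert F \<Delta> \<tturnstile> G"
    proof (rule provI)
      fix \<Delta>' assume w': "world \<Delta>'" and sub: "insert F \<Delta> \<subseteq> \<Delta>'"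
      interpret w': world \<Delta>' by fact
      have "\<Delta>' \<tturnstile> F" using sub characteristic_wf[OF c] by (simp add: ipor.Assm)
      moreover have "\<Delta>' \<tturnstile> ?e \<approx> One" using e\<Delta> by (rule ipor_weaken) (use sub in auto)
      then have "w'.sem w'.generic ?e = w'.bit True"
        using ty by (simp add: w'.prov_eq_iff_sem del: w'.sem_bops)
      ultimately show "\<Delta>' \<tturnstile> G" unfolding e[OF w'] using c d by (simp add: w'.characteristic_iff)
    qed (rule characteristic_wf[OF d])
    then show "\<Delta> \<tturnstile> PImp F G" using characteristic_wf[OF c] by (rule ipor.ImpI)
  qed
qed (use c d in \<open>auto simp: characteristic_def\<close>)

text \<open>A world need not have a witness for a provable \<open>PEx F\<close>. Therefore
  \<open>iff\<close> is required in all worlds: \<open>ExE\<close> provides a fresh variable, which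
  is a witness in the worlds over the extended hypotheses. Conversely, an element that satisfies
  \<open>f\<close> is named by its representative.\<close>

lemma characteristic_Ex:
  assumes f: "characteristic f F" and g: "str_tm g"
    and iff: "\<And>\<Delta> \<rho>. world \<Delta> \<Longrightarrow> world.sem \<Delta> \<rho> g = world.bit \<Delta> True \<longleftrightarrow>
      (\<exists>a. world.sem \<Delta> (a \<triangleright> \<rho>) f = world.bit \<Delta> True)"
  shows "characteristic g (PEx F)"
proof (rule characteristicI)
  fix \<Delta> assume w: "world \<Delta>"
  then interpret world \<Delta> .
  show "\<Delta> \<tturnstile> PEx F \<longleftrightarrow> sem generic g = bit True"
  proof
    assume ex: "\<Delta> \<tturnstile> PEx F"
    have "insert F (pshift ` \<Delta>) \<tturnstile> pshift (g \<approx> One)" unfolding pshift_def psubst.simps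
    proof (rule prov_eqI)
      fix \<Delta>' assume w': "world \<Delta>'" and sub: "insert F (psubst (\<lambda>i. Var (Suc i)) ` \<Delta>) \<subseteq> \<Delta>'"
      interpret w': world \<Delta>' by fact
      have "\<Delta>' \<tturnstile> F" using sub characteristic_wf[OF f] by (simp add: ipor.Assm)
      then have "w'.sem (w'.generic 0 \<triangleright> (\<lambda>i. w'.generic (Suc i))) f = w'.bit True"
        using f by (simp add: w'.characteristic_iff)
      then show "w'.sem w'.generic (subst (\<lambda>i. Var (Suc i)) g) = w'.sem w'.generic (subst (\<lambda>i. Var (Suc i)) One)"
        using g iff[OF w'] by (auto intro!: exI[of _ "w'.generic 0"])
    qed (use g in auto)
    then have "\<Delta> \<tturnstile> g \<approx> One" using ipor.ExE[OF ex, of "g \<approx> One"] g by simp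
    then show "sem generic g = bit True" using g by (simp add: prov_eq_iff_sem)
  next
    assume "sem generic g = bit True"
    then obtain a where a: "sem (a \<triangleright> generic) f = bit True" using iff[OF w] by auto
    have ty: "str_tm ((rep a \<triangleright> Var) i)" for i by (rule str_tm_ext) auto
    have "\<Delta> \<tturnstile> psubst (rep a \<triangleright> Var) F"
      using a ty f by (subst characteristic_psubst[OF f]) (auto simp: comp_ext sem_generic[of "rep a"])
    then have "\<Delta> \<tturnstile> pinst (rep a) F" by (simp add: pinst_def ext_def)
    then show "\<Delta> \<tturnstile> PEx F" by (rule ipor.ExI) (use characteristic_wf[OF f] in auto)
  qed
qed (use g characteristic_wf[OF f] in auto)

text \<open>Knowing all instances in one world would not prove the universal formula. The equation
  \<open>g \<approx> One\<close> is carried under the quantifier instead, and \<open>F\<close> is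
  checked at the fresh variable in every world that contains the shifted equation.\<close>

lemma characteristic_All:
  assumes f: "characteristic f F" and g: "str_tm g"
    and iff: "\<And>\<Delta> \<rho>. world \<Delta> \<Longrightarrow> world.sem \<Delta> \<rho> g = world.bit \<Delta> True \<longleftrightarrow>
      (\<forall>a. world.sem \<Delta> (a \<triangleright> \<rho>) f = world.bit \<Delta> True)"
  shows "characteristic g (PAll F)"
proof (rule characteristicI)
  fix \<Delta> assume w: "world \<Delta>"
  then interpret world \<Delta> .
  show "\<Delta> \<tturnstile> PAll F \<longleftrightarrow> sem generic g = bit True"
  proof
    assume all: "\<Delta> \<tturnstile> PAll F"
    have "sem (a \<triangleright> generic) f = bit True" for a
    proof -
      have ty: "str_tm ((rep a \<triangleright> Var) i)" for i by (rule str_tm_ext) auto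
      have "\<Delta> \<tturnstile> psubst (rep a \<triangleright> Var) F"
        using ipor.AllE[OF all, of "rep a"] by (simp add: pinst_def ext_def)
      then show ?thesis
        using ty f by (subst (asm) characteristic_psubst[OF f]) (auto simp: comp_ext sem_generic[of "rep a"])
    qed
    then show "sem generic g = bit True" using iff[OF w] by simp
  next
    assume "sem generic g = bit True"
    then have g\<Delta>: "\<Delta> \<tturnstile> g \<approx> One" using g by (simp add: prov_eq_iff_sem)
    have "pshift ` {g \<approx> One} \<tturnstile> F"
    proof (rule provI)
      fix \<Delta>' assume w': "world \<Delta>'" and sub: "pshift ` {g \<approx> One} \<subseteq> \<Delta>'"
      interpret w': world \<Delta>' by fact
      have "\<Delta>' \<tturnstile> shift g \<approx> One"
        by (rule ipor.Assm) (use sub g in \<open>auto simp: pshift_def shift_eq_subst[symmetric]\<close>)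
      then have "w'.sem (\<lambda>i. w'.generic (Suc i)) g = w'.bit True"
        using g by (simp add: w'.prov_eq_iff_sem)
      then have "w'.sem (w'.generic 0 \<triangleright> (\<lambda>i. w'.generic (Suc i))) f = w'.bit True"
        using iff[OF w'] by blast
      then show "\<Delta>' \<tturnstile> F" using f by (simp add: w'.characteristic_iff)
    qed (rule characteristic_wf[OF f])
    then have "{g \<approx> One} \<tturnstile> PAll F" using ipor.AllI[of strs "{g \<approx> One}" F] by simp
    then show "\<Delta> \<tturnstile> PAll F" using g\<Delta> by (rule prov_cut) simp
  qed
qed (use g characteristic_wf[OF f] in auto)


subsection \<open>Subword quantifiers\<close>

lemma str_tm_ex_prefix [simp]: "str_tm f \<Longrightarrow> str_tm t \<Longrightarrow> str_tm (ex_prefix f \<cdot> t)"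
  using typing_ex_prefix by (auto simp: typing_App)

lemma (in world) sem_ex_prefix [simp]:
  "str_tm f \<Longrightarrow> str_tm t \<Longrightarrow> sem \<rho> (ex_prefix f \<cdot> t) = bit True \<longleftrightarrow>
     (\<exists>v. pre v (sem \<rho> t) \<and> sem (v \<triangleright> \<rho>) f = bit True)"
  by (simp add: sem_appl typing_ex_prefix appl_ex_prefix_iff)

text \<open>A subword of \<open>t\<close> is a suffix, of length \<open>|i|\<close> with \<open>i\<close> an initial part of \<open>1^v\<close>, of a prefix \<open>v\<close> of \<open>t\<close>.\<close>

definition ex_subword :: "tm \<Rightarrow> tm \<Rightarrow> tm" where
  "ex_subword f t =
    ex_prefix (ex_prefix (subst (SufC \<cdot> Var 1 \<cdot> Var 0 \<triangleright> (\<lambda>i. Var (Suc (Suc i)))) f) \<cdot> Times One (Var 0)) \<cdot> t"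

lemma str_tm_ex_subword_body: "str_tm f \<Longrightarrow> str_tm (subst (SufC \<cdot> Var 1 \<cdot> Var 0 \<triangleright> (\<lambda>i. Var (Suc (Suc i)))) f)"
  by (intro str_tm_subst str_tm_ext) simp_all

lemma str_tm_ex_subword [simp]: "str_tm f \<Longrightarrow> str_tm t \<Longrightarrow> str_tm (ex_subword f t)"
  unfolding ex_subword_def by (intro str_tm_ex_prefix str_tm_ex_subword_body) simp_all

text \<open>Since \<open>f\<close> itself confines \<open>x\<close> to the subwords of
  \<open>t\<close>, the search misses nothing: \<open>x\<close> is found as the suffix of the prefix
  \<open>cat w x\<close> that is cut off by \<open>ones x\<close>.\<close>

lemma (in world) sem_ex_subword:
  assumes "str_tm f" "str_tm t"
    and sub: "\<And>x. sem (x \<triangleright> \<rho>) f = bit True \<Longrightarrow> \<exists>w. pre (cat w x) (sem \<rho> t)"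
  shows "sem \<rho> (ex_subword f t) = bit True \<longleftrightarrow> (\<exists>x. sem (x \<triangleright> \<rho>) f = bit True)"
proof -
  let ?\<theta> = "SufC \<cdot> Var 1 \<cdot> Var 0 \<triangleright> (\<lambda>i. Var (Suc (Suc i)))"
  have "sem (i \<triangleright> v \<triangleright> \<rho>) (subst ?\<theta> f) = sem (suf v i \<triangleright> \<rho>) f" for i v
    by (subst sem_subst) (auto intro!: str_tm_ext simp: comp_ext assms)
  then have "sem \<rho> (ex_subword f t) = bit True \<longleftrightarrow>
    (\<exists>v. pre v (sem \<rho> t) \<and> (\<exists>i. pre i (ones v) \<and> sem (suf v i \<triangleright> \<rho>) f = bit True))"
    using assms(1,2) str_tm_ex_subword_body[OF assms(1)] unfolding ex_subword_def by simp
  also have "\<dots> \<longleftrightarrow> (\<exists>x. sem (x \<triangleright> \<rho>) f = bit True)"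
  proof
    assume "\<exists>x. sem (x \<triangleright> \<rho>) f = bit True"
    then obtain x w where x: "sem (x \<triangleright> \<rho>) f = bit True" "pre (cat w x) (sem \<rho> t)" using sub by blast
    have "pre (ones x) (ones (cat w x))" using shorter_suffix by (simp add: shorter_def)
    moreover have "sem (suf (cat w x) (ones x) \<triangleright> \<rho>) f = bit True" using x by simp
    ultimately show "\<exists>v. pre v (sem \<rho> t) \<and> (\<exists>i. pre i (ones v) \<and> sem (suf v i \<triangleright> \<rho>) f = bit True)"
      using x(2) by blast
  qed blast
  finally show ?thesis .
qed

lemma characteristic_bounded_Ex:
  assumes f: "characteristic f F" and t: "str_tm t"
    and "\<And>\<Delta> \<rho> a. world \<Delta> \<Longrightarrow> world.sem \<Delta> (a \<triangleright> \<rho>) f = world.bit \<Delta> True \<Longrightarrow> world.pre \<Delta> a (world.sem \<Delta> \<rho> t)"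
  shows "characteristic (ex_prefix f \<cdot> t) (PEx F)"
proof (rule characteristic_Ex[OF f])
  note ty = characteristic_str_tm[OF f]
  show "str_tm (ex_prefix f \<cdot> t)" using ty t by simp
  fix \<Delta> \<rho> assume "world \<Delta>"
  then interpret world \<Delta> .
  show "sem \<rho> (ex_prefix f \<cdot> t) = bit True \<longleftrightarrow> (\<exists>a. sem (a \<triangleright> \<rho>) f = bit True)"
    using ty t assms(3)[OF \<open>world \<Delta>\<close>] by auto
qed

theorem sigma0_characteristic: "sigma0 F \<Longrightarrow> \<exists>c. characteristic c (tr F)"
proof (induction rule: sigma0.induct)
  case (1 t)
  show ?case by (metis characteristic_Flip str_tm_tr tr.simps(1))
next
  case (2 t u)
  show ?case by (metis characteristic_Eq str_tm_tr tr.simps(2))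
next
  case (3 t u)
  show ?case by (metis characteristic_Sub str_tm_tr tr.simps(3))
next
  case (4 F)
  moreover have "characteristic (Eq Zero One) PBot" by (rule characteristic_Eq) simp_all
  ultimately show ?case by (metis characteristic_Imp tr.simps(4))
next
  case (5 F G)
  then show ?case by (metis characteristic_And tr.simps(5))
next
  case (6 F G)
  then show ?case by (metis characteristic_Or tr.simps(6))
next
  case (7 F G)
  then show ?case by (metis characteristic_Imp tr.simps(7))
next
  case (8 F t)
  then obtain f where f: "characteristic f (tr F)" by blast
  note ty = characteristic_str_tm[OF f]
  let ?T = "tr_term t"
  let ?M = "PAnd (Var 0 \<sqsubseteq>\<^sub>P shift (shift ?T)) (PAnd (Var 0 \<oplus> Var 1 \<sqsubseteq>\<^sub>P shift (shift ?T)) (pshift (tr F)))"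
  define m where "m = BAnd (Test (Sub (Var 0) (shift (shift ?T))))
    (Test (BAnd (Test (Sub (Var 0 \<oplus> Var 1) (shift (shift ?T)))) (Test (shift f))))"
  have m: "characteristic m ?M" unfolding m_def
    by (intro characteristic_And characteristic_Sub characteristic_shift f) simp_all
  have sm: "world.sem \<Delta> (w \<triangleright> x \<triangleright> \<rho>) m = world.bit \<Delta> True \<longleftrightarrow> world.pre \<Delta> w (world.sem \<Delta> \<rho> ?T) \<and>
     world.pre \<Delta> (world.cat \<Delta> w x) (world.sem \<Delta> \<rho> ?T) \<and> world.sem \<Delta> (x \<triangleright> \<rho>) f = world.bit \<Delta> True"
    if "world \<Delta>" for \<Delta> w x \<rho>
  proof -
    interpret world \<Delta> by fact
    show ?thesis using ty by (simp add: m_def)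
  qed
  have tym: "str_tm m" by (rule characteristic_str_tm[OF m])
  have "characteristic (ex_prefix m \<cdot> shift ?T) (PEx ?M)"
  proof (rule characteristic_bounded_Ex[OF m])
    fix \<Delta> \<rho> a assume w: "world \<Delta>"
    interpret world \<Delta> by fact
    assume "sem (a \<triangleright> \<rho>) m = bit True"
    then show "pre a (sem \<rho> (shift ?T))" using sm[OF w, of a "\<rho> 0" "\<lambda>i. \<rho> (Suc i)"] by simp
  qed simp
  then have "characteristic (ex_subword (ex_prefix m \<cdot> shift ?T) ?T) (PEx (PEx ?M))"
  proof (rule characteristic_Ex)
    fix \<Delta> \<rho> assume w: "world \<Delta>"
    then interpret world \<Delta> .
    show "sem \<rho> (ex_subword (ex_prefix m \<cdot> shift ?T) ?T) = bit True \<longleftrightarrow>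
      (\<exists>a. sem (a \<triangleright> \<rho>) (ex_prefix m \<cdot> shift ?T) = bit True)"
      by (rule sem_ex_subword) (use sm[OF w] tym in auto)
  qed (use tym in simp)
  then show ?case by (auto simp: rsubword_ex_def)
next
  case (9 F t)
  then obtain f where f: "characteristic f (tr F)" by blast
  note ty = characteristic_str_tm[OF f]
  let ?T = "tr_term t"
  let ?M = "PAnd (Var 0 \<sqsubseteq>\<^sub>P shift (shift ?T)) (Var 0 \<oplus> Var 1 \<sqsubseteq>\<^sub>P shift (shift ?T))"
  define m where "m = BAnd (Test (Sub (Var 0) (shift (shift ?T)))) (Test (Sub (Var 0 \<oplus> Var 1) (shift (shift ?T))))"
  have m: "characteristic m ?M" unfolding m_def
    by (intro characteristic_And characteristic_Sub) simp_all
  have sm: "world.sem \<Delta> (w \<triangleright> x \<triangleright> \<rho>) m = world.bit \<Delta> True \<longleftrightarrow> world.pre \<Delta> w (world.sem \<Delta> \<rho> ?T) \<and>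
     world.pre \<Delta> (world.cat \<Delta> w x) (world.sem \<Delta> \<rho> ?T)"
    if "world \<Delta>" for \<Delta> w x \<rho>
  proof -
    interpret world \<Delta> by fact
    show ?thesis by (simp add: m_def)
  qed
  have tym: "str_tm m" by (rule characteristic_str_tm[OF m])
  have "characteristic (ex_prefix m \<cdot> shift ?T) (PEx ?M)"
  proof (rule characteristic_bounded_Ex[OF m])
    fix \<Delta> \<rho> a assume w: "world \<Delta>"
    interpret world \<Delta> by fact
    assume "sem (a \<triangleright> \<rho>) m = bit True"
    then show "pre a (sem \<rho> (shift ?T))" using sm[OF w, of a "\<rho> 0" "\<lambda>i. \<rho> (Suc i)"] by simp
  qed simp
  from characteristic_Imp[OF this f]
  have i: "characteristic (BOr (BNeg (Test (ex_prefix m \<cdot> shift ?T))) (Test f)) (PImp (PEx ?M) (tr F))"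
    (is "characteristic ?i _") .
  \<comment> \<open>The universal quantifier is a failed search for a counterexample. A
    counterexample satisfies the premise of the implication, so it is a subword and within the range
    of the search.\<close>
  have "characteristic (BNeg (Test (ex_subword (BNeg (Test ?i)) ?T))) (PAll (PImp (PEx ?M) (tr F)))"
  proof (rule characteristic_All[OF i])
    fix \<Delta> \<rho> assume w: "world \<Delta>"
    then interpret world \<Delta> .
    have "sem \<rho> (ex_subword (BNeg (Test ?i)) ?T) = bit True \<longleftrightarrow>
      (\<exists>a. sem (a \<triangleright> \<rho>) (BNeg (Test ?i)) = bit True)"
      by (rule sem_ex_subword) (use sm[OF w] tym ty in auto)
    then show "sem \<rho> (BNeg (Test (ex_subword (BNeg (Test ?i)) ?T))) = bit True \<longleftrightarrow>
      (\<forall>a. sem (a \<triangleright> \<rho>) ?i = bit True)"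
      using tym ty by auto
  qed (use tym ty in simp)
  then show ?case by (auto simp: rsubword_all_def)
qed

section \<open>Bounded existential quantifiers\<close>

lemma wf_pbex [simp]: "str_tm t \<Longrightarrow> wf_form strs (pbex t F) \<longleftrightarrow> wf_form strs F"
  by (simp add: pbex_def)

lemma pinst_psubst_up [simp]: "pinst t (psubst (up \<theta>) F) = psubst (t \<triangleright> \<theta>) F"
proof -
  have "(\<lambda>i. subst (case_nat t Var) (up \<theta> i)) = t \<triangleright> \<theta>"
    by (auto simp: fun_eq_iff up_def ext_def split: nat.splits)
  then show ?thesis by (simp add: pinst_def psubst_psubst)
qed

lemma (in world) pbexI:
  assumes ty: "str_tm t" "wf_form strs F" "\<And>i. str_tm (\<theta> i)"
    and a: "shorter a (sem (\<lambda>i. sem generic (\<theta> i)) t)" and F: "\<Gamma> \<tturnstile> psubst (rep a \<triangleright> \<theta>) F"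
  shows "\<Gamma> \<tturnstile> psubst \<theta> (pbex t F)"
proof -
  let ?M = "PAnd (Times One (Var 0) \<sqsubseteq>\<^sub>P Times One (shift (subst \<theta> t))) (psubst (up \<theta>) F)"
  have "\<Gamma> \<tturnstile> Times One (rep a) \<sqsubseteq>\<^sub>P Times One (subst \<theta> t)"
    using a ty by (simp add: prov_sub_iff shorter_def sem_generic[of "rep a"])
  with F have "\<Gamma> \<tturnstile> PAnd (Times One (rep a) \<sqsubseteq>\<^sub>P Times One (subst \<theta> t)) (psubst (rep a \<triangleright> \<theta>) F)"
    by (intro ipor.AndI)
  moreover have "pinst (rep a) ?M = PAnd (Times One (rep a) \<sqsubseteq>\<^sub>P Times One (subst \<theta> t)) (psubst (rep a \<triangleright> \<theta>) F)"
    using pinst_psubst_up[of "rep a" \<theta> F] by (simp add: pinst_def)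
  ultimately have "\<Gamma> \<tturnstile> pinst (rep a) ?M" by simp
  then have "\<Gamma> \<tturnstile> PEx ?M"
    by (rule ipor.ExI) (use ty wf_psubst_strs[OF ty(2) typing_up_strs[OF ty(3)]] in simp_all)
  then show ?thesis unfolding psubst_pbex unfolding pbex_def .
qed

lemma pbexE:
  assumes ty: "str_tm t" "wf_form strs F" "wf_form strs G"
    and "insert (Times One (Var 0) \<sqsubseteq>\<^sub>P Times One (shift t)) (insert F (pshift ` \<Gamma>)) \<tturnstile> pshift G"
  shows "insert (pbex t F) \<Gamma> \<tturnstile> G"
proof -
  let ?b = "Times One (Var 0) \<sqsubseteq>\<^sub>P Times One (shift t)"
  let ?\<Delta> = "insert (PAnd ?b F) (pshift ` insert (pbex t F) \<Gamma>)"
  have ex: "insert (pbex t F) \<Gamma> \<tturnstile> PEx (PAnd ?b F)"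
    unfolding pbex_def by (rule ipor.Assm) (use ty in simp_all)
  have and_: "?\<Delta> \<tturnstile> PAnd ?b F" by (rule ipor.Assm) (use ty in simp_all)
  have "insert ?b (insert F (pshift ` \<Gamma>)) \<union> ?\<Delta> \<tturnstile> pshift G"
    using assms(4) by (rule ipor_weaken) auto
  then have "insert ?b (insert F ?\<Delta>) \<tturnstile> pshift G"
    by (rule ipor_weaken) auto
  then have "insert F ?\<Delta> \<tturnstile> pshift G"
    by (rule prov_cut) (use ipor.AndE1[OF and_] in \<open>auto elim: ipor_weaken\<close>)
  then have "?\<Delta> \<tturnstile> pshift G" by (rule prov_cut) (use ipor.AndE2[OF and_] in auto)
  then have "Str ;; strs | ?\<Delta> \<turnstile>\<^sub>P pshift G" by simp
  from ipor.ExE[OF ex this ty(3)] show ?thesis .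
qed

lemma pbex_mono:
  assumes "{F} \<tturnstile> G" "str_tm t" "wf_form strs F"
  shows "{pbex t F} \<tturnstile> pbex t G"
proof (rule pbexE)
  let ?b = "Times One (Var 0) \<sqsubseteq>\<^sub>P Times One (shift t)"
  have wf: "wf_form strs G" using ipor_wf[OF assms(1)] .
  have "{?b, F} \<tturnstile> ?b" by (rule ipor.Assm) (use assms in auto)
  moreover have "{?b, F} \<tturnstile> G" using assms(1) by (rule ipor_weaken) auto
  ultimately have "{?b, F} \<tturnstile> PAnd ?b G" by (rule ipor.AndI)
  moreover have "pshift (pbex t G) = PEx (psubst (up (\<lambda>i. Var (Suc i))) (PAnd ?b G))"
    by (simp add: pshift_def pbex_def)
  moreover have "pinst (Var 0) (psubst (up (\<lambda>i. Var (Suc i))) (PAnd ?b G)) = PAnd ?b G"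
    by (subst pinst_psubst_up) simp
  ultimately show "insert ?b (insert F (pshift ` {})) \<tturnstile> pshift (pbex t G)"
    using ipor.ExI[of strs "{?b, F}" "Var 0" "psubst (up (\<lambda>i. Var (Suc i))) (PAnd ?b G)"]
      wf_psubst_strs[of "PAnd ?b G" "up (\<lambda>i. Var (Suc i))", OF _ typing_up_strs] wf assms(2)
    by (simp del: pinst_psubst_up psubst.simps)
  show "wf_form strs (pbex t G)" using wf assms by simp
qed (use assms in simp_all)

text \<open>Terms of \<open>\<R>\<L>\<close> are monotone in length, unlike terms with
  \<open>Cond\<close> or \<open>Tail\<close> in general. For this reason the bounds below are kept
  as translations of \<open>\<R>\<L>\<close> terms.\<close>

lemma (in world) shorter_tr:
  "(\<And>i. shorter (\<rho> i) (\<rho>' i)) \<Longrightarrow> shorter (sem \<rho> (tr_term s)) (sem \<rho>' (tr_term s))"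
  by (induction s) (auto intro: shorter_cat shorter_times)

text \<open>
  Two bounded quantifiers are merged into one over \<open>y = x z\<close>; the place \<open>i\<close> at which to cut \<open>y\<close>
  is recovered by a search bounded by \<open>1^y\<close>.
\<close>

definition split_search :: "tm \<Rightarrow> tm \<Rightarrow> tm \<Rightarrow> tm" where
  "split_search t s f = (let x = DropC \<cdot> Var 1 \<cdot> Var 0; z = SufC \<cdot> Var 1 \<cdot> Var 0; p = (\<lambda>i. Var (Suc (Suc i))) in
    ex_prefix (BAnd (Sub (Times One x) (Times One (shift (shift t))))
      (BAnd (Sub (Times One z) (Times One (subst (x \<triangleright> p) s))) (Test (subst (z \<triangleright> x \<triangleright> p) f))))
    \<cdot> Times One (Var 0))"

lemma split_search_typing:
  assumes "str_tm s" "str_tm f"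
  shows "str_tm (subst (DropC \<cdot> Var 1 \<cdot> Var 0 \<triangleright> (\<lambda>i. Var (Suc (Suc i)))) s)"
    "str_tm (subst (SufC \<cdot> Var 1 \<cdot> Var 0 \<triangleright> DropC \<cdot> Var 1 \<cdot> Var 0 \<triangleright> (\<lambda>i. Var (Suc (Suc i)))) f)"
  using assms by (intro str_tm_subst str_tm_ext; simp)+

lemma str_tm_split_search [simp]:
  "str_tm t \<Longrightarrow> str_tm s \<Longrightarrow> str_tm f \<Longrightarrow> str_tm (split_search t s f)"
  unfolding split_search_def Let_def
  by (intro str_tm_ex_prefix) (simp_all add: split_search_typing del: One_nat_def)

lemma (in world) sem_split_search:
  assumes ty: "str_tm t" "str_tm s" "str_tm f"
  shows "sem (y \<triangleright> \<rho>) (split_search t s f) = bit True \<longleftrightarrow>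
    (\<exists>i. pre i (ones y) \<and> shorter (drop y i) (sem \<rho> t) \<and> shorter (suf y i) (sem (drop y i \<triangleright> \<rho>) s) \<and>
      sem (suf y i \<triangleright> drop y i \<triangleright> \<rho>) f = bit True)"
proof -
  let ?x = "DropC \<cdot> Var 1 \<cdot> Var 0" and ?z = "SufC \<cdot> Var 1 \<cdot> Var 0" and ?p = "\<lambda>i. Var (Suc (Suc i))"
  note tys = split_search_typing[OF ty(2,3)]
  have "sem (i \<triangleright> y \<triangleright> \<rho>) (subst (?x \<triangleright> ?p) s) = sem (drop y i \<triangleright> \<rho>) s" for i
    by (subst sem_subst) (auto intro!: str_tm_ext simp: comp_ext ty)
  moreover have "sem (i \<triangleright> y \<triangleright> \<rho>) (subst (?z \<triangleright> ?x \<triangleright> ?p) f) = sem (suf y i \<triangleright> drop y i \<triangleright> \<rho>) f" for i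
    by (subst sem_subst) (auto intro!: str_tm_ext simp: comp_ext ty)
  ultimately show ?thesis using ty tys
    by (simp add: split_search_def Let_def shorter_def)
qed

text \<open>The bound is \<open>t s(t)\<close>: if \<open>x\<close> is no longer than
  \<open>t\<close>, then \<open>s(x)\<close> is no longer than \<open>s(t)\<close> by monotonicity,
  so the concatenation of \<open>x\<close> and \<open>z\<close> is within the bound. Conversely,
  \<open>g\<close> checks the two original bounds again on the pieces that it cuts.\<close>

lemma pbex_pbex:
  fixes t :: rterm and s :: rterm and f :: tm
  defines "y \<equiv> t \<frown> rtsubst (case_nat t RVar) s"
    and "g \<equiv> split_search (tr_term t) (tr_term s) f"
  assumes f: "str_tm f"
  shows "{} \<tturnstile> PIff (pbex (tr_term t) (pbex (tr_term s) (f \<approx> One))) (pbex (tr_term y) (g \<approx> One))"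
proof (rule prov_PIffI)
  let ?T = "tr_term t" and ?S = "tr_term s" and ?Y = "tr_term y"
  let ?s = "\<lambda>i. Var (Suc i)" and ?ss = "\<lambda>i. Var (Suc (Suc i))"
  have g: "str_tm g" by (simp add: g_def f)
  have wf: "wf_form strs (f \<approx> One)" "wf_form strs (g \<approx> One)" using f g by auto
  have "?Y = ?T \<oplus> inst ?T ?S"
  proof -
    have "(\<lambda>i. tr_term (case_nat t RVar i)) = case_nat ?T Var"
      by (auto simp: fun_eq_iff split: nat.splits)
    then show ?thesis by (simp add: y_def tr_rtsubst inst_def)
  qed
  then have Y: "world.sem \<Delta> \<rho> ?Y = world.cat \<Delta> (world.sem \<Delta> \<rho> ?T) (world.sem \<Delta> (world.sem \<Delta> \<rho> ?T \<triangleright> \<rho>) ?S)"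
    if "world \<Delta>" for \<Delta> \<rho>
  proof -
    interpret world \<Delta> by fact
    show ?thesis unfolding \<open>?Y = _\<close> by simp
  qed
  let ?bT = "Times One (Var 0) \<sqsubseteq>\<^sub>P Times One (shift ?T)" and ?bS = "Times One (Var 0) \<sqsubseteq>\<^sub>P Times One (shift ?S)"
  have "insert ?bS (insert (f \<approx> One) (pshift ` {?bT})) \<tturnstile> pshift (pshift (pbex ?Y (g \<approx> One)))"
  proof (rule provI)
    fix \<Delta> assume w: "world \<Delta>" and sub: "insert ?bS (insert (f \<approx> One) (pshift ` {?bT})) \<subseteq> \<Delta>"
    interpret world \<Delta> by fact
    define x z \<rho> where "x = generic 1" and "z = generic 0" and "\<rho> = (\<lambda>i. generic (Suc (Suc i)))"
    have gen: "z \<triangleright> x \<triangleright> \<rho> = generic"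
      by (auto simp: x_def z_def \<rho>_def ext_def fun_eq_iff split: nat.splits)
    have gen': "(\<lambda>i. generic (Suc i)) = x \<triangleright> \<rho>"
      by (auto simp: x_def \<rho>_def ext_def fun_eq_iff split: nat.splits)
    have "\<Delta> \<tturnstile> ?bS" "\<Delta> \<tturnstile> f \<approx> One" "\<Delta> \<tturnstile> Times One (Var 1) \<sqsubseteq>\<^sub>P Times One (shift (shift ?T))"
      by (rule ipor.Assm; use sub f in \<open>auto simp: pshift_def shift_eq_subst[symmetric]\<close>)+
    then have "shorter z (sem (x \<triangleright> \<rho>) ?S)" "sem (z \<triangleright> x \<triangleright> \<rho>) f = bit True" "shorter x (sem \<rho> ?T)"
      using f by (simp_all add: prov_sub_iff prov_eq_iff_sem shorter_def gen gen')
        (simp_all add: x_def z_def \<rho>_def)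
    moreover from this have "shorter (sem (x \<triangleright> \<rho>) ?S) (sem (sem \<rho> ?T \<triangleright> \<rho>) ?S)"
      by (intro shorter_tr) (auto simp: ext_def split: nat.splits)
    \<comment> \<open>The cut is at \<open>ones z\<close>, which splits \<open>cat x z\<close> into
      \<open>x\<close> and \<open>z\<close> again; it is within the search bound by
      \<open>shorter_suffix\<close>.\<close>
    ultimately have "shorter (cat x z) (sem \<rho> ?Y)" "sem (cat x z \<triangleright> \<rho>) g = bit True"
      using f shorter_suffix[of z x]
      by (auto simp: Y[OF w] g_def sem_split_search shorter_def[of z "cat x z"]
        intro: shorter_cat shorter_trans intro!: exI[of _ "ones z"])
    then have "\<Delta> \<tturnstile> psubst ?ss (pbex ?Y (g \<approx> One))"
    proof (intro pbexI[where a="cat x z"])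
      have ty: "str_tm ((rep (cat x z) \<triangleright> ?ss) i)" for i by (rule str_tm_ext) auto
      assume "sem (cat x z \<triangleright> \<rho>) g = bit True"
      then have "\<Delta> \<tturnstile> subst (rep (cat x z) \<triangleright> ?ss) g \<approx> One"
        using g ty by (simp add: prov_eq_iff_sem comp_ext sem_generic[of "rep _"] \<rho>_def)
      then show "\<Delta> \<tturnstile> psubst (rep (cat x z) \<triangleright> ?ss) (g \<approx> One)" by simp
    qed (use g in \<open>auto simp: \<rho>_def\<close>)
    then show "\<Delta> \<tturnstile> pshift (pshift (pbex ?Y (g \<approx> One)))" by (simp add: pshift_def psubst_psubst)
  qed (use wf in \<open>simp add: pshift_def wf_psubst_strs del: wf_eq_One\<close>)
  then have "insert (pbex ?S (f \<approx> One)) {?bT} \<tturnstile> pshift (pbex ?Y (g \<approx> One))"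
    by (intro pbexE) (use wf in \<open>simp_all add: pshift_def wf_psubst_strs del: wf_eq_One\<close>)
  then have "insert ?bT (insert (pbex ?S (f \<approx> One)) (pshift ` {})) \<tturnstile> pshift (pbex ?Y (g \<approx> One))"
    by (simp add: insert_commute)
  then show "{pbex ?T (pbex ?S (f \<approx> One))} \<tturnstile> pbex ?Y (g \<approx> One)"
    by (intro pbexE) (use wf in \<open>simp_all del: wf_eq_One\<close>)
  let ?bY = "Times One (Var 0) \<sqsubseteq>\<^sub>P Times One (shift ?Y)"
  have "insert ?bY (insert (g \<approx> One) (pshift ` {})) \<tturnstile> pshift (pbex ?T (pbex ?S (f \<approx> One)))"
  proof (rule provI)
    fix \<Delta> assume w: "world \<Delta>" and sub: "insert ?bY (insert (g \<approx> One) (pshift ` {})) \<subseteq> \<Delta>"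
    interpret world \<Delta> by fact
    define y \<rho> where "y = generic 0" and "\<rho> = (\<lambda>i. generic (Suc i))"
    have gen: "y \<triangleright> \<rho> = generic"
      by (auto simp: y_def \<rho>_def ext_def fun_eq_iff split: nat.splits)
    have "\<Delta> \<tturnstile> g \<approx> One"
      by (rule ipor.Assm) (use sub g in auto)
    then have "sem (y \<triangleright> \<rho>) g = bit True" using g by (simp add: prov_eq_iff_sem gen)
    then obtain x z where x: "shorter x (sem \<rho> ?T)" and z: "shorter z (sem (x \<triangleright> \<rho>) ?S)"
      and fz: "sem (z \<triangleright> x \<triangleright> \<rho>) f = bit True"
      using f by (auto simp: g_def sem_split_search)
    let ?x = "rep x \<triangleright> ?s" and ?z = "rep z \<triangleright> rep x \<triangleright> ?s"
    have ty: "str_tm (?x i)" "str_tm (?z i)" for i by (intro str_tm_ext; simp)+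
    have "\<Delta> \<tturnstile> subst ?z f \<approx> One"
      using fz f ty by (simp add: prov_eq_iff_sem comp_ext sem_generic[of "rep _"] \<rho>_def)
    then have "\<Delta> \<tturnstile> psubst ?x (pbex ?S (f \<approx> One))"
      by (intro pbexI[where a=z]) (use z ty wf in \<open>simp_all add: comp_ext sem_generic[of "rep _"] \<rho>_def\<close>)
    then have "\<Delta> \<tturnstile> psubst ?s (pbex ?T (pbex ?S (f \<approx> One)))"
      by - (rule pbexI[where a=x], use x wf in \<open>simp_all add: \<rho>_def\<close>)
    then show "\<Delta> \<tturnstile> pshift (pbex ?T (pbex ?S (f \<approx> One)))" by (simp add: pshift_def)
  qed (use wf in \<open>simp add: pshift_def wf_psubst_strs del: wf_eq_One\<close>)
  then show "{pbex ?Y (g \<approx> One)} \<tturnstile> pbex ?T (pbex ?S (f \<approx> One))"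
    by (intro pbexE) (use wf in \<open>simp_all del: wf_eq_One\<close>)
qed

text \<open>A dummy quantifier brings a decidable formula into the form that NP-induction requires.
  It is the start of the merging of quantifiers.\<close>

lemma pbex_Empty:
  assumes f: "characteristic f F"
  shows "{} \<tturnstile> PIff F (pbex Empty (shift f \<approx> One))"
proof (rule prov_PIffI)
  note ty = characteristic_str_tm[OF f] and wf = characteristic_wf[OF f]
  show "insert F {} \<tturnstile> pbex Empty (shift f \<approx> One)"
  proof (rule provI)
    fix \<Delta> assume "world \<Delta>" and sub: "insert F {} \<subseteq> \<Delta>"
    then interpret world \<Delta> by simp
    have "\<Delta> \<tturnstile> F" by (rule ipor.Assm) (use sub wf in auto)
    then have "sem generic f = bit True" using f by (simp add: characteristic_iff)
    then have "\<Delta> \<tturnstile> f \<approx> One" using ty by (simp add: prov_eq_iff_sem)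
    moreover have "subst (rep eps \<triangleright> Var) (shift f) = f" by (simp add: ext_def)
    ultimately have "\<Delta> \<tturnstile> psubst Var (pbex Empty (shift f \<approx> One))"
      by (intro pbexI[where a=eps]) (use ty in \<open>simp_all add: ext_def\<close>)
    then show "\<Delta> \<tturnstile> pbex Empty (shift f \<approx> One)" by simp
  qed (use ty in simp)
  have "insert (Times One (Var 0) \<sqsubseteq>\<^sub>P Times One (shift Empty)) (insert (shift f \<approx> One) (pshift ` {})) \<tturnstile> pshift F"
  proof (rule provI)
    fix \<Delta> assume "world \<Delta>"
      and sub: "insert (Times One (Var 0) \<sqsubseteq>\<^sub>P Times One (shift Empty)) (insert (shift f \<approx> One) (pshift ` {})) \<subseteq> \<Delta>"
    then interpret world \<Delta> by simp
    have "\<Delta> \<tturnstile> shift f \<approx> One" by (rule ipor.Assm) (use sub ty in auto)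
    then show "\<Delta> \<tturnstile> pshift F"
      using characteristic_iff[OF characteristic_shift[OF f]] ty by (simp add: prov_eq_iff_sem)
  qed (rule characteristic_wf[OF characteristic_shift[OF f]])
  then show "insert (pbex Empty (shift f \<approx> One)) {} \<tturnstile> F"
    by (intro pbexE) (use ty wf in simp_all)
qed

lemma prov_PIff_trans: "{} \<tturnstile> PIff F G \<Longrightarrow> {} \<tturnstile> PIff G H \<Longrightarrow> {} \<tturnstile> PIff F H"
  by (rule prov_PIffI) (metis prov_PIff_iff ipor.Assm insertI1 ipor_wf wf_form.simps(4,6))+

text \<open>The bound is stated as \<open>tr_term s\<close> so that the induction can use
  \<open>shorter_tr\<close> for the next quantifier.\<close>

theorem sigma1_np:
  "sigma1 F \<Longrightarrow> \<exists>s f. str_tm f \<and> {} \<tturnstile> PIff (tr F) (pbex (tr_term s) (f \<approx> One))"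
proof (induction rule: sigma1.induct)
  case (1 F)
  then obtain c where c: "characteristic c (tr F)" using sigma0_characteristic by blast
  then show ?case using pbex_Empty[OF c] characteristic_str_tm[OF c]
    by (intro exI[of _ REps] exI[of _ "shift c"]) simp
next
  case (2 F t)
  then obtain s f where f: "str_tm f" and iff: "{} \<tturnstile> PIff (tr F) (pbex (tr_term s) (f \<approx> One))" (is "_ \<tturnstile> PIff _ ?P")
    by blast
  have P: "wf_form strs ?P" using f by simp
  have "{tr F} \<tturnstile> ?P" "{?P} \<tturnstile> tr F" using prov_PIff_iff[OF iff] P by (metis insertI1 ipor.Assm wf_tr)+
  then have "{} \<tturnstile> PIff (pbex (tr_term t) (tr F)) (pbex (tr_term t) ?P)"
    using P by (intro prov_PIffI pbex_mono) simp_all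
  from prov_PIff_trans[OF this pbex_pbex[OF f]] f
  have "str_tm (split_search (tr_term t) (tr_term s) f) \<and> {} \<tturnstile> PIff (tr (rbex t F))
    (pbex (tr_term (t \<frown> rtsubst (case_nat t RVar) s)) (split_search (tr_term t) (tr_term s) f \<approx> One))"
    by (simp add: rbex_def pbex_def)
  then show ?case by blast
qed


section \<open>The axioms and rules of \<open>IRS\<close>\<close>

lemma prov_all_shift: "\<Gamma> \<tturnstile> pshift (PAll F) \<Longrightarrow> \<Gamma> \<tturnstile> F"
  using ipor.AllE[of strs \<Gamma> "psubst (up (\<lambda>i. Var (Suc i))) F" "Var 0"] by (simp add: pshift_def)

text \<open>Induction transfers along a derivable equivalence, because such an equivalence can be
  instantiated at the empty string and at both successors.\<close>

lemma notation_induction: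
  assumes iff: "{} \<tturnstile> PIff F P" and P: "np_predicate strs P"
  shows "{} \<tturnstile> PImp (PAnd (pinst Empty F) (PAll (PImp F (PAnd (psucc Zero F) (psucc One F))))) (PAll F)"
proof -
  let ?H = "PAnd (pinst Empty F) (PAll (PImp F (PAnd (psucc Zero F) (psucc One F))))"
  have wfP: "wf_form strs P" and wfF: "wf_form strs F"
    using P ipor_wf[OF iff] by (auto simp: np_predicate_def)
  have "{} \<tturnstile> PIff (pinst Empty F) (pinst Empty P)"
    unfolding pinst_def by (rule prov_PIff_subst[OF iff]) (auto split: nat.splits)
  note iff0 = prov_PIff_iff[OF this]
  have "{} \<tturnstile> PIff (psucc b F) (psucc b P)" if "str_tm b" for b
    unfolding psucc_def by (rule prov_PIff_subst[OF iff]) (use that in \<open>auto split: nat.splits\<close>)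
  then have iffs: "\<Gamma> \<tturnstile> psucc b F \<longleftrightarrow> \<Gamma> \<tturnstile> psucc b P" if "str_tm b" for \<Gamma> b
    using prov_PIff_iff that by blast
  have wfs: "wf_form strs (psucc b F)" "wf_form strs (psucc b P)" if "str_tm b" for b
    unfolding psucc_def using wfF wfP by (auto intro!: wf_psubst_strs simp: that split: nat.splits)
  have wf0: "wf_form strs (pinst Empty F)" "wf_form strs (pinst Empty P)"
    using wf_pinst[of Str strs F] wf_pinst[of Str strs P] wfF wfP by simp_all
  have wfH: "wf_form strs ?H" using wfF wfs wf0 by simp
  have H: "{?H} \<tturnstile> ?H" by (rule ipor.Assm[OF _ wfH]) simp
  have base: "{?H} \<tturnstile> pinst Empty P" using ipor.AndE1[OF H] iff0 by simp
  have step: "{?H} \<tturnstile> PAll (PImp P (psucc b P))" if b: "b = Zero \<or> b = One" for b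
  proof -
    let ?D = "insert P (pshift ` {?H})"
    have "wf_form strs (pshift ?H)" using wf_pshift[OF wfH, of Str] by simp
    then have "?D \<tturnstile> pshift ?H" by (intro ipor.Assm) auto
    then have "?D \<tturnstile> pshift (PAll (PImp F (PAnd (psucc Zero F) (psucc One F))))"
      unfolding pshift_def psubst.simps by (rule ipor.AndE2)
    then have "?D \<tturnstile> PImp F (PAnd (psucc Zero F) (psucc One F))" by (rule prov_all_shift)
    moreover have "?D \<tturnstile> F" using prov_PIff_iff[OF iff] ipor.Assm[of P ?D strs] wfP by simp
    ultimately have "?D \<tturnstile> PAnd (psucc Zero F) (psucc One F)" by (rule ipor.ImpE)
    then have "?D \<tturnstile> psucc b F" using b ipor.AndE1 ipor.AndE2 by metis
    then have "?D \<tturnstile> psucc b P" using iffs[of b] b by auto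
    then have "pshift ` {?H} \<tturnstile> PImp P (psucc b P)" using wfP by (rule ipor.ImpI)
    then show ?thesis using ipor.AllI[of strs "{?H}"] by simp
  qed
  have prem: "{?H} \<tturnstile> PAnd (pinst Empty P) (PAnd (PAll (PImp P (psucc Zero P))) (PAll (PImp P (psucc One P))))"
    (is "_ \<tturnstile> ?Q") by (intro ipor.AndI base step) simp_all
  have "{?H} \<tturnstile> PImp ?Q (PAll P)"
  proof (rule ipor.Ax)
    show "ipor_axiom strs (PImp ?Q (PAll P))" using P by (intro ipor_axiom.intros(7)) simp
    show "wf_form strs (PImp ?Q (PAll P))" using ipor_wf[OF prem] wfP by simp
  qed
  from this prem have all: "{?H} \<tturnstile> PAll P" by (rule ipor.ImpE)
  have "pshift ` {PAll P} \<tturnstile> pshift (PAll P)"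
    by (rule ipor.Assm) (use wf_pshift[of strs "PAll P" Str] wfP in simp_all)
  then have "pshift ` {PAll P} \<tturnstile> F" using prov_all_shift prov_PIff_iff[OF iff] by blast
  then have "{PAll P} \<tturnstile> PAll F" using ipor.AllI[of strs "{PAll P}" F] by simp
  then have "{?H} \<tturnstile> PAll F" using all by (rule prov_cut) simp
  then show ?thesis using wfH by (rule ipor.ImpI)
qed

lemma prov_ImpI:
  assumes "\<And>\<Delta>. world \<Delta> \<Longrightarrow> \<Delta> \<tturnstile> F \<Longrightarrow> \<Delta> \<tturnstile> G" and wf: "wf_form strs F" "wf_form strs G"
  shows "\<Gamma> \<tturnstile> PImp F G"
proof (rule ipor.ImpI[OF provI[OF _ wf(2)] wf(1)])
  fix \<Delta> assume "world \<Delta>" "insert F \<Gamma> \<subseteq> \<Delta>"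
  then show "\<Delta> \<tturnstile> G" using assms(1) ipor.Assm[of F \<Delta> strs] wf(1) by auto
qed

lemma (in world) prov_POr_iff:
  "wf_form strs F \<Longrightarrow> wf_form strs G \<Longrightarrow> \<Gamma> \<tturnstile> POr F G \<longleftrightarrow> \<Gamma> \<tturnstile> F \<or> \<Gamma> \<tturnstile> G"
  using prime ipor.OrI1 ipor.OrI2 by metis

lemma digit_cases:
  assumes "b \<in> {RZero, ROne}"
  obtains d where "tr_term b = digit d"
  using assms that[of False] that[of True] by auto

lemma (in world) sem_digit [simp]: "sem \<rho> (digit d) = bit d"
  by (cases d) simp_all

lemma str_tm_digit [simp]: "str_tm (digit d)"
  by simp

lemma wf_eq_str: "str_tm t \<Longrightarrow> str_tm u \<Longrightarrow> wf_form strs (t \<approx> u)"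
  by auto

lemma irs_axiom_sound: "irs_axiom F \<Longrightarrow> \<Gamma> \<tturnstile> tr F"
proof (induction rule: irs_axiom.induct)
  case (1 x)
  show ?case by (auto intro!: eq_axiom por_axiom.intros(2))
next
  case (2 b x y)
  then show ?case by (auto intro!: eq_axiom por_axiom.intros(3))
next
  case (3 x)
  show ?case by (auto intro!: eq_axiom por_axiom.intros(16))
next
  case (4 b x y)
  then obtain d where d: "tr_term b = digit d" by (rule digit_cases)
  \<comment> \<open>The axiom for \<open>Times\<close> speaks of the defined \<open>Conc\<close>,
    that of \<open>IRS\<close> of primitive concatenation; their agreement \<open>conc_cat\<close>
    enters here.\<close>
  have "\<Gamma> \<tturnstile> Times (tr_term x) (tr_term y \<oplus> digit d) \<approx> Times (tr_term x) (tr_term y) \<oplus> tr_term x"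
  proof (rule prov_eqI)
    fix \<Delta> assume "world \<Delta>"
    then interpret world \<Delta> .
    show "sem generic (Times (tr_term x) (tr_term y \<oplus> digit d)) = sem generic (Times (tr_term x) (tr_term y) \<oplus> tr_term x)"
      by (simp del: if_split)
  qed simp_all
  then show ?case by (simp only: tr.simps tr_term.simps d)
next
  case (5 x)
  have "\<Delta> \<tturnstile> tr_term x \<sqsubseteq>\<^sub>P Empty \<longleftrightarrow> \<Delta> \<tturnstile> tr_term x \<approx> Empty" if "world \<Delta>" for \<Delta>
  proof -
    interpret world \<Delta> by fact
    show ?thesis by (simp add: prov_sub_iff prov_eq_iff_sem)
  qed
  then show ?case by (simp del: wf_form.simps(1)) (intro ipor.AndI prov_ImpI; simp add: wf_eq_str del: wf_form.simps(1))
next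
  case (6 b x y)
  then obtain d where d: "tr_term b = digit d" by (rule digit_cases)
  let ?x = "tr_term x" and ?y = "tr_term y"
  have "\<Delta> \<tturnstile> ?x \<sqsubseteq>\<^sub>P ?y \<oplus> digit d \<longleftrightarrow> \<Delta> \<tturnstile> POr (?x \<sqsubseteq>\<^sub>P ?y) (?x \<approx> ?y \<oplus> digit d)" if "world \<Delta>" for \<Delta>
  proof -
    interpret world \<Delta> by fact
    show ?thesis by (simp add: prov_POr_iff prov_sub_iff prov_eq_iff_sem wf_eq_str pre_dg del: wf_form.simps(1))
  qed
  then have "\<Gamma> \<tturnstile> PIff (?x \<sqsubseteq>\<^sub>P ?y \<oplus> digit d) (POr (?x \<sqsubseteq>\<^sub>P ?y) (?x \<approx> ?y \<oplus> digit d))"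
    by (intro ipor.AndI prov_ImpI) (simp_all add: wf_eq_str del: wf_form.simps(1))
  then show ?case by (simp only: tr.simps tr_term.simps d)
next
  case (7 b x y)
  then obtain d where d: "tr_term b = digit d" by (rule digit_cases)
  let ?x = "tr_term x" and ?y = "tr_term y"
  have "\<Delta> \<tturnstile> ?x \<approx> ?y" if "world \<Delta>" "\<Delta> \<tturnstile> ?x \<oplus> digit d \<approx> ?y \<oplus> digit d" for \<Delta>
  proof -
    interpret world \<Delta> by fact
    show ?thesis using that(2) by (simp add: prov_eq_iff_sem)
  qed
  then have "\<Gamma> \<tturnstile> PImp (?x \<oplus> digit d \<approx> ?y \<oplus> digit d) (?x \<approx> ?y)"
    by (intro prov_ImpI) (simp_all add: wf_eq_str del: wf_form.simps(1))
  then show ?case by (simp only: tr.simps tr_term.simps d)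
next
  case (8 x y)
  let ?x = "tr_term x" and ?y = "tr_term y"
  have "\<not> \<Delta> \<tturnstile> ?x \<oplus> Zero \<approx> ?y \<oplus> One" if "world \<Delta>" for \<Delta>
  proof -
    interpret world \<Delta> by fact
    show ?thesis by (simp add: prov_eq_iff_sem)
  qed
  then have "\<Gamma> \<tturnstile> PImp (?x \<oplus> Zero \<approx> ?y \<oplus> One) PBot"
    by (intro prov_ImpI) (simp_all add: wf_eq_str del: wf_form.simps(1))
  then show ?case by simp
next
  case (9 b x)
  then obtain d where d: "tr_term b = digit d" by (rule digit_cases)
  let ?x = "tr_term x"
  have "\<not> \<Delta> \<tturnstile> ?x \<oplus> digit d \<approx> Empty" if "world \<Delta>" for \<Delta>
  proof -
    interpret world \<Delta> by fact
    show ?thesis by (simp add: prov_eq_iff_sem)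
  qed
  then have "\<Gamma> \<tturnstile> PImp (?x \<oplus> digit d \<approx> Empty) PBot"
    by (intro prov_ImpI) (simp_all add: wf_eq_str del: wf_form.simps(1))
  then show ?case by (simp only: tr.simps tr_term.simps d)
next
  case (10 B)
  then obtain s f where f: "str_tm f" and iff: "{} \<tturnstile> PIff (tr B) (pbex (tr_term s) (f \<approx> One))"
    using sigma1_np by blast
  have "np_predicate strs (pbex (tr_term s) (f \<approx> One))"
    unfolding np_predicate_def using f by (auto simp: strs_apply)
  from notation_induction[OF iff this] show ?case
    by (auto elim: ipor_weaken)
qed

theorem irs_sound: "\<Gamma> \<turnstile>\<^sub>R F \<Longrightarrow> tr ` \<Gamma> \<tturnstile> tr F"
proof (induction rule: irs.induct)
  case (Ax F \<Gamma>)
  then show ?case by (rule irs_axiom_sound)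
next
  case (Assm F \<Gamma>)
  then show ?case by (intro ipor.Assm) simp_all
next
  case (NegI F \<Gamma> G)
  have "insert (tr F) (tr ` \<Gamma>) \<tturnstile> PBot"
    using NegI.IH ipor.ImpE[of strs "insert (tr F) (tr ` \<Gamma>)" "tr G" PBot] by simp
  then show ?case by (simp add: ipor.ImpI)
next
  case (NegE \<Gamma> F G)
  have "tr ` \<Gamma> \<tturnstile> PBot" using NegE.IH ipor.ImpE[of strs "tr ` \<Gamma>" "tr F" PBot] by simp
  then show ?case by (rule ipor.BotE) simp
next
  case (AndI \<Gamma> F G)
  then show ?case by (simp add: ipor.AndI)
next
  case (AndE1 \<Gamma> F G)
  then show ?case using ipor.AndE1 by simp
next
  case (AndE2 \<Gamma> F G)
  then show ?case using ipor.AndE2 by simp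
next
  case (OrI1 \<Gamma> F G)
  then show ?case by (simp add: ipor.OrI1)
next
  case (OrI2 \<Gamma> G F)
  then show ?case by (simp add: ipor.OrI2)
next
  case (OrE \<Gamma> F G H)
  then show ?case using ipor.OrE[of strs "tr ` \<Gamma>" "tr F" "tr G" "tr H"] by simp
next
  case (ImpI F \<Gamma> G)
  then show ?case by (simp add: ipor.ImpI)
next
  case (ImpE \<Gamma> F G)
  then show ?case using ipor.ImpE[of strs "tr ` \<Gamma>" "tr F" "tr G"] by simp
next
  case (AllI \<Gamma> F)
  then show ?case using ipor.AllI[of strs "tr ` \<Gamma>" "tr F"] by (simp add: image_image)
next
  case (AllE \<Gamma> F t)
  then show ?case using ipor.AllE[of strs "tr ` \<Gamma>" "tr F" "tr_term t"] by simp
next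
  case (ExI \<Gamma> t F)
  then show ?case using ipor.ExI[of strs "tr ` \<Gamma>" "tr_term t" "tr F"] by simp
next
  case (ExE \<Gamma> F G)
  then show ?case using ipor.ExE[of strs "tr ` \<Gamma>" "tr F" "tr G"] by (simp add: image_image)
next
  case (Refl \<Gamma> t)
  show ?case using ipor.Refl[OF str_tm_tr] by simp
next
  case (Leibniz \<Gamma> t u F)
  then show ?case
    using ipor.Leibniz[of strs "tr ` \<Gamma>" "tr_term t" "tr_term u" "tr F" Str] by simp
qed

theorem mainTheorem10:
  assumes "IRS_theorem F"
  shows "IPOR_theorem (tr F)"
  using irs_sound[of "{}" F] assms by (simp add: IRS_theorem_def IPOR_theorem_def strs_def)

end
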